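(* (1) (Lawson and Steinberg) Let $\mathcal{G}$ be an ordered groupoid with an Ehresmann topology $T$. The category of sheaves on the Ehresmann site $(\mathcal{G},T)$ is equivalent to the category of sheaves on the left-cancellative Grothendieck site $(\mathbf{L}(\mathcal{G}),J_T)$. (2) Let $\mathcal{C}$ be a left-cancellative category with a Grothendieck topology $J$. The category of sheaves on the left-cancellative site $(\mathcal{C},J)$ is equivalent to the category of sheaves on the Ehresmann site $(\mathbf{G}(\mathcal{C}),T_J)$.
   Context: All categories are small. A category is left-cancellative if all its arrows are monomorphisms; a left-cancellative site is a left-cancellative category with a Grothendieck topology, and sheaves on it are sheaves of sets in the usual sense. An ordered groupoid is a groupoid $\mathcal{G}$ with a partial order $\le$ on its arrows, inducing one on objects via identities, such that: $a\le b$ implies $a^{-1}\le b^{-1}$; $a\le b$ and $c\le d$ imply $ac\le bd$ when both composites are defined; and for each $f\colon A\to B$ and $A'\le A$ there is a unique arrow $f|_{A'}\colon A'\to B'$ with domain $A'$ and $f|_{A'}\le f$. Groupoid arrows are called horizontal; relations $A'\le A$ are called vertical arrows. A vertical sieve on an object $A$ is a downward closed subset of $\downarrow A=\{A'\mid A'\le A\}$. For a vertical sieve $\mathcal{B}$ on $B$ and a horizontal $f\colon A\to B'$ with $B'\le B$, $f^*\mathcal{B}=\{A'\le A\mid \mathrm{cod}(f|_{A'})\in\mathcal{B}\}$. An Ehresmann topology $T$ on $\mathcal{G}$ assigns to each object $A$ a collection $T(A)$ of vertical sieves on $A$ such that: (ET.1) $\downarrow A\in T(A)$; (ET.2) if $\mathcal{B}\in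 T(B)$ and $f\colon A\to B'$ with $B'\le B$, then $f^*\mathcal{B}\in T(A)$; (ET.3) if $\mathcal{A}\in T(A)$ and $\mathcal{B}$ is a vertical sieve on $A$ such that $f^*\mathcal{B}\in T(C)$ for every $f\colon C\to A'$ with $A'\in\mathcal{A}$, then $\mathcal{B}\in T(A)$. An Ehresmann site is an ordered groupoid with an Ehresmann topology. A presheaf $F$ on $\mathcal{G}$ assigns to each object $A$ a set $F(A)$, to each horizontal $f\colon A\to B$ a function $F(f)\colon F(B)\to F(A)$ and to each $A'\le A$ a function $F(A)\to F(A')$ (written $x\mapsto x|_{A'}$), both contravariantly functorial, such that each relation $f'\le f$ (with $f'\colon A'\to B'$, $f\colon A\to B$) gives a commutative square $F(f')(x|_{B'})=(F(f)(x))|_{A'}$. Morphisms are families of functions natural in both horizontal and vertical arrows. $F$ is a sheaf for $T$ if for every $\mathcal{A}\in T(A)$ and every matching family $(x_{A'}\in F(A'))_{A'\in\mathcal{A}}$ (i.e. $x_{A'}|_{A''}=x_{A''}$ whenever $A''\le A'$ in $\mathcal{A}$) there is a unique $x\in F(A)$ with $x|_{A'}=x_{A'}$ for all $A'\in\mathcal{A}$. Sheaves form a full subcategory of presheaves. For an ordered groupoid $\mathcal{G}$, $\mathbf{L}(\mathcal{G})$ is the left-cancellative category with the same objects as $\mathcal{G}$, in which an arrow $A\to B$ is a formal composite $A\xrightarrow{h}B'\le B$ of a horizontal arrow $h\colon A\to B'$ and a vertical arrow $B'\le B$; the composite of $A\xrightarrow{h}B'\le B$ with $B\xrightarrow{k}C'\le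 C$ is $A\xrightarrow{k|_{B'}h}C''\le C$, where $C''=\mathrm{cod}(k|_{B'})$. The Grothendieck topology $J_T$ on $\mathbf{L}(\mathcal{G})$ is given by: a sieve $\{B_i\xrightarrow{m_i}A'_i\le A\mid i\in I\}$ is in $J_T(A)$ if and only if $\{A'_i\le A\mid i\in I\}\in T(A)$. For a left-cancellative category $\mathcal{C}$, $\mathbf{G}(\mathcal{C})$ is the ordered groupoid whose objects are subobjects $[m\colon A\to B]$ in $\mathcal{C}$ (with $[m]=[m']$ iff $m=m'k$ for an isomorphism $k$); whose horizontal arrows $[m]\to[n]$ are classes $[m,n]$ of spans $B\xleftarrow{m}A\xrightarrow{n}C$ modulo isomorphism of the apex, the composite of $[k,m]$ and $[m',n]$ with $m=m'h$, $h$ an isomorphism, being $[k,nh]$; with $[n]\le[n']$ iff $n=n'h$ for some $h$, and $[m,n]\le[m',n']$ iff $m=m'h$ and $n=n'h$ for some common arrow $h$. The Ehresmann topology $T_J$ on $\mathbf{G}(\mathcal{C})$ is given by $T_J([m\colon A\to B])=\{[mS]\mid S\in J(A)\}$, where $[mS]=\{[mn]\le[m]\mid n\in S\}$. *)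

theory Defs
  imports Main "HOL-Library.FuncSet"
begin

section \<open>Small categories\<close>

record ('o, 'a) cat =
  Obj :: "'o set"
  Arr :: "'a set"
  Dom :: "'a \<Rightarrow> 'o"
  Cod :: "'a \<Rightarrow> 'o"
  Ide :: "'o \<Rightarrow> 'a"
  Cmp :: "'a \<Rightarrow> 'a \<Rightarrow> 'a" (infixl "\<cdot>\<index>" 70)

text \<open>\<open>g \<cdot> f\<close> is ``\<open>g\<close> after \<open>f\<close>''; it is meaningful only when \<open>Dom C g = Cod C f\<close>.\<close>

locale category =
  fixes C :: "('o, 'a, 'm) cat_scheme" (structure)
  assumes Dom_in: "f \<in> Arr C \<Longrightarrow> Dom C f \<in> Obj C"
    and Cod_in: "f \<in> Arr C \<Longrightarrow> Cod C f \<in> Obj C"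
    and Ide_in: "A \<in> Obj C \<Longrightarrow> Ide C A \<in> Arr C"
    and Dom_Ide: "A \<in> Obj C \<Longrightarrow> Dom C (Ide C A) = A"
    and Cod_Ide: "A \<in> Obj C \<Longrightarrow> Cod C (Ide C A) = A"
    and Cmp_in: "\<lbrakk>f \<in> Arr C; g \<in> Arr C; Dom C g = Cod C f\<rbrakk> \<Longrightarrow> g \<cdot> f \<in> Arr C"
    and Dom_Cmp: "\<lbrakk>f \<in> Arr C; g \<in> Arr C; Dom C g = Cod C f\<rbrakk> \<Longrightarrow> Dom C (g \<cdot> f) = Dom C f"
    and Cod_Cmp: "\<lbrakk>f \<in> Arr C; g \<in> Arr C; Dom C g = Cod C f\<rbrakk> \<Longrightarrow> Cod C (g \<cdot> f) = Cod C g"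
    and Cmp_Ide_right: "f \<in> Arr C \<Longrightarrow> f \<cdot> Ide C (Dom C f) = f"
    and Cmp_Ide_left: "f \<in> Arr C \<Longrightarrow> Ide C (Cod C f) \<cdot> f = f"
    and Cmp_assoc: "\<lbrakk>f \<in> Arr C; g \<in> Arr C; h \<in> Arr C; Dom C g = Cod C f; Dom C h = Cod C g\<rbrakk>
      \<Longrightarrow> (h \<cdot> g) \<cdot> f = h \<cdot> (g \<cdot> f)"

definition inverse_arrows :: "('o, 'a, 'm) cat_scheme \<Rightarrow> 'a \<Rightarrow> 'a \<Rightarrow> bool" where
  "inverse_arrows C f g \<longleftrightarrow> f \<in> Arr C \<and> g \<in> Arr C \<and> Dom C g = Cod C f \<and> Cod C g = Dom C f \<and>
     g \<cdot>\<^bsub>C\<^esub> f = Ide C (Dom C f) \<and> f \<cdot>\<^bsub>C\<^esub> g = Ide C (Cod C f)"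

definition iso_arrow :: "('o, 'a, 'm) cat_scheme \<Rightarrow> 'a \<Rightarrow> bool" where
  "iso_arrow C f \<longleftrightarrow> (\<exists>g. inverse_arrows C f g)"

definition inv_arrow :: "('o, 'a, 'm) cat_scheme \<Rightarrow> 'a \<Rightarrow> 'a" where
  "inv_arrow C f = (THE g. inverse_arrows C f g)"

definition mono_arrow :: "('o, 'a, 'm) cat_scheme \<Rightarrow> 'a \<Rightarrow> bool" where
  "mono_arrow C m \<longleftrightarrow> m \<in> Arr C \<and>
     (\<forall>f\<in>Arr C. \<forall>g\<in>Arr C. Cod C f = Dom C m \<longrightarrow> Cod C g = Dom C m \<longrightarrow> Dom C f = Dom C g \<longrightarrow>
        m \<cdot>\<^bsub>C\<^esub> f = m \<cdot>\<^bsub>C\<^esub> g \<longrightarrow> f = g)"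

locale left_cancellative_category = category +
  assumes mono: "m \<in> Arr C \<Longrightarrow> mono_arrow C m"

definition full_subcat :: "('o, 'a) cat \<Rightarrow> ('o \<Rightarrow> bool) \<Rightarrow> ('o, 'a) cat" where
  "full_subcat C P = C\<lparr>Obj := {A \<in> Obj C. P A}, Arr := {f \<in> Arr C. P (Dom C f) \<and> P (Cod C f)}\<rparr>"


section \<open>Functors and equivalence of categories\<close>

record ('o, 'a, 'p, 'b) fctr =
  FObj :: "'o \<Rightarrow> 'p"
  FArr :: "'a \<Rightarrow> 'b"

locale is_functor = C: category C + D: category D
  for C :: "('o, 'a) cat" and D :: "('p, 'b) cat" +
  fixes F :: "('o, 'a, 'p, 'b) fctr"
  assumes FObj_in: "A \<in> Obj C \<Longrightarrow> FObj F A \<in> Obj D"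
    and FArr_in: "f \<in> Arr C \<Longrightarrow> FArr F f \<in> Arr D"
    and Dom_FArr: "f \<in> Arr C \<Longrightarrow> Dom D (FArr F f) = FObj F (Dom C f)"
    and Cod_FArr: "f \<in> Arr C \<Longrightarrow> Cod D (FArr F f) = FObj F (Cod C f)"
    and FArr_Ide: "A \<in> Obj C \<Longrightarrow> FArr F (Ide C A) = Ide D (FObj F A)"
    and FArr_Cmp: "\<lbrakk>f \<in> Arr C; g \<in> Arr C; Dom C g = Cod C f\<rbrakk>
      \<Longrightarrow> FArr F (g \<cdot>\<^bsub>C\<^esub> f) = FArr F g \<cdot>\<^bsub>D\<^esub> FArr F f"

definition id_fctr :: "('o, 'a, 'o, 'a) fctr" where
  "id_fctr = \<lparr>FObj = (\<lambda>A. A), FArr = (\<lambda>f. f)\<rparr>"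

definition comp_fctr ::
    "('p, 'b, 'q, 'c) fctr \<Rightarrow> ('o, 'a, 'p, 'b) fctr \<Rightarrow> ('o, 'a, 'q, 'c) fctr" where
  "comp_fctr G F = \<lparr>FObj = FObj G \<circ> FObj F, FArr = FArr G \<circ> FArr F\<rparr>"

definition natural_iso :: "('o, 'a) cat \<Rightarrow> ('p, 'b) cat \<Rightarrow>
    ('o, 'a, 'p, 'b) fctr \<Rightarrow> ('o, 'a, 'p, 'b) fctr \<Rightarrow> ('o \<Rightarrow> 'b) \<Rightarrow> bool" where
  "natural_iso C D F G \<eta> \<longleftrightarrow>
     (\<forall>A\<in>Obj C. iso_arrow D (\<eta> A) \<and> Dom D (\<eta> A) = FObj F A \<and> Cod D (\<eta> A) = FObj G A) \<and>
     (\<forall>f\<in>Arr C. \<eta> (Cod C f) \<cdot>\<^bsub>D\<^esub> FArr F f = FArr G f \<cdot>\<^bsub>D\<^esub> \<eta> (Dom C f))"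

definition equivalent_categories :: "('o, 'a) cat \<Rightarrow> ('p, 'b) cat \<Rightarrow> bool" where
  "equivalent_categories C D \<longleftrightarrow> (\<exists>F G \<eta> \<epsilon>. is_functor C D F \<and> is_functor D C G \<and>
     natural_iso C C id_fctr (comp_fctr G F) \<eta> \<and> natural_iso D D (comp_fctr F G) id_fctr \<epsilon>)"


section \<open>Grothendieck sites and their sheaves\<close>

definition sieve :: "('o, 'a, 'm) cat_scheme \<Rightarrow> 'o \<Rightarrow> 'a set \<Rightarrow> bool" where
  "sieve C A S \<longleftrightarrow> S \<subseteq> {f \<in> Arr C. Cod C f = A} \<and>
     (\<forall>f\<in>S. \<forall>g\<in>Arr C. Cod C g = Dom C f \<longrightarrow> f \<cdot>\<^bsub>C\<^esub> g \<in> S)"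

definition pullback_sieve :: "('o, 'a, 'm) cat_scheme \<Rightarrow> 'a \<Rightarrow> 'a set \<Rightarrow> 'a set" where
  "pullback_sieve C f S = {g \<in> Arr C. Cod C g = Dom C f \<and> f \<cdot>\<^bsub>C\<^esub> g \<in> S}"

locale grothendieck_site = category +
  fixes J :: "'o \<Rightarrow> 'a set set"
  assumes covering_sieve: "\<lbrakk>A \<in> Obj C; S \<in> J A\<rbrakk> \<Longrightarrow> sieve C A S"
    and covering_maximal: "A \<in> Obj C \<Longrightarrow> {f \<in> Arr C. Cod C f = A} \<in> J A"
    and covering_stable: "\<lbrakk>f \<in> Arr C; S \<in> J (Cod C f)\<rbrakk> \<Longrightarrow> pullback_sieve C f S \<in> J (Dom C f)"
    and covering_transitive:
      "\<lbrakk>A \<in> Obj C; S \<in> J A; sieve C A R; \<And>f. f \<in> S \<Longrightarrow> pullback_sieve C f R \<in> J (Dom C f)\<rbrakk>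
        \<Longrightarrow> R \<in> J A"

locale left_cancellative_site = left_cancellative_category + grothendieck_site

text \<open>
  Presheaves take values in the subsets of a type \<open>'s\<close>, which plays the role of the universe of
  sets.  All set-theoretic functions (on objects, arrows and elements) are extensional, that is,
  equal to \<^const>\<open>undefined\<close> outside their domain, so that presheaves and their morphisms
  are equal iff they are equal in the usual sense.
\<close>

record ('o, 'a, 's) psh =
  Sec :: "'o \<Rightarrow> 's set"
  Act :: "'a \<Rightarrow> 's \<Rightarrow> 's"

definition presheaf :: "('o, 'a, 'm) cat_scheme \<Rightarrow> ('o, 'a, 's, 'n) psh_scheme \<Rightarrow> bool" where
  "presheaf C F \<longleftrightarrow>
     Sec F \<in> extensional (Obj C) \<and>
     Act F \<in> (\<Pi>\<^sub>E f\<in>Arr C. Sec F (Cod C f) \<rightarrow>\<^sub>E Sec F (Dom C f)) \<and>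
     (\<forall>A\<in>Obj C. \<forall>x\<in>Sec F A. Act F (Ide C A) x = x) \<and>
     (\<forall>f\<in>Arr C. \<forall>g\<in>Arr C. Dom C g = Cod C f \<longrightarrow>
        (\<forall>x\<in>Sec F (Cod C g). Act F (g \<cdot>\<^bsub>C\<^esub> f) x = Act F f (Act F g x)))"

definition presheaf_morphism :: "('o, 'a, 'm) cat_scheme \<Rightarrow>
    ('o, 'a, 's, 'n) psh_scheme \<Rightarrow> ('o, 'a, 's, 'n) psh_scheme \<Rightarrow> ('o \<Rightarrow> 's \<Rightarrow> 's) \<Rightarrow> bool" where
  "presheaf_morphism C F G \<alpha> \<longleftrightarrow>
     \<alpha> \<in> (\<Pi>\<^sub>E A\<in>Obj C. Sec F A \<rightarrow>\<^sub>E Sec G A) \<and>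
     (\<forall>f\<in>Arr C. \<forall>x\<in>Sec F (Cod C f). \<alpha> (Dom C f) (Act F f x) = Act G f (\<alpha> (Cod C f) x))"

text \<open>
  The category whose objects are the \<open>F\<close> with \<open>P F\<close> and whose arrows \<open>F \<rightarrow> G\<close> are the triples
  \<open>(F, G, \<alpha>)\<close> with \<open>M F G \<alpha>\<close>; identities and composition are taken componentwise over the objects in \<open>X\<close>.
\<close>

definition family_category :: "'o set \<Rightarrow> (('o, 'a, 's, 'n) psh_scheme \<Rightarrow> bool) \<Rightarrow>
    (('o, 'a, 's, 'n) psh_scheme \<Rightarrow> ('o, 'a, 's, 'n) psh_scheme \<Rightarrow> ('o \<Rightarrow> 's \<Rightarrow> 's) \<Rightarrow> bool) \<Rightarrow>
    (('o, 'a, 's, 'n) psh_scheme,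
     ('o, 'a, 's, 'n) psh_scheme \<times> ('o, 'a, 's, 'n) psh_scheme \<times> ('o \<Rightarrow> 's \<Rightarrow> 's)) cat" where
  "family_category X P M = \<lparr>
     Obj = {F. P F},
     Arr = {(F, G, \<alpha>). P F \<and> P G \<and> M F G \<alpha>},
     Dom = (\<lambda>(F, G, \<alpha>). F),
     Cod = (\<lambda>(F, G, \<alpha>). G),
     Ide = (\<lambda>F. (F, F, \<lambda>A\<in>X. \<lambda>x\<in>Sec F A. x)),
     Cmp = (\<lambda>(G', H, \<beta>) (F, G, \<alpha>). (F, H, \<lambda>A\<in>X. compose (Sec F A) (\<beta> A) (\<alpha> A)))\<rparr>"

type_synonym ('o, 'a, 's) psh_cat =
  "(('o, 'a, 's) psh, ('o, 'a, 's) psh \<times> ('o, 'a, 's) psh \<times> ('o \<Rightarrow> 's \<Rightarrow> 's)) cat"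

definition presheaf_category :: "('o, 'a, 'm) cat_scheme \<Rightarrow>
    ('o, 'a, 's) psh_cat" where
  "presheaf_category C = family_category (Obj C) (presheaf C) (presheaf_morphism C)"

definition matching_family ::
    "('o, 'a, 'm) cat_scheme \<Rightarrow> ('o, 'a, 's) psh \<Rightarrow> 'a set \<Rightarrow> ('a \<Rightarrow> 's) \<Rightarrow> bool" where
  "matching_family C F S x \<longleftrightarrow> (\<forall>f\<in>S. x f \<in> Sec F (Dom C f)) \<and>
     (\<forall>f\<in>S. \<forall>g\<in>Arr C. Cod C g = Dom C f \<longrightarrow> Act F g (x f) = x (f \<cdot>\<^bsub>C\<^esub> g))"

definition sheaf :: "('o, 'a, 'm) cat_scheme \<Rightarrow> ('o \<Rightarrow> 'a set set) \<Rightarrow> ('o, 'a, 's) psh \<Rightarrow> bool" where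
  "sheaf C J F \<longleftrightarrow> presheaf C F \<and>
     (\<forall>A\<in>Obj C. \<forall>S\<in>J A. \<forall>x. matching_family C F S x \<longrightarrow>
        (\<exists>!s. s \<in> Sec F A \<and> (\<forall>f\<in>S. Act F f s = x f)))"

definition sheaf_category :: "('o, 'a, 'm) cat_scheme \<Rightarrow> ('o \<Rightarrow> 'a set set) \<Rightarrow>
    ('o, 'a, 's) psh_cat" where
  "sheaf_category C J = full_subcat (presheaf_category C) (sheaf C J)"


section \<open>Ordered groupoids\<close>

record ('o, 'a) ogpd = "('o, 'a) cat" +
  Ord :: "('a \<times> 'a) set"

definition leA :: "('o, 'a, 'm) ogpd_scheme \<Rightarrow> 'a \<Rightarrow> 'a \<Rightarrow> bool" where
  "leA G f g \<longleftrightarrow> (f, g) \<in> Ord G"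

definition leO :: "('o, 'a, 'm) ogpd_scheme \<Rightarrow> 'o \<Rightarrow> 'o \<Rightarrow> bool" where
  "leO G A B \<longleftrightarrow> A \<in> Obj G \<and> B \<in> Obj G \<and> leA G (Ide G A) (Ide G B)"

locale ordered_groupoid = category G
  for G :: "('o, 'a, 'm) ogpd_scheme" (structure) +
  assumes groupoid: "f \<in> Arr G \<Longrightarrow> iso_arrow G f"
    and order: "partial_order_on (Arr G) (Ord G)"
    and inv_mono: "leA G a b \<Longrightarrow> leA G (inv_arrow G a) (inv_arrow G b)"
    and Cmp_mono: "\<lbrakk>leA G a b; leA G c d; Dom G a = Cod G c; Dom G b = Cod G d\<rbrakk>
      \<Longrightarrow> leA G (a \<cdot> c) (b \<cdot> d)"
    and restriction: "\<lbrakk>f \<in> Arr G; leO G A' (Dom G f)\<rbrakk> \<Longrightarrow> \<exists>!f'. leA G f' f \<and> Dom G f' = A'"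

definition restr :: "('o, 'a, 'm) ogpd_scheme \<Rightarrow> 'a \<Rightarrow> 'o \<Rightarrow> 'a" where
  "restr G f A' = (THE f'. leA G f' f \<and> Dom G f' = A')"


section \<open>Ehresmann sites and their sheaves\<close>

definition down :: "('o, 'a, 'm) ogpd_scheme \<Rightarrow> 'o \<Rightarrow> 'o set" where
  "down G A = {A'. leO G A' A}"

definition vertical_sieve :: "('o, 'a, 'm) ogpd_scheme \<Rightarrow> 'o \<Rightarrow> 'o set \<Rightarrow> bool" where
  "vertical_sieve G A \<B> \<longleftrightarrow> \<B> \<subseteq> down G A \<and> (\<forall>A'\<in>\<B>. \<forall>A''. leO G A'' A' \<longrightarrow> A'' \<in> \<B>)"

definition pullback_vertical :: "('o, 'a, 'm) ogpd_scheme \<Rightarrow> 'a \<Rightarrow> 'o set \<Rightarrow> 'o set" where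
  "pullback_vertical G f \<B> = {A'. leO G A' (Dom G f) \<and> Cod G (restr G f A') \<in> \<B>}"

locale ehresmann_site = ordered_groupoid +
  fixes T :: "'o \<Rightarrow> 'o set set"
  assumes ET0: "\<lbrakk>A \<in> Obj G; \<A> \<in> T A\<rbrakk> \<Longrightarrow> vertical_sieve G A \<A>"
    and ET1: "A \<in> Obj G \<Longrightarrow> down G A \<in> T A"
    and ET2: "\<lbrakk>B \<in> Obj G; \<B> \<in> T B; f \<in> Arr G; leO G (Cod G f) B\<rbrakk>
      \<Longrightarrow> pullback_vertical G f \<B> \<in> T (Dom G f)"
    and ET3: "\<lbrakk>A \<in> Obj G; \<A> \<in> T A; vertical_sieve G A \<B>;
        \<And>f. \<lbrakk>f \<in> Arr G; Cod G f \<in> \<A>\<rbrakk> \<Longrightarrow> pullback_vertical G f \<B> \<in> T (Dom G f)\<rbrakk>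
      \<Longrightarrow> \<B> \<in> T A"

text \<open>\<open>Res F (A', A)\<close> is the restriction \<open>Sec F A \<rightarrow> Sec F A'\<close> along \<open>A' \<le> A\<close>; the inherited field
  \<^const>\<open>Act\<close> is the action of the horizontal arrows.\<close>

record ('o, 'a, 's) opsh = "('o, 'a, 's) psh" +
  Res :: "'o \<times> 'o \<Rightarrow> 's \<Rightarrow> 's"

definition ordered_presheaf :: "('o, 'a, 'm) ogpd_scheme \<Rightarrow> ('o, 'a, 's) opsh \<Rightarrow> bool" where
  "ordered_presheaf G F \<longleftrightarrow> presheaf G F \<and>
     Res F \<in> (\<Pi>\<^sub>E (A', A)\<in>{(A', A). leO G A' A}. Sec F A \<rightarrow>\<^sub>E Sec F A') \<and>
     (\<forall>A\<in>Obj G. \<forall>x\<in>Sec F A. Res F (A, A) x = x) \<and>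
     (\<forall>A'' A' A. leO G A'' A' \<longrightarrow> leO G A' A \<longrightarrow>
        (\<forall>x\<in>Sec F A. Res F (A'', A') (Res F (A', A) x) = Res F (A'', A) x)) \<and>
     (\<forall>f' f. leA G f' f \<longrightarrow> (\<forall>x\<in>Sec F (Cod G f).
        Act F f' (Res F (Cod G f', Cod G f) x) = Res F (Dom G f', Dom G f) (Act F f x)))"

definition ordered_presheaf_morphism :: "('o, 'a, 'm) ogpd_scheme \<Rightarrow>
    ('o, 'a, 's) opsh \<Rightarrow> ('o, 'a, 's) opsh \<Rightarrow> ('o \<Rightarrow> 's \<Rightarrow> 's) \<Rightarrow> bool" where
  "ordered_presheaf_morphism G F F' \<alpha> \<longleftrightarrow> presheaf_morphism G F F' \<alpha> \<and>
     (\<forall>A' A. leO G A' A \<longrightarrow> (\<forall>x\<in>Sec F A. \<alpha> A' (Res F (A', A) x) = Res F' (A', A) (\<alpha> A x)))"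

type_synonym ('o, 'a, 's) opsh_cat =
  "(('o, 'a, 's) opsh, ('o, 'a, 's) opsh \<times> ('o, 'a, 's) opsh \<times> ('o \<Rightarrow> 's \<Rightarrow> 's)) cat"

definition ordered_presheaf_category :: "('o, 'a, 'm) ogpd_scheme \<Rightarrow>
    ('o, 'a, 's) opsh_cat" where
  "ordered_presheaf_category G =
     family_category (Obj G) (ordered_presheaf G) (ordered_presheaf_morphism G)"

definition vertical_matching_family ::
    "('o, 'a, 'm) ogpd_scheme \<Rightarrow> ('o, 'a, 's) opsh \<Rightarrow> 'o set \<Rightarrow> ('o \<Rightarrow> 's) \<Rightarrow> bool" where
  "vertical_matching_family G F \<A> x \<longleftrightarrow> (\<forall>A'\<in>\<A>. x A' \<in> Sec F A') \<and>
     (\<forall>A'\<in>\<A>. \<forall>A''\<in>\<A>. leO G A'' A' \<longrightarrow> Res F (A'', A') (x A') = x A'')"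

definition ehresmann_sheaf ::
    "('o, 'a, 'm) ogpd_scheme \<Rightarrow> ('o \<Rightarrow> 'o set set) \<Rightarrow> ('o, 'a, 's) opsh \<Rightarrow> bool" where
  "ehresmann_sheaf G T F \<longleftrightarrow> ordered_presheaf G F \<and>
     (\<forall>A\<in>Obj G. \<forall>\<A>\<in>T A. \<forall>x. vertical_matching_family G F \<A> x \<longrightarrow>
        (\<exists>!s. s \<in> Sec F A \<and> (\<forall>A'\<in>\<A>. Res F (A', A) s = x A')))"

definition ehresmann_sheaf_category :: "('o, 'a, 'm) ogpd_scheme \<Rightarrow> ('o \<Rightarrow> 'o set set) \<Rightarrow>
    ('o, 'a, 's) opsh_cat" where
  "ehresmann_sheaf_category G T = full_subcat (ordered_presheaf_category G) (ehresmann_sheaf G T)"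


section \<open>From Ehresmann sites to left-cancellative sites\<close>

text \<open>The formal composite of \<open>h : A \<rightarrow> B'\<close> and \<open>B' \<le> B\<close> is encoded as the pair \<open>(h, B)\<close>.\<close>

definition Lcat :: "('o, 'a, 'm) ogpd_scheme \<Rightarrow> ('o, 'a \<times> 'o) cat" where
  "Lcat G = \<lparr>
     Obj = Obj G,
     Arr = {(h, B). h \<in> Arr G \<and> leO G (Cod G h) B},
     Dom = (\<lambda>(h, B). Dom G h),
     Cod = (\<lambda>(h, B). B),
     Ide = (\<lambda>A. (Ide G A, A)),
     Cmp = (\<lambda>(k, C) (h, B). (restr G k (Cod G h) \<cdot>\<^bsub>G\<^esub> h, C))\<rparr>"

definition Jtop :: "('o, 'a, 'm) ogpd_scheme \<Rightarrow> ('o \<Rightarrow> 'o set set) \<Rightarrow> 'o \<Rightarrow> ('a \<times> 'o) set set" where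
  "Jtop G T A = {S. sieve (Lcat G) A S \<and> {Cod G m | m. (m, A) \<in> S} \<in> T A}"


section \<open>From left-cancellative sites to Ehresmann sites\<close>

definition subobj :: "('o, 'a, 'm) cat_scheme \<Rightarrow> 'a \<Rightarrow> 'a set" where
  "subobj C m = {m \<cdot>\<^bsub>C\<^esub> k | k. iso_arrow C k \<and> Cod C k = Dom C m}"

definition span_class :: "('o, 'a, 'm) cat_scheme \<Rightarrow> 'a \<Rightarrow> 'a \<Rightarrow> ('a \<times> 'a) set" where
  "span_class C m n = {(m \<cdot>\<^bsub>C\<^esub> k, n \<cdot>\<^bsub>C\<^esub> k) | k. iso_arrow C k \<and> Cod C k = Dom C m}"

text \<open>
  Objects and arrows are equivalence classes, and the operations are written without choosing
  representatives: \<open>Domain (span_class C m n) = subobj C m\<close>, \<open>Range (span_class C m n) = subobj C n\<close>,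
  \<open>Id_on (subobj C m) = span_class C m m\<close>, and collecting \<open>(k, n \<cdot> h)\<close> over all representatives
  \<open>(k, m' \<cdot> h)\<close>, \<open>(m', n)\<close> of two composable classes yields exactly the class of the composite.
\<close>

definition Ggpd :: "('o, 'a, 'm) cat_scheme \<Rightarrow> ('a set, ('a \<times> 'a) set) ogpd" where
  "Ggpd C = \<lparr>
     Obj = {subobj C m | m. m \<in> Arr C},
     Arr = {span_class C m n | m n. m \<in> Arr C \<and> n \<in> Arr C \<and> Dom C m = Dom C n},
     Dom = Domain,
     Cod = Range,
     Ide = Id_on,
     Cmp = (\<lambda>Q P. {(k, n \<cdot>\<^bsub>C\<^esub> h) | k m m' n h.
        (k, m) \<in> P \<and> (m', n) \<in> Q \<and> iso_arrow C h \<and> Cod C h = Dom C m' \<and> m = m' \<cdot>\<^bsub>C\<^esub> h}),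
     Ord = {(span_class C (m' \<cdot>\<^bsub>C\<^esub> h) (n' \<cdot>\<^bsub>C\<^esub> h), span_class C m' n') | m' n' h.
        m' \<in> Arr C \<and> n' \<in> Arr C \<and> Dom C m' = Dom C n' \<and> h \<in> Arr C \<and> Cod C h = Dom C m'}\<rparr>"

text \<open>\<open>M\<close> is a subobject; the topology does not depend on the representative \<open>m \<in> M\<close>.\<close>

definition Ttop :: "('o, 'a, 'm) cat_scheme \<Rightarrow> ('o \<Rightarrow> 'a set set) \<Rightarrow> 'a set \<Rightarrow> 'a set set set" where
  "Ttop C J M = {{subobj C (m \<cdot>\<^bsub>C\<^esub> n) | n. n \<in> S} | m S. m \<in> M \<and> S \<in> J (Dom C m)}"

end

theory Submission
  imports Defs
begin

text \<open>
  A sieve on \<open>A\<close> in \<open>L(G)\<close> is determined by the vertical sieve of the codomains of its horizontal parts, because it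
  is closed under precomposition with the (invertible) horizontal arrows; restriction along \<open>A' \<le> A\<close> and the action
  of horizontal arrows are the actions of the two kinds of factors of an arrow of \<open>L(G)\<close>.  Hence part (1) is even
  an isomorphism of categories.  For part (2), \<open>C\<close> is equivalent to \<open>L(G(C))\<close> by sending \<open>A\<close> to the subobject
  \<open>[id\<^sub>A]\<close>, in such a way that covering sieves correspond to each other; pulling back along this equivalence and
  its quasi-inverse identifies the sheaves on both sites, and part (1) applies to \<open>G(C)\<close>.
\<close>


section \<open>Isomorphisms and equivalences\<close>

text \<open>Part (1) is an equality of data: functions are extensional, so translating a presheaf
  forth and back returns the same record. Part (2) cannot be that strict. An object of
  \<open>G(C)\<close> is a class of monomorphisms, so a functor from \<open>L(G(C))\<close> to
  \<open>C\<close> has to choose representatives. The choice makes one composite the identity on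
  \<open>C\<close>, which leaves a single nontrivial natural isomorphism; its component at
  \<open>[m]\<close> is the class of the span \<open>(m, id)\<close> from \<open>[m]\<close> to
  \<open>[id]\<close>, invertible because both legs have the same domain. Left cancellation is what
  lets a span class with legs \<open>a\<close> and \<open>n h\<close> determine \<open>h\<close>.
  The correspondence of covers is split into two conditions, one per functor: the sieve generated by
  the image of a covering sieve covers. The obstacle is to extend a matching family to this
  generated sieve, whose members may have domains outside the image of the functor; they are reached
  by precomposing with isomorphisms.\<close>

context category
begin

lemma inverse_arrows_sym: "inverse_arrows C f g \<Longrightarrow> inverse_arrows C g f"
  by (auto simp: inverse_arrows_def)

lemma inverse_arrows_unique:
  assumes "inverse_arrows C f g" "inverse_arrows C f g'"
  shows "g = g'"
proof -
  note * = assms[unfolded inverse_arrows_def]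
  have "g = g \<cdot> (f \<cdot> g')"
    using * Cmp_Ide_right[of g] by simp
  also have "\<dots> = (g \<cdot> f) \<cdot> g'"
    by (rule Cmp_assoc[symmetric]) (use * in simp_all)
  also have "\<dots> = g'"
    using * Cmp_Ide_left[of g'] by simp
  finally show ?thesis .
qed

lemma inv_arrow_eq: "inverse_arrows C f g \<Longrightarrow> inv_arrow C f = g"
  unfolding inv_arrow_def by (rule the_equality) (auto intro: inverse_arrows_unique)

lemma inverse_arrows_inv_arrow: "iso_arrow C f \<Longrightarrow> inverse_arrows C f (inv_arrow C f)"
  unfolding iso_arrow_def by (metis inv_arrow_eq)

lemma iso_in: "iso_arrow C f \<Longrightarrow> f \<in> Arr C"
  by (auto simp: iso_arrow_def inverse_arrows_def)

lemma iso_inv_arrow: "iso_arrow C f \<Longrightarrow> iso_arrow C (inv_arrow C f)"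
  unfolding iso_arrow_def[of _ "inv_arrow C f"]
  by (blast intro: inverse_arrows_sym inverse_arrows_inv_arrow)

lemma inv_arrow:
  assumes "iso_arrow C f"
  shows "inv_arrow C f \<in> Arr C" "Dom C (inv_arrow C f) = Cod C f" "Cod C (inv_arrow C f) = Dom C f"
    and "inv_arrow C f \<cdot> f = Ide C (Dom C f)" "f \<cdot> inv_arrow C f = Ide C (Cod C f)"
  using inverse_arrows_inv_arrow[OF assms] by (auto simp: inverse_arrows_def)

lemma inverse_arrows_Ide: "A \<in> Obj C \<Longrightarrow> inverse_arrows C (Ide C A) (Ide C A)"
  using Cmp_Ide_left[of "Ide C A"] by (simp add: inverse_arrows_def Ide_in Dom_Ide Cod_Ide)

lemma iso_Ide: "A \<in> Obj C \<Longrightarrow> iso_arrow C (Ide C A)"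
  by (metis iso_arrow_def inverse_arrows_Ide)

lemma inverse_arrows_Cmp:
  assumes f: "inverse_arrows C f f'" and g: "inverse_arrows C g g'" and "Dom C g = Cod C f"
  shows "inverse_arrows C (g \<cdot> f) (f' \<cdot> g')"
proof -
  note * = assms[unfolded inverse_arrows_def]
  note simps = Cmp_in Dom_Cmp Cod_Cmp
  have "(f' \<cdot> g') \<cdot> (g \<cdot> f) = f' \<cdot> (g' \<cdot> (g \<cdot> f))"
    by (rule Cmp_assoc) (use * in \<open>simp_all add: simps\<close>)
  also have "g' \<cdot> (g \<cdot> f) = (g' \<cdot> g) \<cdot> f"
    by (rule Cmp_assoc[symmetric]) (use * in simp_all)
  also have "\<dots> = f"
    using * Cmp_Ide_left[of f] by simp
  finally have 1: "(f' \<cdot> g') \<cdot> (g \<cdot> f) = Ide C (Dom C (g \<cdot> f))"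
    using * by (simp add: simps)
  have "(g \<cdot> f) \<cdot> (f' \<cdot> g') = g \<cdot> (f \<cdot> (f' \<cdot> g'))"
    by (rule Cmp_assoc) (use * in \<open>simp_all add: simps\<close>)
  also have "f \<cdot> (f' \<cdot> g') = (f \<cdot> f') \<cdot> g'"
    by (rule Cmp_assoc[symmetric]) (use * in simp_all)
  also have "\<dots> = g'"
    using * Cmp_Ide_left[of g'] by simp
  finally have 2: "(g \<cdot> f) \<cdot> (f' \<cdot> g') = Ide C (Cod C (g \<cdot> f))"
    using * by (simp add: simps)
  show ?thesis
    using * 1 2 by (simp add: inverse_arrows_def Cmp_in Dom_Cmp Cod_Cmp)
qed

lemma iso_Cmp: "\<lbrakk>iso_arrow C f; iso_arrow C g; Dom C g = Cod C f\<rbrakk> \<Longrightarrow> iso_arrow C (g \<cdot> f)"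
  by (metis iso_arrow_def inverse_arrows_Cmp)

end

lemma (in is_functor) iso_FArr: "iso_arrow C f \<Longrightarrow> iso_arrow D (FArr F f)"
proof -
  assume "iso_arrow C f"
  then obtain g where "inverse_arrows C f g"
    by (auto simp: iso_arrow_def)
  then have "inverse_arrows D (FArr F f) (FArr F g)"
    by (auto simp: inverse_arrows_def FArr_in Dom_FArr Cod_FArr C.Dom_in C.Cod_in
        simp flip: FArr_Ide FArr_Cmp)
  then show ?thesis
    by (auto simp: iso_arrow_def)
qed

section \<open>Composition of functors and of natural isomorphisms\<close>

lemma id_fctr_simps [simp]: "FObj id_fctr A = A" "FArr id_fctr f = f"
  by (simp_all add: id_fctr_def)

lemma comp_fctr_simps [simp]:
  "FObj (comp_fctr G F) A = FObj G (FObj F A)" "FArr (comp_fctr G F) f = FArr G (FArr F f)"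
  by (simp_all add: comp_fctr_def)

lemma is_functor_comp:
  assumes "is_functor C D F" "is_functor D E G"
  shows "is_functor C E (comp_fctr G F)"
proof -
  interpret F: is_functor C D F by fact
  interpret G: is_functor D E G by fact
  show ?thesis
    by unfold_locales
      (simp_all add: F.FObj_in F.FArr_in F.Dom_FArr F.Cod_FArr F.FArr_Ide F.FArr_Cmp
        G.FObj_in G.FArr_in G.Dom_FArr G.Cod_FArr G.FArr_Ide G.FArr_Cmp)
qed

text \<open>A composite that is the identity on the carriers may still differ from
  \<open>id_fctr\<close> as a HOL function elsewhere. Identity components therefore take the place
  of an equality of functors, and their naturality squares are the two unit laws.\<close>

lemma natural_iso_Ide:
  assumes "is_functor C D F" "is_functor C D G"
    and eq: "\<And>A. A \<in> Obj C \<Longrightarrow> FObj F A = FObj G A" "\<And>f. f \<in> Arr C \<Longrightarrow> FArr F f = FArr G f"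
  shows "natural_iso C D F G (\<lambda>A. Ide D (FObj F A))"
proof -
  interpret F: is_functor C D F by fact
  interpret G: is_functor C D G by fact
  have "Ide D (FObj F (Cod C f)) \<cdot>\<^bsub>D\<^esub> FArr F f = FArr G f \<cdot>\<^bsub>D\<^esub> Ide D (FObj F (Dom C f))" if "f \<in> Arr C" for f
    using F.D.Cmp_Ide_left[OF F.FArr_in[OF that]] F.D.Cmp_Ide_right[OF G.FArr_in[OF that]] that
    by (simp add: eq F.Cod_FArr G.Dom_FArr G.Cod_FArr F.C.Dom_in F.C.Cod_in)
  then show ?thesis
    by (simp add: natural_iso_def F.D.iso_Ide F.D.Dom_Ide F.D.Cod_Ide F.FObj_in G.FObj_in eq)
qed

lemma is_functor_id: "category C \<Longrightarrow> is_functor C C id_fctr"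
  by (simp add: is_functor_def is_functor_axioms_def)

lemma equivalent_categories_if_isomorphic:
  assumes F: "is_functor C D F" and G: "is_functor D C G"
    and "\<And>A. A \<in> Obj C \<Longrightarrow> FObj G (FObj F A) = A" "\<And>f. f \<in> Arr C \<Longrightarrow> FArr G (FArr F f) = f"
    and "\<And>B. B \<in> Obj D \<Longrightarrow> FObj F (FObj G B) = B" "\<And>g. g \<in> Arr D \<Longrightarrow> FArr F (FArr G g) = g"
  shows "equivalent_categories C D"
proof -
  have cat: "category C" "category D"
    using F by (simp_all add: is_functor_def)
  have "natural_iso C C id_fctr (comp_fctr G F) (Ide C)"
    using natural_iso_Ide[OF is_functor_id[OF cat(1)] is_functor_comp[OF F G]] by (simp add: assms)
  moreover have "natural_iso D D (comp_fctr F G) id_fctr (\<lambda>B. Ide D (FObj F (FObj G B)))"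
    using natural_iso_Ide[OF is_functor_comp[OF G F] is_functor_id[OF cat(2)]] by (simp add: assms)
  ultimately show ?thesis
    using F G unfolding equivalent_categories_def by blast
qed

lemma natural_iso_trans:
  assumes "is_functor C D F" "is_functor C D G" "is_functor C D H"
    and \<eta>: "natural_iso C D F G \<eta>" and \<theta>: "natural_iso C D G H \<theta>"
  shows "natural_iso C D F H (\<lambda>A. \<theta> A \<cdot>\<^bsub>D\<^esub> \<eta> A)"
proof -
  interpret F: is_functor C D F by fact
  interpret G: is_functor C D G by fact
  interpret H: is_functor C D H by fact
  have \<eta>': "iso_arrow D (\<eta> A)" "\<eta> A \<in> Arr D" "Dom D (\<eta> A) = FObj F A" "Cod D (\<eta> A) = FObj G A"
    and \<theta>': "iso_arrow D (\<theta> A)" "\<theta> A \<in> Arr D" "Dom D (\<theta> A) = FObj G A" "Cod D (\<theta> A) = FObj H A"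
    if "A \<in> Obj C" for A
    using that \<eta> \<theta> by (auto simp: natural_iso_def F.D.iso_in)
  have "(\<theta> (Cod C f) \<cdot>\<^bsub>D\<^esub> \<eta> (Cod C f)) \<cdot>\<^bsub>D\<^esub> FArr F f
      = FArr H f \<cdot>\<^bsub>D\<^esub> (\<theta> (Dom C f) \<cdot>\<^bsub>D\<^esub> \<eta> (Dom C f))" (is "?l = ?r") if f: "f \<in> Arr C" for f
  proof -
    note obj = F.C.Dom_in[OF f] F.C.Cod_in[OF f]
    note simps = \<eta>'[OF obj(1)] \<eta>'[OF obj(2)] \<theta>'[OF obj(1)] \<theta>'[OF obj(2)] f
      F.FArr_in F.Dom_FArr F.Cod_FArr G.FArr_in G.Dom_FArr G.Cod_FArr H.FArr_in H.Dom_FArr H.Cod_FArr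
    have "?l = \<theta> (Cod C f) \<cdot>\<^bsub>D\<^esub> (\<eta> (Cod C f) \<cdot>\<^bsub>D\<^esub> FArr F f)"
      by (simp add: simps F.D.Cmp_assoc)
    also have "\<dots> = \<theta> (Cod C f) \<cdot>\<^bsub>D\<^esub> (FArr G f \<cdot>\<^bsub>D\<^esub> \<eta> (Dom C f))"
      using \<eta> f by (simp add: natural_iso_def)
    also have "\<dots> = (\<theta> (Cod C f) \<cdot>\<^bsub>D\<^esub> FArr G f) \<cdot>\<^bsub>D\<^esub> \<eta> (Dom C f)"
      by (simp add: simps F.D.Cmp_assoc)
    also have "\<dots> = (FArr H f \<cdot>\<^bsub>D\<^esub> \<theta> (Dom C f)) \<cdot>\<^bsub>D\<^esub> \<eta> (Dom C f)"
      using \<theta> f by (simp add: natural_iso_def)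
    also have "\<dots> = ?r"
      by (simp add: simps F.D.Cmp_assoc)
    finally show ?thesis .
  qed
  then show ?thesis
    by (simp add: natural_iso_def F.D.iso_Cmp F.D.Dom_Cmp F.D.Cod_Cmp \<eta>' \<theta>')
qed

text \<open>For the transitivity of equivalence: there the unit of the second equivalence is
  sandwiched between \<open>F\<close> and \<open>G\<close>, and the counit of the first one between
  \<open>G'\<close> and \<open>F'\<close>.\<close>

lemma natural_iso_whisker:
  assumes F: "is_functor C D F" and H: "is_functor D' E H" and "is_functor D D' G" "is_functor D D' G'"
    and \<eta>: "natural_iso D D' G G' \<eta>"
  shows "natural_iso C E (comp_fctr H (comp_fctr G F)) (comp_fctr H (comp_fctr G' F))
    (\<lambda>A. FArr H (\<eta> (FObj F A)))"
proof -
  interpret F: is_functor C D F by fact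
  interpret G: is_functor D D' G by fact
  interpret G': is_functor D D' G' by fact
  interpret H: is_functor D' E H by fact
  have \<eta>': "iso_arrow D' (\<eta> A)" "\<eta> A \<in> Arr D'" "Dom D' (\<eta> A) = FObj G A" "Cod D' (\<eta> A) = FObj G' A"
    if "A \<in> Obj D" for A
    using that \<eta> by (auto simp: natural_iso_def G.D.iso_in)
  have "\<eta> (FObj F (Cod C f)) \<cdot>\<^bsub>D'\<^esub> FArr G (FArr F f) = FArr G' (FArr F f) \<cdot>\<^bsub>D'\<^esub> \<eta> (FObj F (Dom C f))"
    if "f \<in> Arr C" for f
    using \<eta> F.FArr_in[OF that] by (auto simp: natural_iso_def F.Dom_FArr F.Cod_FArr that)
  then show ?thesis
    by (simp add: natural_iso_def F.FObj_in F.FArr_in F.Dom_FArr F.Cod_FArr H.iso_FArr \<eta>' H.Dom_FArr H.Cod_FArr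
        H.FArr_Cmp[symmetric] F.C.Dom_in F.C.Cod_in G.FArr_in G.Cod_FArr G'.FArr_in G'.Dom_FArr)
qed

lemma comp_fctr_assoc: "comp_fctr (comp_fctr H G) F = comp_fctr H (comp_fctr G F)"
  by (simp add: comp_fctr_def fun_eq_iff)

lemma comp_id_fctr [simp]: "comp_fctr id_fctr F = F" "comp_fctr F id_fctr = F"
  by (simp_all add: comp_fctr_def id_fctr_def o_def)

text \<open>The unit of the composite is \<eta> followed by \<open>G \<eta>' F\<close>; its counit
  is \<open>F' \<epsilon> G'\<close> followed by \<open>\<epsilon>'\<close>.\<close>

lemma equivalent_categories_trans:
  assumes "equivalent_categories C D" "equivalent_categories D E"
  shows "equivalent_categories C E"
proof -
  from assms obtain F G \<eta> \<epsilon> F' G' \<eta>' \<epsilon>'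
    where fct: "is_functor C D F" "is_functor D C G" "is_functor D E F'" "is_functor E D G'"
      and nat: "natural_iso C C id_fctr (comp_fctr G F) \<eta>" "natural_iso D D (comp_fctr F G) id_fctr \<epsilon>"
        "natural_iso D D id_fctr (comp_fctr G' F') \<eta>'" "natural_iso E E (comp_fctr F' G') id_fctr \<epsilon>'"
    unfolding equivalent_categories_def by blast
  have cat: "category C" "category D" "category E"
    using fct by (simp_all add: is_functor_def)
  note comp = is_functor_comp[OF fct(1,2)] is_functor_comp[OF fct(2,1)]
    is_functor_comp[OF fct(3,4)] is_functor_comp[OF fct(4,3)]
    is_functor_comp[OF fct(1,3)] is_functor_comp[OF fct(4,2)]
  have "natural_iso C C (comp_fctr G F) (comp_fctr (comp_fctr G G') (comp_fctr F' F)) (\<lambda>A. FArr G (\<eta>' (FObj F A)))"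
    using natural_iso_whisker[OF fct(1,2) is_functor_id[OF cat(2)] comp(3) nat(3)]
    by (simp add: comp_fctr_assoc)
  with nat(1) have "natural_iso C C id_fctr (comp_fctr (comp_fctr G G') (comp_fctr F' F))
      (\<lambda>A. FArr G (\<eta>' (FObj F A)) \<cdot>\<^bsub>C\<^esub> \<eta> A)"
    by (intro natural_iso_trans[OF _ comp(1)] is_functor_id cat is_functor_comp[OF comp(5,6)])
  moreover
  have "natural_iso E E (comp_fctr (comp_fctr F' F) (comp_fctr G G')) (comp_fctr F' G') (\<lambda>A. FArr F' (\<epsilon> (FObj G' A)))"
    using natural_iso_whisker[OF fct(4,3) comp(2) is_functor_id[OF cat(2)] nat(2)]
    by (simp add: comp_fctr_assoc)
  with nat(4) have "natural_iso E E (comp_fctr (comp_fctr F' F) (comp_fctr G G')) id_fctr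
      (\<lambda>A. \<epsilon>' A \<cdot>\<^bsub>E\<^esub> FArr F' (\<epsilon> (FObj G' A)))"
    by (intro natural_iso_trans[OF _ comp(4)] is_functor_id cat is_functor_comp[OF comp(6,5)])
  ultimately show ?thesis
    using comp(5,6) unfolding equivalent_categories_def by blast
qed


section \<open>Categories of families\<close>

lemma family_category_simps [simp]:
  "Obj (family_category X P M) = {F. P F}"
  "Arr (family_category X P M) = {(F, G, \<alpha>). P F \<and> P G \<and> M F G \<alpha>}"
  "Dom (family_category X P M) (F, G, \<alpha>) = F"
  "Cod (family_category X P M) (F, G, \<alpha>) = G"
  "Ide (family_category X P M) F = (F, F, \<lambda>A\<in>X. \<lambda>x\<in>Sec F A. x)"
  "Cmp (family_category X P M) (G', H, \<beta>) (F, G, \<alpha>) = (F, H, \<lambda>A\<in>X. compose (Sec F A) (\<beta> A) (\<alpha> A))"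
  by (simp_all add: family_category_def)

text \<open>Turns the sheaf categories, defined as full subcategories, into family categories, so
  that one treatment of functors covers them all.\<close>

lemma full_subcat_family_category:
  assumes "\<And>F. Q F \<Longrightarrow> P F"
  shows "full_subcat (family_category X P M) Q = family_category X Q M"
  using assms by (auto simp: full_subcat_def family_category_def)

text \<open>The unit laws hold as equalities because a morphism is extensional both in the object
  and in the element: composing with a restricted identity changes nothing.\<close>

lemma category_family_category:
  assumes M: "\<And>F G \<alpha>. M F G \<alpha> \<Longrightarrow> \<alpha> \<in> (\<Pi>\<^sub>E A\<in>X. Sec F A \<rightarrow>\<^sub>E Sec G A)"
    and ide: "\<And>F. P F \<Longrightarrow> M F F (\<lambda>A\<in>X. \<lambda>x\<in>Sec F A. x)"
    and comp: "\<And>F G H \<alpha> \<beta>. \<lbrakk>P F; P G; P H; M F G \<alpha>; M G H \<beta>\<rbrakk>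
      \<Longrightarrow> M F H (\<lambda>A\<in>X. compose (Sec F A) (\<beta> A) (\<alpha> A))"
  shows "category (family_category X P M)"
proof -
  have app: "\<alpha> A x \<in> Sec G A" if "M F G \<alpha>" "A \<in> X" "x \<in> Sec F A" for F G \<alpha> A x
    using M[OF that(1)] that(2,3) by auto
  have right: "(\<lambda>A\<in>X. compose (Sec F A) (\<alpha> A) ((\<lambda>A\<in>X. \<lambda>x\<in>Sec F A. x) A)) = \<alpha>"
    and left: "(\<lambda>A\<in>X. compose (Sec F A) ((\<lambda>A\<in>X. \<lambda>x\<in>Sec G A. x) A) (\<alpha> A)) = \<alpha>"
    if "M F G \<alpha>" for F G \<alpha>
    using M[OF that] by (auto intro!: extensionalityI[of _ X] Id_compose compose_Id simp: PiE_iff)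
  show ?thesis
  proof (unfold_locales, goal_cases)
    case (11 f g h)
    then show ?case
      by (auto simp: compose_def app intro!: restrict_ext)
  qed (auto simp: ide comp left right simp del: restrict_apply)
qed

text \<open>One construction for both parts: with \<open>e\<close> the identity it carries the
  translation between the two kinds of presheaves, and with \<open>e\<close> the object map of a
  functor it is pulling back along that functor.\<close>

definition reindex_fctr :: "'o set \<Rightarrow> ('o \<Rightarrow> 'p) \<Rightarrow> ('F \<Rightarrow> 'G) \<Rightarrow>
    ('F, 'F \<times> 'F \<times> ('p \<Rightarrow> 'x), 'G, 'G \<times> 'G \<times> ('o \<Rightarrow> 'x)) fctr" where
  "reindex_fctr X e \<Phi> = \<lparr>FObj = \<Phi>, FArr = (\<lambda>(F, G, \<alpha>). (\<Phi> F, \<Phi> G, \<lambda>A\<in>X. \<alpha> (e A)))\<rparr>"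

lemma reindex_fctr_simps [simp]:
  "FObj (reindex_fctr X e \<Phi>) = \<Phi>"
  "FArr (reindex_fctr X e \<Phi>) (F, G, \<alpha>) = (\<Phi> F, \<Phi> G, \<lambda>A\<in>X. \<alpha> (e A))"
  by (simp_all add: reindex_fctr_def)

lemma is_functor_reindex_fctr:
  assumes "category (family_category Y P M)" "category (family_category X P' M')"
    and "\<And>A. A \<in> X \<Longrightarrow> e A \<in> Y"
    and "\<And>F. P F \<Longrightarrow> P' (\<Phi> F)"
    and "\<And>F A. P F \<Longrightarrow> A \<in> X \<Longrightarrow> Sec (\<Phi> F) A = Sec F (e A)"
    and "\<And>F G \<alpha>. P F \<Longrightarrow> P G \<Longrightarrow> M F G \<alpha> \<Longrightarrow> M' (\<Phi> F) (\<Phi> G) (\<lambda>A\<in>X. \<alpha> (e A))"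
  shows "is_functor (family_category Y P M) (family_category X P' M') (reindex_fctr X e \<Phi>)"
  using assms by (auto simp: is_functor_def is_functor_axioms_def intro!: restrict_ext)


section \<open>Presheaves on a category\<close>

lemma presheaf_morphism_appl:
  "\<lbrakk>presheaf_morphism C F G \<alpha>; A \<in> Obj C; x \<in> Sec F A\<rbrakk> \<Longrightarrow> \<alpha> A x \<in> Sec G A"
  by (auto simp: presheaf_morphism_def)

lemma presheaf_morphism_natural:
  "\<lbrakk>presheaf_morphism C F G \<alpha>; f \<in> Arr C; x \<in> Sec F (Cod C f)\<rbrakk>
    \<Longrightarrow> \<alpha> (Dom C f) (Act F f x) = Act G f (\<alpha> (Cod C f) x)"
  by (auto simp: presheaf_morphism_def)

lemma presheaf_morphism_extensional: "presheaf_morphism C F G \<alpha> \<Longrightarrow> \<alpha> \<in> extensional (Obj C)"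
  by (auto simp: presheaf_morphism_def PiE_def)

lemma Act_in: "\<lbrakk>presheaf C F; f \<in> Arr C; x \<in> Sec F (Cod C f)\<rbrakk> \<Longrightarrow> Act F f x \<in> Sec F (Dom C f)"
  by (auto simp: presheaf_def)

lemma Act_extensional: "\<lbrakk>presheaf C F; f \<in> Arr C\<rbrakk> \<Longrightarrow> Act F f \<in> extensional (Sec F (Cod C f))"
  by (auto simp: presheaf_def PiE_def Pi_iff)

lemma Act_Ide: "\<lbrakk>presheaf C F; A \<in> Obj C; x \<in> Sec F A\<rbrakk> \<Longrightarrow> Act F (Ide C A) x = x"
  by (auto simp: presheaf_def)

lemma Act_Cmp:
  "\<lbrakk>presheaf C F; f \<in> Arr C; g \<in> Arr C; Dom C g = Cod C f; x \<in> Sec F (Cod C g)\<rbrakk>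
    \<Longrightarrow> Act F (g \<cdot>\<^bsub>C\<^esub> f) x = Act F f (Act F g x)"
  by (auto simp: presheaf_def)

lemma sheaf_presheaf: "sheaf C J F \<Longrightarrow> presheaf C F"
  by (simp add: sheaf_def)

context category
begin

lemma presheaf_morphism_Ide:
  "presheaf C F \<Longrightarrow> presheaf_morphism C F F (\<lambda>A\<in>Obj C. \<lambda>x\<in>Sec F A. x)"
  by (auto simp: presheaf_morphism_def Dom_in Cod_in Act_in)

lemma presheaf_morphism_Cmp:
  assumes "presheaf C F" "presheaf_morphism C F G \<alpha>" "presheaf_morphism C G H \<beta>"
  shows "presheaf_morphism C F H (\<lambda>A\<in>Obj C. compose (Sec F A) (\<beta> A) (\<alpha> A))"
  using assms unfolding presheaf_morphism_def[of _ F H]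
  by (auto simp: compose_def Dom_in Cod_in Act_in presheaf_morphism_appl presheaf_morphism_natural)

lemma sheaf_category_eq:
  "sheaf_category C J = family_category (Obj C) (sheaf C J) (presheaf_morphism C)"
  unfolding sheaf_category_def presheaf_category_def
  by (rule full_subcat_family_category) (rule sheaf_presheaf)

lemma category_sheaf_category: "category (sheaf_category C J)"
  unfolding sheaf_category_eq
  by (rule category_family_category)
    (auto simp: presheaf_morphism_def[THEN iffD1] sheaf_presheaf presheaf_morphism_Ide intro: presheaf_morphism_Cmp)

text \<open>Pointwise inverses of a natural family are natural: write a section of \<open>G\<close>
  as the image of one of \<open>F\<close>, use the given square and cancel. The inverse \<beta> is
  restricted in both arguments to meet the extensionality convention.\<close>

lemma iso_sheaf_category:
  assumes F: "sheaf C J F" and G: "sheaf C J G" and \<alpha>: "presheaf_morphism C F G \<alpha>"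
    and bij: "\<And>A. A \<in> Obj C \<Longrightarrow> bij_betw (\<alpha> A) (Sec F A) (Sec G A)"
  shows "iso_arrow (sheaf_category C J) (F, G, \<alpha>)"
proof -
  define \<beta> where "\<beta> = (\<lambda>A\<in>Obj C. \<lambda>y\<in>Sec G A. inv_into (Sec F A) (\<alpha> A) y)"
  have \<beta>_in: "\<beta> A y \<in> Sec F A" and \<alpha>\<beta>: "\<alpha> A (\<beta> A y) = y" if "A \<in> Obj C" "y \<in> Sec G A" for A y
    using that bij[OF that(1)]
    by (auto simp: \<beta>_def bij_betw_def inv_into_into f_inv_into_f)
  have \<beta>\<alpha>: "\<beta> A (\<alpha> A x) = x" if "A \<in> Obj C" "x \<in> Sec F A" for A x
    using that bij[OF that(1)] \<alpha> by (auto simp: \<beta>_def bij_betw_def presheaf_morphism_appl)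
  have "\<beta> (Dom C f) (Act G f y) = Act F f (\<beta> (Cod C f) y)" if "f \<in> Arr C" "y \<in> Sec G (Cod C f)" for f y
  proof -
    have "Act G f y = \<alpha> (Dom C f) (Act F f (\<beta> (Cod C f) y))"
      using that by (simp add: presheaf_morphism_natural[OF \<alpha>] \<beta>_in \<alpha>\<beta> Cod_in)
    then show ?thesis
      using that by (simp add: \<beta>\<alpha> \<beta>_in Dom_in Cod_in Act_in[OF sheaf_presheaf[OF F]])
  qed
  then have \<beta>: "presheaf_morphism C G F \<beta>"
    using \<beta>_in by (auto simp: presheaf_morphism_def \<beta>_def)
  have "inverse_arrows (sheaf_category C J) (F, G, \<alpha>) (G, F, \<beta>)"
    using F G \<alpha> \<beta>
    by (auto simp: inverse_arrows_def sheaf_category_eq compose_def \<alpha>\<beta> \<beta>\<alpha> intro!: restrict_ext)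
  then show ?thesis
    by (auto simp: iso_arrow_def)
qed

end



section \<open>Ordered groupoids\<close>

context ordered_groupoid
begin

section \<open>The order on arrows and the calculus of restrictions\<close>

lemma leA_in: "leA G f g \<Longrightarrow> f \<in> Arr G" "leA G f g \<Longrightarrow> g \<in> Arr G"
  using order by (auto simp: leA_def partial_order_on_def preorder_on_def)

lemma leA_refl: "f \<in> Arr G \<Longrightarrow> leA G f f"
  using order by (auto simp: leA_def partial_order_on_def preorder_on_def refl_on_def)

lemma leA_trans: "\<lbrakk>leA G f g; leA G g h\<rbrakk> \<Longrightarrow> leA G f h"
  using order unfolding leA_def partial_order_on_def preorder_on_def by (meson transD)

text \<open>\<open>Cmp_mono\<close> applied to the inverses and the arrows themselves compares the
  composites of each arrow with its inverse, which are the identities of the two domains.\<close>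

lemma leA_Dom: "leA G f g \<Longrightarrow> leO G (Dom G f) (Dom G g)"
proof -
  assume fg: "leA G f g"
  note f = inv_arrow[OF groupoid[OF leA_in(1)[OF fg]]] and g = inv_arrow[OF groupoid[OF leA_in(2)[OF fg]]]
  have "leA G (inv_arrow G f \<cdot> f) (inv_arrow G g \<cdot> g)"
    using fg f g by (intro Cmp_mono inv_mono) auto
  then show ?thesis
    using leA_in[OF fg] by (simp add: leO_def f g Dom_in)
qed

lemma leA_Cod: "leA G f g \<Longrightarrow> leO G (Cod G f) (Cod G g)"
  using leA_Dom[OF inv_mono] by (simp add: inv_arrow groupoid leA_in)

lemma leO_in: "leO G A B \<Longrightarrow> A \<in> Obj G" "leO G A B \<Longrightarrow> B \<in> Obj G"
  by (auto simp: leO_def)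

lemma leO_refl: "A \<in> Obj G \<Longrightarrow> leO G A A"
  by (simp add: leO_def leA_refl Ide_in)

lemma leO_trans: "\<lbrakk>leO G A B; leO G B D\<rbrakk> \<Longrightarrow> leO G A D"
  by (auto simp: leO_def intro: leA_trans)

lemma restr:
  assumes "f \<in> Arr G" "leO G A' (Dom G f)"
  shows leA_restr: "leA G (restr G f A') f" and Dom_restr: "Dom G (restr G f A') = A'"
    and restr_in: "restr G f A' \<in> Arr G" and leO_Cod_restr: "leO G (Cod G (restr G f A')) (Cod G f)"
proof -
  show *: "leA G (restr G f A') f" "Dom G (restr G f A') = A'"
    using theI'[OF restriction[OF assms]] by (auto simp: restr_def)
  show "restr G f A' \<in> Arr G" "leO G (Cod G (restr G f A')) (Cod G f)"
    using leA_in(1)[OF *(1)] leA_Cod[OF *(1)] .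
qed

text \<open>Uniqueness of restrictions in usable form: each later rule for \<open>restr\<close> is
  proved by exhibiting some arrow below \<open>f\<close> with the right domain.\<close>

lemma restr_eqI: "\<lbrakk>leA G f' f; Dom G f' = A'\<rbrakk> \<Longrightarrow> restr G f A' = f'"
  unfolding restr_def using restriction[of f A'] leA_in leA_Dom by (intro the1_equality) auto

lemma restr_Dom: "f \<in> Arr G \<Longrightarrow> restr G f (Dom G f) = f"
  by (simp add: restr_eqI leA_refl)

lemma restr_Ide: "leO G A' A \<Longrightarrow> restr G (Ide G A) A' = Ide G A'"
  by (simp add: restr_eqI leO_def Dom_Ide)

lemma restr_restr:
  assumes "f \<in> Arr G" "leO G A' (Dom G f)" "leO G A'' A'"
  shows "restr G (restr G f A') A'' = restr G f A''"
  using assms restr[of f A'] restr[of "restr G f A'" A''] by (metis restr_eqI leA_trans)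

lemma restr_Cmp:
  assumes "f \<in> Arr G" "g \<in> Arr G" "Dom G g = Cod G f" "leO G A' (Dom G f)"
  shows "restr G (g \<cdot> f) A' = restr G g (Cod G (restr G f A')) \<cdot> restr G f A'"
  using assms restr[of f A'] restr[of g "Cod G (restr G f A')"]
  by (intro restr_eqI) (auto simp: Cmp_mono Dom_Cmp)

section \<open>The category \<open>L(G)\<close> and the factorization of its arrows\<close>

lemma Lcat_simps [simp]:
  "Obj (Lcat G) = Obj G" "(h, B) \<in> Arr (Lcat G) \<longleftrightarrow> h \<in> Arr G \<and> leO G (Cod G h) B"
  "Dom (Lcat G) (h, B) = Dom G h" "Cod (Lcat G) (h, B) = B" "Ide (Lcat G) A = (Ide G A, A)"
  "(k, B') \<cdot>\<^bsub>Lcat G\<^esub> (h, B) = (restr G k (Cod G h) \<cdot> h, B')"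
  by (simp_all add: Lcat_def)

lemma Lcat_Cmp:
  assumes "h \<in> Arr G" "k \<in> Arr G" "leO G (Cod G h) (Dom G k)"
  shows "restr G k (Cod G h) \<cdot> h \<in> Arr G" "Dom G (restr G k (Cod G h) \<cdot> h) = Dom G h"
    "Cod G (restr G k (Cod G h) \<cdot> h) = Cod G (restr G k (Cod G h))"
  using assms restr[of k "Cod G h"] by (simp_all add: Cmp_in Dom_Cmp Cod_Cmp)

lemma category_Lcat: "category (Lcat G)"
proof (unfold_locales, goal_cases)
  case (6 f g)
  then show ?case
    by (cases f; cases g) (auto simp: Lcat_Cmp intro: leO_trans[OF leO_Cod_restr])
next
  case (11 f g h)
  obtain f' A g' B h' D where [simp]: "f = (f', A)" "g = (g', B)" "h = (h', D)"
    by (cases f, cases g, cases h)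
  let ?g = "restr G g' (Cod G f')" and ?h = "restr G h' (Cod G g')"
  from 11 have *: "f' \<in> Arr G" "g' \<in> Arr G" "h' \<in> Arr G" "leO G (Cod G f') (Dom G g')" "leO G (Cod G g') (Dom G h')"
    by auto
  note g = restr[OF *(2,4)] and h = restr[OF *(3,5)]
  have g': "leO G (Cod G ?g) (Dom G h')"
    using g(4) *(5) by (rule leO_trans)
  note h' = restr[OF *(3) g']
  \<comment> \<open>Restricting in stages agrees with restricting once, so both bracketings consist
    of the same three horizontal arrows and only associativity in \<open>G\<close> is left.\<close>
  have "restr G (?h \<cdot> g') (Cod G f') = restr G h' (Cod G ?g) \<cdot> ?g"
    using * g h by (simp add: restr_Cmp restr_restr)
  then show ?case
    using * g h h' by (simp add: Cmp_assoc Cod_Cmp)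
qed (auto simp: leO_in leO_refl Dom_in Cod_in Ide_in Dom_Ide Cod_Ide Lcat_Cmp Cmp_Ide_right Cmp_Ide_left restr_Dom restr_Ide)

lemma Lcat_factor:
  "\<lbrakk>h \<in> Arr G; leO G (Cod G h) B\<rbrakk> \<Longrightarrow> (Ide G (Cod G h), B) \<cdot>\<^bsub>Lcat G\<^esub> (h, Cod G h) = (h, B)"
  by (simp add: restr_Ide leO_refl Cod_in Cmp_Ide_left)

text \<open>Every arrow of \<open>L(G)\<close> is a horizontal arrow followed by a vertical one, so
  the action on these two kinds determines the whole presheaf. All comparisons below rest on
  this.\<close>

lemma Act_Lcat_factor:
  assumes "presheaf (Lcat G) F" "h \<in> Arr G" "leO G (Cod G h) B" "x \<in> Sec F B"
  shows "Act F (h, Cod G h) (Act F (Ide G (Cod G h), B) x) = Act F (h, B) x"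
  using Act_Cmp[of "Lcat G" F "(h, Cod G h)" "(Ide G (Cod G h), B)" x] assms Lcat_factor[of h B]
  by (simp add: Cod_Ide Dom_Ide Ide_in Cod_in leO_refl)

end


section \<open>Ordered presheaves as presheaves on the associated category\<close>

text \<open>Contravariance reverses the formal composite: restrict to the codomain of
  \<open>h\<close> and only afterwards act with \<open>h\<close>. The guards on arrows and sections
  make the result extensional.\<close>

definition psh_of_opsh :: "('o, 'a, 'm) ogpd_scheme \<Rightarrow> ('o, 'a, 's) opsh \<Rightarrow> ('o, 'a \<times> 'o, 's) psh" where
  "psh_of_opsh G F = \<lparr>Sec = Sec F,
     Act = (\<lambda>(h, B)\<in>Arr (Lcat G). \<lambda>x\<in>Sec F B. Act F h (Res F (Cod G h, B) x))\<rparr>"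

text \<open>Sections need no guard here, since the action of a presheaf is already extensional in
  them.\<close>

definition opsh_of_psh :: "('o, 'a, 'm) ogpd_scheme \<Rightarrow> ('o, 'a \<times> 'o, 's) psh \<Rightarrow> ('o, 'a, 's) opsh" where
  "opsh_of_psh G F = \<lparr>Sec = Sec F,
     Act = (\<lambda>h\<in>Arr G. Act F (h, Cod G h)),
     Res = (\<lambda>(A', A)\<in>{(A', A). leO G A' A}. Act F (Ide G A', A))\<rparr>"

context ordered_groupoid
begin

lemma opsh_of_psh_simps [simp]:
  "Sec (opsh_of_psh G F) = Sec F"
  "h \<in> Arr G \<Longrightarrow> Act (opsh_of_psh G F) h = Act F (h, Cod G h)"
  "leO G A' A \<Longrightarrow> Res (opsh_of_psh G F) (A', A) = Act F (Ide G A', A)"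
  by (simp_all add: opsh_of_psh_def)

lemma psh_of_opsh_simps [simp]:
  "Sec (psh_of_opsh G F) = Sec F"
  "\<lbrakk>h \<in> Arr G; leO G (Cod G h) B; x \<in> Sec F B\<rbrakk>
    \<Longrightarrow> Act (psh_of_opsh G F) (h, B) x = Act F h (Res F (Cod G h, B) x)"
  by (simp_all add: psh_of_opsh_def)

lemma ordered_presheaf_presheaf: "ordered_presheaf G F \<Longrightarrow> presheaf G F"
  by (simp add: ordered_presheaf_def)

lemma Res_in: "\<lbrakk>ordered_presheaf G F; leO G A' A; x \<in> Sec F A\<rbrakk> \<Longrightarrow> Res F (A', A) x \<in> Sec F A'"
  by (auto simp: ordered_presheaf_def PiE_iff)

lemma Res_extensional: "\<lbrakk>ordered_presheaf G F; leO G A' A\<rbrakk> \<Longrightarrow> Res F (A', A) \<in> extensional (Sec F A)"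
  by (auto simp: ordered_presheaf_def PiE_def Pi_iff)

lemma Res_refl: "\<lbrakk>ordered_presheaf G F; A \<in> Obj G; x \<in> Sec F A\<rbrakk> \<Longrightarrow> Res F (A, A) x = x"
  by (simp add: ordered_presheaf_def)

lemma Res_Res: "\<lbrakk>ordered_presheaf G F; leO G A'' A'; leO G A' A; x \<in> Sec F A\<rbrakk>
    \<Longrightarrow> Res F (A'', A') (Res F (A', A) x) = Res F (A'', A) x"
  by (simp add: ordered_presheaf_def)

lemma Act_Res: "\<lbrakk>ordered_presheaf G F; leA G f' f; x \<in> Sec F (Cod G f)\<rbrakk>
    \<Longrightarrow> Act F f' (Res F (Cod G f', Cod G f) x) = Res F (Dom G f', Dom G f) (Act F f x)"
  by (simp add: ordered_presheaf_def)

lemma presheaf_psh_of_opsh: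
  assumes F: "ordered_presheaf G F"
  shows "presheaf (Lcat G) (psh_of_opsh G F)"
proof -
  note [simp] = Act_in[OF ordered_presheaf_presheaf[OF F]] Res_in[OF F] Res_refl[OF F]
  have "Act (psh_of_opsh G F) ((k, D) \<cdot>\<^bsub>Lcat G\<^esub> (h, Dom G k)) x
      = Act (psh_of_opsh G F) (h, Dom G k) (Act (psh_of_opsh G F) (k, D) x)"
    if *: "h \<in> Arr G" "leO G (Cod G h) (Dom G k)" "k \<in> Arr G" "leO G (Cod G k) D" "x \<in> Sec F D" for h k D x
  proof -
    let ?k = "restr G k (Cod G h)"
    note k = restr[OF *(3,2)]
    have kD: "leO G (Cod G ?k) D"
      using k(4) *(4) by (rule leO_trans)
    have "Act F (?k \<cdot> h) (Res F (Cod G ?k, D) x) = Act F h (Act F ?k (Res F (Cod G ?k, D) x))"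
      using * k kD by (intro Act_Cmp[OF ordered_presheaf_presheaf[OF F]]) auto
    also have "Res F (Cod G ?k, D) x = Res F (Cod G ?k, Cod G k) (Res F (Cod G k, D) x)"
      using * k by (simp add: Res_Res[OF F])
    \<comment> \<open>The naturality square of \<open>?k \<le> k\<close> moves the restriction past
      the action of \<open>k\<close>. This is where the compatibility between horizontal and
      vertical actions enters.\<close>
    also have "Act F ?k \<dots> = Res F (Cod G h, Dom G k) (Act F k (Res F (Cod G k, D) x))"
      using * k by (simp add: Act_Res[OF F])
    finally show ?thesis
      using * k kD by (simp add: Lcat_Cmp Res_Res[OF F])
  qed
  moreover have "Sec F \<in> extensional (Obj G)"
    using ordered_presheaf_presheaf[OF F] by (simp add: presheaf_def)
  moreover have "Act (psh_of_opsh G F) \<in> (\<Pi>\<^sub>E f\<in>Arr (Lcat G). Sec F (Cod (Lcat G) f) \<rightarrow>\<^sub>E Sec F (Dom (Lcat G) f))"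
    by (auto simp: psh_of_opsh_def)
  moreover have "Act F (Ide G A) x = x" if "A \<in> Obj G" "x \<in> Sec F A" for A x
    using that by (rule Act_Ide[OF ordered_presheaf_presheaf[OF F]])
  ultimately show ?thesis
    by (auto simp: presheaf_def Ide_in Cod_Ide leO_refl simp del: Lcat_simps(6))
qed

lemma ordered_presheaf_opsh_of_psh:
  assumes F: "presheaf (Lcat G) F"
  shows "ordered_presheaf G (opsh_of_psh G F)"
proof -
  have act: "Act F (h, B) x \<in> Sec F (Dom G h)" if "h \<in> Arr G" "leO G (Cod G h) B" "x \<in> Sec F B" for h B x
    using Act_in[OF F, of "(h, B)" x] that by simp
  have ext: "Act F (h, B) \<in> extensional (Sec F B)" if "h \<in> Arr G" "leO G (Cod G h) B" for h B
    using Act_extensional[OF F, of "(h, B)"] that by simp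
  have cmp: "Act F (h, Dom G k) (Act F (k, D) x) = Act F (restr G k (Cod G h) \<cdot> h, D) x"
    if "h \<in> Arr G" "leO G (Cod G h) (Dom G k)" "k \<in> Arr G" "leO G (Cod G k) D" "x \<in> Sec F D" for h k D x
    using Act_Cmp[OF F, of "(h, Dom G k)" "(k, D)" x] that by simp
  note objs = Dom_in Cod_in leO_refl Ide_in Dom_Ide Cod_Ide leO_in
  have "presheaf G (opsh_of_psh G F)"
    unfolding presheaf_def
  proof (intro conjI ballI impI)
    show "Sec (opsh_of_psh G F) \<in> extensional (Obj G)"
      using F by (simp add: presheaf_def)
    show "Act (opsh_of_psh G F)
        \<in> (\<Pi>\<^sub>E f\<in>Arr G. Sec (opsh_of_psh G F) (Cod G f) \<rightarrow>\<^sub>E Sec (opsh_of_psh G F) (Dom G f))"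
      using act ext by (auto simp: opsh_of_psh_def PiE_iff objs)
  next
    fix A x assume "A \<in> Obj G" "x \<in> Sec (opsh_of_psh G F) A"
    then show "Act (opsh_of_psh G F) (Ide G A) x = x"
      using Act_Ide[OF F, of A x] by (simp add: objs)
  next
    fix f g x assume "f \<in> Arr G" "g \<in> Arr G" "Dom G g = Cod G f" "x \<in> Sec (opsh_of_psh G F) (Cod G g)"
    then show "Act (opsh_of_psh G F) (g \<cdot> f) x = Act (opsh_of_psh G F) f (Act (opsh_of_psh G F) g x)"
      using cmp[of f g "Cod G g" x] restr_Dom[of g] by (simp add: objs Cmp_in Cod_Cmp)
  qed
  moreover have "Res (opsh_of_psh G F) \<in> (\<Pi>\<^sub>E (A', A)\<in>{(A', A). leO G A' A}. Sec F A \<rightarrow>\<^sub>E Sec F A')"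
  proof -
    have "Act F (Ide G A', A) x \<in> Sec F A'" if "leO G A' A" "x \<in> Sec F A" for A' A x
      using act[of "Ide G A'" A x] that by (simp add: objs)
    then show ?thesis
      using ext by (auto simp: opsh_of_psh_def PiE_iff objs)
  qed
  moreover have "Act F (Ide G A, A) x = x" if "A \<in> Obj G" "x \<in> Sec F A" for A x
    using Act_Ide[OF F, of A x] that by simp
  moreover have "Act F (Ide G A'', A') (Act F (Ide G A', A) x) = Res (opsh_of_psh G F) (A'', A) x"
    if "leO G A'' A'" "leO G A' A" "x \<in> Sec F A" for A'' A' A x
    using that leO_trans[OF that(1,2)] cmp[of "Ide G A''" "Ide G A'" A x] Cmp_Ide_left[of "Ide G A''"] by (simp add: objs restr_Ide)
  \<comment> \<open>Both sides are the action of the single arrow \<open>(f', Cod G f)\<close> of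
    \<open>L(G)\<close>: on the left through its factorization, on the right because
    \<open>f\<close> restricted to \<open>Dom G f'\<close> is \<open>f'\<close>.\<close>
  moreover have "Act F (f', Cod G f') (Act F (Ide G (Cod G f'), Cod G f) x)
      = Act F (Ide G (Dom G f'), Dom G f) (Act F (f, Cod G f) x)"
    if "leA G f' f" "x \<in> Sec F (Cod G f)" for f' f x
    using that cmp[of "Ide G (Dom G f')" f "Cod G f" x] restr_eqI[OF that(1)]
    by (simp add: objs leA_in leA_Dom leA_Cod Act_Lcat_factor[OF F] Cmp_Ide_right)
  ultimately show ?thesis
    by (auto simp: ordered_presheaf_def objs leA_in leA_Dom leA_Cod)
qed

text \<open>The detour inserts \<open>Res F (A, A)\<close> for a horizontal arrow and the action of
  an identity for a vertical one, both trivial on sections; outside the carriers both sides are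
  \<open>undefined\<close>.\<close>

lemma opsh_of_psh_of_opsh:
  assumes F: "ordered_presheaf G F"
  shows "opsh_of_psh G (psh_of_opsh G F) = F"
proof -
  have "Act (opsh_of_psh G (psh_of_opsh G F)) = Act F"
  proof (rule extensionalityI[of _ "Arr G"])
    fix h assume h: "h \<in> Arr G"
    then have "Act F h \<in> extensional (Sec F (Cod G h))"
      by (rule Act_extensional[OF ordered_presheaf_presheaf[OF F]])
    with h show "Act (opsh_of_psh G (psh_of_opsh G F)) h = Act F h"
      by (auto intro!: extensionalityI[of _ "Sec F (Cod G h)"] simp: Cod_in leO_refl Res_refl[OF F] psh_of_opsh_def)
  qed (use F in \<open>auto simp: opsh_of_psh_def ordered_presheaf_def presheaf_def PiE_def\<close>)
  moreover have "Res (opsh_of_psh G (psh_of_opsh G F)) = Res F"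
  proof (rule extensionalityI[of _ "{(A', A). leO G A' A}"], goal_cases)
    case (3 p)
    obtain A' A where [simp]: "p = (A', A)" by (cases p)
    with 3 have *: "leO G A' A" by simp
    then have "Res F (A', A) \<in> extensional (Sec F A)"
      by (rule Res_extensional[OF F])
    with * show ?case
      by (auto intro!: extensionalityI[of _ "Sec F A"]
          simp: psh_of_opsh_def Ide_in Cod_Ide leO_in Act_Ide[OF ordered_presheaf_presheaf[OF F]] Res_in[OF F])
  qed (use F in \<open>auto simp: opsh_of_psh_def ordered_presheaf_def PiE_def\<close>)
  ultimately show ?thesis
    by simp
qed

lemma psh_of_opsh_of_psh:
  assumes F: "presheaf (Lcat G) F"
  shows "psh_of_opsh G (opsh_of_psh G F) = F"
proof -
  have "Act (psh_of_opsh G (opsh_of_psh G F)) = Act F"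
  proof (rule extensionalityI[of _ "Arr (Lcat G)"], goal_cases)
    case (3 f)
    obtain h B where [simp]: "f = (h, B)" by (cases f)
    with 3 have *: "h \<in> Arr G" "leO G (Cod G h) B" by simp_all
    then have "Act F (h, B) \<in> extensional (Sec F B)"
      using Act_extensional[OF F, of "(h, B)"] by simp
    with * show ?case
      by (auto intro!: extensionalityI[of _ "Sec F B"] simp: Act_Lcat_factor[OF F])
        (auto simp: psh_of_opsh_def)
  qed (use F in \<open>auto simp: psh_of_opsh_def presheaf_def PiE_def\<close>)
  then show ?thesis
    by simp
qed

text \<open>Horizontal and vertical naturality are instances of naturality over \<open>L(G)\<close>.
  Conversely, the square of an arbitrary arrow is pasted from the squares of its two
  factors.\<close>

lemma presheaf_morphism_opsh_of_psh_iff: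
  assumes F: "presheaf (Lcat G) F" and F': "presheaf (Lcat G) F'"
  shows "ordered_presheaf_morphism G (opsh_of_psh G F) (opsh_of_psh G F') \<alpha>
    \<longleftrightarrow> presheaf_morphism (Lcat G) F F' \<alpha>" (is "?l \<longleftrightarrow> ?r")
proof
  assume ?r
  note nat = presheaf_morphism_natural[OF this]
  have "\<alpha> (Dom G h) (Act F (h, B) x) = Act F' (h, B) (\<alpha> B x)"
    if "h \<in> Arr G" "leO G (Cod G h) B" "x \<in> Sec F B" for h B x
    using nat[of "(h, B)" x] that by simp
  moreover have "\<alpha> A' (Act F (Ide G A', A) x) = Act F' (Ide G A', A) (\<alpha> A x)" if "leO G A' A" "x \<in> Sec F A" for A' A x
    using nat[of "(Ide G A', A)" x] that by (simp add: Ide_in Dom_Ide Cod_Ide leO_in)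
  ultimately show ?l
    using \<open>?r\<close> by (auto simp: ordered_presheaf_morphism_def presheaf_morphism_def Cod_in leO_refl)
next
  assume ?l
  then have \<alpha>: "\<alpha> \<in> (\<Pi>\<^sub>E A\<in>Obj G. Sec F A \<rightarrow>\<^sub>E Sec F' A)"
    and nat: "\<And>h x. \<lbrakk>h \<in> Arr G; x \<in> Sec F (Cod G h)\<rbrakk>
      \<Longrightarrow> \<alpha> (Dom G h) (Act F (h, Cod G h) x) = Act F' (h, Cod G h) (\<alpha> (Cod G h) x)"
    and nat': "\<And>A' A x. \<lbrakk>leO G A' A; x \<in> Sec F A\<rbrakk>
      \<Longrightarrow> \<alpha> A' (Act F (Ide G A', A) x) = Act F' (Ide G A', A) (\<alpha> A x)"
    by (auto simp: ordered_presheaf_morphism_def presheaf_morphism_def)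
  have "\<alpha> (Dom G h) (Act F (h, B) x) = Act F' (h, B) (\<alpha> B x)"
    if "h \<in> Arr G" "leO G (Cod G h) B" "x \<in> Sec F B" for h B x
  proof -
    have "Act F (Ide G (Cod G h), B) x \<in> Sec F (Cod G h)" "\<alpha> B x \<in> Sec F' B"
      using that Act_in[OF F, of "(Ide G (Cod G h), B)" x] \<alpha>
      by (auto simp: Dom_Ide Cod_Ide Ide_in Cod_in leO_in)
    then show ?thesis
      using that by (simp flip: Act_Lcat_factor[OF F] Act_Lcat_factor[OF F'] add: nat nat')
  qed
  with \<alpha> show ?r
    by (auto simp: presheaf_morphism_def)
qed

text \<open>Matching families correspond: a family \<open>x\<close> on a sieve is evaluated at the
  identities \<open>(Ide G B, A)\<close>, and a vertical family \<open>y\<close> is extended by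
  letting \<open>m\<close> act on \<open>y (Cod G m)\<close>. By the factorization of
  \<open>(m, A)\<close>, a section amalgamates one family iff it amalgamates the other.\<close>

lemma sheaf_opsh_of_psh_iff:
  assumes F: "presheaf (Lcat G) F"
    and T: "\<And>A \<A>. \<lbrakk>A \<in> Obj G; \<A> \<in> T A\<rbrakk> \<Longrightarrow> vertical_sieve G A \<A>"
  shows "ehresmann_sheaf G T (opsh_of_psh G F) \<longleftrightarrow> sheaf (Lcat G) (Jtop G T) F" (is "?l \<longleftrightarrow> ?r")
proof
  assume ?l
  have "\<exists>!s. s \<in> Sec F A \<and> (\<forall>f\<in>S. Act F f s = x f)"
    if A: "A \<in> Obj G" and S: "S \<in> Jtop G T A" and x: "matching_family (Lcat G) F S x" for A S x
  proof -
    define \<A> where "\<A> = {Cod G m | m. (m, A) \<in> S}"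
    have sv: "sieve (Lcat G) A S" and \<A>: "\<A> \<in> T A"
      using S by (auto simp: Jtop_def \<A>_def)
    have S_elim: "\<exists>m. f = (m, A) \<and> m \<in> Arr G \<and> leO G (Cod G m) A" if "f \<in> S" for f
      using sv that by (cases f) (auto simp: sieve_def)
    have closed: "f \<cdot>\<^bsub>Lcat G\<^esub> g \<in> S" "Act F g (x f) = x (f \<cdot>\<^bsub>Lcat G\<^esub> g)"
      if "f \<in> S" "g \<in> Arr (Lcat G)" "Cod (Lcat G) g = Dom (Lcat G) f" for f g
      using sv x that by (auto simp: sieve_def matching_family_def)
    \<comment> \<open>Precomposing \<open>(m, A)\<close> with the inverse of \<open>m\<close> leaves
      the identity of \<open>Cod G m\<close>, and a sieve is closed under precomposition.
      Invertibility of horizontal arrows is used here.\<close>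
    have Ide_S: "(Ide G B, A) \<in> S" if "B \<in> \<A>" for B
    proof -
      obtain m where m: "(m, A) \<in> S" "B = Cod G m"
        using \<open>B \<in> \<A>\<close> by (auto simp: \<A>_def)
      with S_elim have "m \<in> Arr G" by blast
      with m show ?thesis
        using closed(1)[OF m(1), of "(inv_arrow G m, Dom G m)"] inv_arrow[OF groupoid[of m]]
        by (simp add: leO_refl Dom_in restr_Dom)
    qed
    define y where "y B = x (Ide G B, A)" for B
    have "vertical_matching_family G (opsh_of_psh G F) \<A> y"
      unfolding vertical_matching_family_def
    proof (intro conjI ballI impI)
      fix B assume "B \<in> \<A>"
      from Ide_S[OF this] x S_elim[OF Ide_S[OF this]] have "x (Ide G B, A) \<in> Sec F (Dom G (Ide G B))"
        by (auto simp: matching_family_def)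
      moreover have "B \<in> Obj G"
        using \<open>B \<in> \<A>\<close> T[OF A \<A>] by (auto simp: vertical_sieve_def down_def leO_in)
      ultimately show "y B \<in> Sec (opsh_of_psh G F) B"
        by (simp add: y_def Dom_Ide)
    next
      fix B' B'' assume B: "B' \<in> \<A>" "B'' \<in> \<A>" "leO G B'' B'"
      then have "Act F (Ide G B'', B') (x (Ide G B', A)) = x ((Ide G B', A) \<cdot>\<^bsub>Lcat G\<^esub> (Ide G B'', B'))"
        by (intro closed Ide_S) (auto simp: Ide_in Dom_Ide Cod_Ide leO_in)
      with B show "Res (opsh_of_psh G F) (B'', B') (y B') = y B''"
        using Cmp_Ide_left[of "Ide G B''"] by (simp add: y_def Cod_Ide Ide_in leO_in restr_Ide)
    qed
    with \<open>?l\<close> A \<A> have "\<exists>!s. s \<in> Sec (opsh_of_psh G F) A \<and> (\<forall>A'\<in>\<A>. Res (opsh_of_psh G F) (A', A) s = y A')"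
      unfolding ehresmann_sheaf_def by blast
    moreover have "(\<forall>A'\<in>\<A>. Res (opsh_of_psh G F) (A', A) s = y A') \<longleftrightarrow> (\<forall>f\<in>S. Act F f s = x f)"
      if s: "s \<in> Sec F A" for s
    proof
      assume *: "\<forall>A'\<in>\<A>. Res (opsh_of_psh G F) (A', A) s = y A'"
      show "\<forall>f\<in>S. Act F f s = x f"
      proof
        fix f assume f: "f \<in> S"
        with S_elim obtain m where m: "f = (m, A)" "m \<in> Arr G" "leO G (Cod G m) A" by blast
        with f have "Cod G m \<in> \<A>" by (auto simp: \<A>_def)
        have "Act F f s = Act F (m, Cod G m) (Act F (Ide G (Cod G m), A) s)"
          using m s by (simp add: Act_Lcat_factor[OF F])
        also have "\<dots> = Act F (m, Cod G m) (x (Ide G (Cod G m), A))"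
          using * \<open>Cod G m \<in> \<A>\<close> m by (force simp: y_def)
        also have "\<dots> = x ((Ide G (Cod G m), A) \<cdot>\<^bsub>Lcat G\<^esub> (m, Cod G m))"
          using m \<open>Cod G m \<in> \<A>\<close> by (intro closed Ide_S) (auto simp: Dom_Ide Cod_in leO_refl)
        also have "\<dots> = x f"
          using m Lcat_factor[of m A] by simp
        finally show "Act F f s = x f" .
      qed
    next
      assume "\<forall>f\<in>S. Act F f s = x f"
      then show "\<forall>A'\<in>\<A>. Res (opsh_of_psh G F) (A', A) s = y A'"
        using Ide_S T[OF A \<A>] by (auto simp: y_def vertical_sieve_def down_def)
    qed
    ultimately show ?thesis
      by (simp cong: conj_cong)
  qed
  with F show ?r
    by (simp add: sheaf_def)
next
  assume ?r
  have "\<exists>!s. s \<in> Sec (opsh_of_psh G F) A \<and> (\<forall>A'\<in>\<A>. Res (opsh_of_psh G F) (A', A) s = y A')"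
    if A: "A \<in> Obj G" and \<A>: "\<A> \<in> T A" and y: "vertical_matching_family G (opsh_of_psh G F) \<A> y" for A \<A> y
  proof -
    have down: "leO G B A" and closed: "leO G B' B \<Longrightarrow> B' \<in> \<A>" and y_in: "y B \<in> Sec F B" if "B \<in> \<A>" for B B'
      using T[OF A \<A>] y that by (auto simp: vertical_sieve_def down_def vertical_matching_family_def)
    have y_res: "Act F (Ide G B', B) (y B) = y B'" if "B \<in> \<A>" "leO G B' B" for B B'
      using y that closed[OF that] by (auto simp: vertical_matching_family_def)
    \<comment> \<open>Downward closure of \<A> makes this set a sieve, and the identities in it show
      that its codomains exhaust \<A>.\<close>
    define S where "S = {(m, A) | m. m \<in> Arr G \<and> Cod G m \<in> \<A>}"
    have restr_\<A>: "Cod G (restr G m (Cod G k)) \<in> \<A>"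
      if "m \<in> Arr G" "Cod G m \<in> \<A>" "leO G (Cod G k) (Dom G m)" for m k
      using that closed leO_Cod_restr by blast
    have "sieve (Lcat G) A S"
      by (auto simp: sieve_def S_def down Lcat_Cmp restr_\<A>)
    moreover have "{Cod G m | m. (m, A) \<in> S} = \<A>"
    proof -
      have "\<exists>m. B = Cod G m \<and> m \<in> Arr G \<and> Cod G m \<in> \<A>" if "B \<in> \<A>" for B
        using that down[OF that] by (intro exI[of _ "Ide G B"]) (simp add: Cod_Ide Ide_in leO_in)
      then show ?thesis
        by (auto simp: S_def)
    qed
    ultimately have S: "S \<in> Jtop G T A"
      using \<A> by (simp add: Jtop_def)
    \<comment> \<open>These values are forced: on the inclusion of \<open>Cod G m\<close> into
      \<open>A\<close> the family has to be \<open>y\<close>, and \<open>m\<close> acts on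
      that.\<close>
    define x where "x = (\<lambda>(m, B :: 'o). Act F (m, Cod G m) (y (Cod G m)))"
    have "matching_family (Lcat G) F S x"
      unfolding matching_family_def
    proof (intro conjI ballI impI)
      fix f assume "f \<in> S"
      then show "x f \<in> Sec F (Dom (Lcat G) f)"
        using Act_in[OF F, of "(_, Cod G _)"] y_in by (auto simp: S_def x_def Cod_in leO_refl)
    next
      fix f g assume "f \<in> S" "g \<in> Arr (Lcat G)" "Cod (Lcat G) g = Dom (Lcat G) f"
      then obtain m k where fg: "f = (m, A)" "g = (k, Dom G m)"
        and m: "m \<in> Arr G" "Cod G m \<in> \<A>" and k: "k \<in> Arr G" "leO G (Cod G k) (Dom G m)"
        by (cases g) (auto simp: S_def)
      let ?m = "restr G m (Cod G k)"
      note m' = restr[OF m(1) k(2)] Lcat_Cmp[OF k(1) m(1) k(2)]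
      have "Act F g (x f) = Act F ((m, Cod G m) \<cdot>\<^bsub>Lcat G\<^esub> (k, Dom G m)) (y (Cod G m))"
        using m k by (subst Act_Cmp[OF F]) (auto simp: fg x_def y_in Cod_in leO_refl)
      \<comment> \<open>Splitting off the inclusion of \<open>Cod G ?m\<close> into
        \<open>Cod G m\<close> exposes a restriction of \<open>y\<close>, which the matching
        condition evaluates.\<close>
      also have "\<dots> = Act F (?m \<cdot> k, Cod G ?m) (Act F (Ide G (Cod G ?m), Cod G m) (y (Cod G m)))"
        using Act_Lcat_factor[OF F, of "?m \<cdot> k" "Cod G m" "y (Cod G m)"] m m' by (simp add: y_in)
      also have "\<dots> = x (f \<cdot>\<^bsub>Lcat G\<^esub> g)"
        using m m' by (simp add: y_res x_def fg)
      finally show "Act F g (x f) = x (f \<cdot>\<^bsub>Lcat G\<^esub> g)" .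
    qed
    with \<open>?r\<close> A S have "\<exists>!s. s \<in> Sec F A \<and> (\<forall>f\<in>S. Act F f s = x f)"
      unfolding sheaf_def by simp
    moreover have "(\<forall>f\<in>S. Act F f s = x f) \<longleftrightarrow> (\<forall>A'\<in>\<A>. Res (opsh_of_psh G F) (A', A) s = y A')"
      if s: "s \<in> Sec F A" for s
    proof
      assume *: "\<forall>f\<in>S. Act F f s = x f"
      show "\<forall>A'\<in>\<A>. Res (opsh_of_psh G F) (A', A) s = y A'"
      proof
        fix B assume B: "B \<in> \<A>"
        from down[OF B] have B': "leO G B A" "B \<in> Obj G" by (auto simp: leO_in)
        with B have "(Ide G B, A) \<in> S"
          by (auto simp: S_def Ide_in Cod_Ide)
        with * have "Act F (Ide G B, A) s = Act F (Ide G B, B) (y B)"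
          using B' by (auto simp: x_def Cod_Ide)
        with B B' show "Res (opsh_of_psh G F) (B, A) s = y B"
          by (simp add: y_res leO_refl)
      qed
    next
      assume *: "\<forall>A'\<in>\<A>. Res (opsh_of_psh G F) (A', A) s = y A'"
      show "\<forall>f\<in>S. Act F f s = x f"
      proof
        fix f assume "f \<in> S"
        then obtain m where m: "f = (m, A)" "m \<in> Arr G" "Cod G m \<in> \<A>" by (auto simp: S_def)
        then have "Act F (m, A) s = Act F (m, Cod G m) (Act F (Ide G (Cod G m), A) s)"
          using s down by (simp add: Act_Lcat_factor[OF F])
        also have "Act F (Ide G (Cod G m), A) s = y (Cod G m)"
          using * m down by force
        finally show "Act F f s = x f"
          by (simp add: m x_def)
      qed
    qed
    ultimately show ?thesis
      by (simp cong: conj_cong)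
  qed
  with F show ?l
    by (simp add: ehresmann_sheaf_def ordered_presheaf_opsh_of_psh)
qed

section \<open>The category of Ehresmann sheaves and part (1)\<close>

lemma ehresmann_sheaf_category_eq:
  "ehresmann_sheaf_category G T = family_category (Obj G) (ehresmann_sheaf G T) (ordered_presheaf_morphism G)"
  unfolding ehresmann_sheaf_category_def ordered_presheaf_category_def
  by (rule full_subcat_family_category) (simp add: ehresmann_sheaf_def)

lemma ordered_presheaf_morphism_Cmp:
  assumes "ordered_presheaf G F" "ordered_presheaf_morphism G F F' \<alpha>" "ordered_presheaf_morphism G F' F'' \<beta>"
  shows "ordered_presheaf_morphism G F F'' (\<lambda>A\<in>Obj G. compose (Sec F A) (\<beta> A) (\<alpha> A))"
  using assms presheaf_morphism_Cmp[of F F' \<alpha> F'' \<beta>] unfolding ordered_presheaf_morphism_def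
  by (auto simp: compose_def leO_in Res_in ordered_presheaf_presheaf presheaf_morphism_appl)

lemma category_ehresmann_sheaf_category: "category (ehresmann_sheaf_category G T)"
  unfolding ehresmann_sheaf_category_eq
proof (rule category_family_category, goal_cases)
  case (2 F)
  then have "ordered_presheaf G F" by (simp add: ehresmann_sheaf_def)
  then show ?case
    by (auto simp: ordered_presheaf_morphism_def presheaf_morphism_Ide ordered_presheaf_presheaf leO_in Res_in)
qed (auto simp: ordered_presheaf_morphism_def[THEN iffD1] presheaf_morphism_def[THEN iffD1] ehresmann_sheaf_def
    ordered_presheaf_morphism_Cmp)

text \<open>Both orders are stated: part (1) is the first, and part (2) chains the equivalence for
  \<open>C\<close> with the second. Mutually inverse functors give either one.\<close>

theorem equivalent_ehresmann_sheaf_category_Lcat: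
  fixes T :: "'o \<Rightarrow> 'o set set"
  assumes T: "\<And>A \<A>. \<lbrakk>A \<in> Obj G; \<A> \<in> T A\<rbrakk> \<Longrightarrow> vertical_sieve G A \<A>"
  defines "E \<equiv> ehresmann_sheaf_category G T :: ('o, 'a, 's) opsh_cat"
    and "S \<equiv> sheaf_category (Lcat G) (Jtop G T) :: ('o, 'a \<times> 'o, 's) psh_cat"
  shows "equivalent_categories E S" "equivalent_categories S E"
proof -
  interpret L: category "Lcat G" by (rule category_Lcat)
  note E = E_def[unfolded ehresmann_sheaf_category_eq] and S = S_def[unfolded L.sheaf_category_eq Lcat_simps(1)]
  have cat: "category E" "category S"
    unfolding E_def S_def by (rule category_ehresmann_sheaf_category L.category_sheaf_category)+
  have psh: "presheaf (Lcat G) (psh_of_opsh G F)" and inv: "opsh_of_psh G (psh_of_opsh G F) = F"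
    if "ehresmann_sheaf G T F" for F :: "('o, 'a, 's) opsh"
    using that by (auto simp: ehresmann_sheaf_def presheaf_psh_of_opsh opsh_of_psh_of_opsh)
  have sh: "sheaf (Lcat G) (Jtop G T) (psh_of_opsh G F)"
    if "ehresmann_sheaf G T F" for F :: "('o, 'a, 's) opsh"
    using that sheaf_opsh_of_psh_iff[OF psh[OF that] T] by (simp add: inv[OF that])
  have esh: "ehresmann_sheaf G T (opsh_of_psh G F)" if "sheaf (Lcat G) (Jtop G T) F" for F :: "('o, 'a \<times> 'o, 's) psh"
    using that sheaf_opsh_of_psh_iff[OF sheaf_presheaf[OF that] T] by simp
  have mor: "ordered_presheaf_morphism G F F' \<alpha> \<longleftrightarrow> presheaf_morphism (Lcat G) (psh_of_opsh G F) (psh_of_opsh G F') \<alpha>"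
    if "ehresmann_sheaf G T F" "ehresmann_sheaf G T F'" for F F' :: "('o, 'a, 's) opsh" and \<alpha>
    using presheaf_morphism_opsh_of_psh_iff[OF psh[OF that(1)] psh[OF that(2)]] by (simp add: inv that)
  have ext: "restrict \<alpha> (Obj G) = \<alpha>" if "presheaf_morphism (Lcat G) F F' \<alpha>" for F F' :: "('o, 'a \<times> 'o, 's) psh" and \<alpha>
    using presheaf_morphism_extensional[OF that] by (simp add: extensional_restrict)
  have ext': "restrict \<alpha> (Obj G) = \<alpha>" if "ordered_presheaf_morphism G F F' \<alpha>" for F F' :: "('o, 'a, 's) opsh" and \<alpha>
    using that presheaf_morphism_extensional[of G F F' \<alpha>]
    by (simp add: ordered_presheaf_morphism_def extensional_restrict)
  let ?\<Phi> = "reindex_fctr (Obj G) (\<lambda>A. A) (psh_of_opsh G)" and ?\<Psi> = "reindex_fctr (Obj G) (\<lambda>A. A) (opsh_of_psh G)"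
  have \<Phi>: "is_functor E S ?\<Phi>"
    using cat unfolding E S
    by (intro is_functor_reindex_fctr) (auto simp: sh ext' simp flip: mor)
  have \<Psi>: "is_functor S E ?\<Psi>"
    using cat unfolding E S
    by (intro is_functor_reindex_fctr) (auto simp: esh ext presheaf_morphism_opsh_of_psh_iff sheaf_presheaf)
  have inv1: "FObj ?\<Psi> (FObj ?\<Phi> F) = F" if "F \<in> Obj E" for F
    using that by (simp add: E inv)
  have inv2: "FArr ?\<Psi> (FArr ?\<Phi> f) = f" if "f \<in> Arr E" for f
    using that by (auto simp: E inv ext')
  have inv3: "FObj ?\<Phi> (FObj ?\<Psi> F) = F" if "F \<in> Obj S" for F
    using that by (simp add: S psh_of_opsh_of_psh sheaf_presheaf)
  have inv4: "FArr ?\<Phi> (FArr ?\<Psi> f) = f" if "f \<in> Arr S" for f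
    using that by (auto simp: S psh_of_opsh_of_psh sheaf_presheaf ext)
  show "equivalent_categories E S" "equivalent_categories S E"
    using equivalent_categories_if_isomorphic[OF \<Phi> \<Psi> inv1 inv2 inv3 inv4]
      equivalent_categories_if_isomorphic[OF \<Psi> \<Phi> inv3 inv4 inv1 inv2] by auto
qed

end



section \<open>Pulling sheaves back along an equivalence\<close>

text \<open>The inverse arrow acts as the inverse map. The result cancels an isomorphism in the
  gluing argument below and makes the components of a counit bijective.\<close>

lemma (in category) bij_betw_Act_iso:
  assumes P: "presheaf C P" and k: "iso_arrow C k"
  shows "bij_betw (Act P k) (Sec P (Cod C k)) (Sec P (Dom C k))"
proof (rule bij_betwI[where g = "Act P (inv_arrow C k)"])
  note k' = inv_arrow[OF k] iso_in[OF k]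
  show "Act P k \<in> Sec P (Cod C k) \<rightarrow> Sec P (Dom C k)"
    using k' Act_in[OF P] by auto
  show "Act P (inv_arrow C k) \<in> Sec P (Dom C k) \<rightarrow> Sec P (Cod C k)"
    using k' Act_in[OF P, of "inv_arrow C k"] by auto
  show "Act P (inv_arrow C k) (Act P k x) = x" if "x \<in> Sec P (Cod C k)" for x
    using that k' Act_Cmp[OF P, of "inv_arrow C k" k x] by (simp add: Act_Ide[OF P] Cod_in)
  show "Act P k (Act P (inv_arrow C k) x) = x" if "x \<in> Sec P (Dom C k)" for x
    using that k' Act_Cmp[OF P, of k "inv_arrow C k" x] by (simp add: Act_Ide[OF P] Dom_in)
qed

text \<open>Precomposition with \<open>F\<close>. The guards on objects and arrows make it
  extensional there; in the sections it inherits this from a presheaf \<open>P\<close>.\<close>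

definition pull_psh ::
    "('o, 'a) cat \<Rightarrow> ('o, 'a, 'p, 'b) fctr \<Rightarrow> ('p, 'b, 's) psh \<Rightarrow> ('o, 'a, 's) psh" where
  "pull_psh C F P = \<lparr>Sec = (\<lambda>A\<in>Obj C. Sec P (FObj F A)), Act = (\<lambda>f\<in>Arr C. Act P (FArr F f))\<rparr>"

lemma pull_psh_simps [simp]:
  "A \<in> Obj C \<Longrightarrow> Sec (pull_psh C F P) A = Sec P (FObj F A)"
  "f \<in> Arr C \<Longrightarrow> Act (pull_psh C F P) f = Act P (FArr F f)"
  by (simp_all add: pull_psh_def)

lemma (in is_functor) presheaf_pull_psh:
  assumes P: "presheaf D P"
  shows "presheaf C (pull_psh C F P)"
  unfolding presheaf_def
proof (intro conjI ballI impI)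
  show "Sec (pull_psh C F P) \<in> extensional (Obj C)"
    by (simp add: pull_psh_def)
  show "Act (pull_psh C F P)
      \<in> (\<Pi>\<^sub>E f\<in>Arr C. Sec (pull_psh C F P) (Cod C f) \<rightarrow>\<^sub>E Sec (pull_psh C F P) (Dom C f))"
  proof (rule PiE_I)
    fix f assume f: "f \<in> Arr C"
    then have "Act P (FArr F f) \<in> Sec P (Cod D (FArr F f)) \<rightarrow>\<^sub>E Sec P (Dom D (FArr F f))"
      using P FArr_in[OF f] by (auto simp: presheaf_def)
    with f show "Act (pull_psh C F P) f \<in> Sec (pull_psh C F P) (Cod C f) \<rightarrow>\<^sub>E Sec (pull_psh C F P) (Dom C f)"
      by (simp add: C.Dom_in C.Cod_in Dom_FArr Cod_FArr)
  qed (simp add: pull_psh_def)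
qed (simp_all add: C.Ide_in C.Cmp_in C.Cod_in FArr_Ide FArr_Cmp FArr_in FObj_in Dom_FArr Cod_FArr
    Act_Ide[OF P] Act_Cmp[OF P])

lemma (in is_functor) presheaf_morphism_pull_psh:
  assumes "presheaf_morphism D P Q \<alpha>"
  shows "presheaf_morphism C (pull_psh C F P) (pull_psh C F Q) (\<lambda>A\<in>Obj C. \<alpha> (FObj F A))"
proof -
  have "\<alpha> (FObj F A) \<in> Sec P (FObj F A) \<rightarrow>\<^sub>E Sec Q (FObj F A)" if "A \<in> Obj C" for A
    using assms FObj_in[OF that] by (auto simp: presheaf_morphism_def)
  moreover have "\<alpha> (FObj F (Dom C f)) (Act P (FArr F f) x) = Act Q (FArr F f) (\<alpha> (FObj F (Cod C f)) x)"
    if "f \<in> Arr C" "x \<in> Sec P (FObj F (Cod C f))" for f x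
    using presheaf_morphism_natural[OF assms FArr_in[OF that(1)], of x] that by (simp add: Dom_FArr Cod_FArr)
  ultimately show ?thesis
    unfolding presheaf_morphism_def by (simp add: C.Dom_in C.Cod_in PiE_iff)
qed

text \<open>A fully faithful and essentially surjective functor. The set in
  \<open>cover_preserving\<close> is the sieve generated by the image of \<open>S\<close>: all
  arrows factoring through some \<open>FArr F f\<close>. Covers are compared in one direction only,
  so an equivalence of sites consists of two instances.\<close>

locale cover_preserving_equivalence = is_functor C D F
  for C :: "('o, 'a) cat" and D :: "('p, 'b) cat" and F :: "('o, 'a, 'p, 'b) fctr" +
  fixes J :: "'o \<Rightarrow> 'a set set" and K :: "'p \<Rightarrow> 'b set set"
  assumes full: "\<lbrakk>A \<in> Obj C; B \<in> Obj C; g \<in> Arr D; Dom D g = FObj F A; Cod D g = FObj F B\<rbrakk>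
      \<Longrightarrow> \<exists>f\<in>Arr C. Dom C f = A \<and> Cod C f = B \<and> FArr F f = g"
    and faithful: "\<lbrakk>f \<in> Arr C; f' \<in> Arr C; Dom C f = Dom C f'; Cod C f = Cod C f'; FArr F f = FArr F f'\<rbrakk>
      \<Longrightarrow> f = f'"
    and essentially_surjective: "Y \<in> Obj D \<Longrightarrow> \<exists>X\<in>Obj C. \<exists>k. iso_arrow D k \<and> Dom D k = FObj F X \<and> Cod D k = Y"
    and sieve: "\<lbrakk>A \<in> Obj C; S \<in> J A\<rbrakk> \<Longrightarrow> sieve C A S"
    and cover_preserving: "\<lbrakk>A \<in> Obj C; S \<in> J A\<rbrakk>
      \<Longrightarrow> {FArr F f \<cdot>\<^bsub>D\<^esub> k | f k. f \<in> S \<and> k \<in> Arr D \<and> Cod D k = FObj F (Dom C f)} \<in> K (FObj F A)"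
begin

text \<open>A matching family \<open>x\<close> on \<open>S\<close> is extended to the generated
  sieve \<open>R\<close> by giving \<open>FArr F f\<close> after \<open>k\<close> the value of
  \<open>k\<close> acting on \<open>x f\<close>. The sheaf condition of \<open>P\<close> on
  \<open>R\<close> then yields the amalgamation on \<open>S\<close>, once this value is known not to
  depend on the factorization.\<close>

lemma sheaf_pull_psh:
  assumes "sheaf D K P"
  shows "sheaf C J (pull_psh C F P)"
proof -
  have P: "presheaf D P" using assms by (rule sheaf_presheaf)
  have "\<exists>!s. s \<in> Sec (pull_psh C F P) A \<and> (\<forall>f\<in>S. Act (pull_psh C F P) f s = x f)"
    if A: "A \<in> Obj C" and S: "S \<in> J A" and x: "matching_family C (pull_psh C F P) S x" for A S x
  proof -
    have S_in: "f \<in> Arr C" "Cod C f = A" and closed: "\<lbrakk>h \<in> Arr C; Cod C h = Dom C f\<rbrakk> \<Longrightarrow> f \<cdot>\<^bsub>C\<^esub> h \<in> S"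
      if "f \<in> S" for f h
      using sieve[OF A S] that by (auto simp: sieve_def)
    have x_in: "x f \<in> Sec P (FObj F (Dom C f))"
      and x_match: "\<lbrakk>h \<in> Arr C; Cod C h = Dom C f\<rbrakk> \<Longrightarrow> Act P (FArr F h) (x f) = x (f \<cdot>\<^bsub>C\<^esub> h)"
      if "f \<in> S" for f h
      using x that S_in[OF that] by (auto simp: matching_family_def C.Dom_in)
    let ?fac = "\<lambda>g f k. f \<in> S \<and> k \<in> Arr D \<and> Cod D k = FObj F (Dom C f) \<and> g = FArr F f \<cdot>\<^bsub>D\<^esub> k"
    define R where "R = {FArr F f \<cdot>\<^bsub>D\<^esub> k | f k. f \<in> S \<and> k \<in> Arr D \<and> Cod D k = FObj F (Dom C f)}"
    have R: "R \<in> K (FObj F A)"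
      unfolding R_def by (rule cover_preserving[OF A S])
    have unique: "Act P k (x f) = Act P k' (x f')" if "?fac g f k" "?fac g f' k'" for g f k f' k'
    proof -
      have fk: "f \<in> S" "k \<in> Arr D" "Cod D k = FObj F (Dom C f)" "g = FArr F f \<cdot>\<^bsub>D\<^esub> k"
        and fk': "f' \<in> S" "k' \<in> Arr D" "Cod D k' = FObj F (Dom C f')" "g = FArr F f' \<cdot>\<^bsub>D\<^esub> k'"
        using that by auto
      note f = S_in[OF fk(1)] and f' = S_in[OF fk'(1)]
      have dom: "Dom D k' = Dom D k"
        using fk fk' D.Dom_Cmp[of k "FArr F f"] D.Dom_Cmp[of k' "FArr F f'"] f f'
        by (simp add: FArr_in Dom_FArr)
      \<comment> \<open>The common domain of \<open>k\<close> and \<open>k'\<close> need not be in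
        the image of \<open>F\<close>. After precomposing with an isomorphism \<open>u\<close> from
        an image object, fullness lifts both arrows to \<open>C\<close>, faithfulness equates the
        two composites there, and the matching condition applies; \<open>u\<close> is cancelled at
        the end, since it acts injectively.\<close>
      obtain X u where X: "X \<in> Obj C" and u: "iso_arrow D u" "Dom D u = FObj F X" "Cod D u = Dom D k"
        using essentially_surjective[OF D.Dom_in[OF fk(2)]] by blast
      note u' = D.iso_in[OF u(1)]
      obtain a where a: "a \<in> Arr C" "Dom C a = X" "Cod C a = Dom C f" "FArr F a = k \<cdot>\<^bsub>D\<^esub> u"
        using full[OF X C.Dom_in[OF f(1)], of "k \<cdot>\<^bsub>D\<^esub> u"] fk u u' by (auto simp: D.Cmp_in D.Dom_Cmp D.Cod_Cmp)
      obtain a' where a': "a' \<in> Arr C" "Dom C a' = X" "Cod C a' = Dom C f'" "FArr F a' = k' \<cdot>\<^bsub>D\<^esub> u"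
        using full[OF X C.Dom_in[OF f'(1)], of "k' \<cdot>\<^bsub>D\<^esub> u"] fk' u u' dom by (auto simp: D.Cmp_in D.Dom_Cmp D.Cod_Cmp)
      have "FArr F (f \<cdot>\<^bsub>C\<^esub> a) = g \<cdot>\<^bsub>D\<^esub> u"
        using a f fk u u' by (simp add: FArr_Cmp D.Cmp_assoc FArr_in Dom_FArr)
      also have "\<dots> = FArr F (f' \<cdot>\<^bsub>C\<^esub> a')"
        using a' f' fk' u u' dom by (simp add: FArr_Cmp D.Cmp_assoc FArr_in Dom_FArr)
      finally have "f \<cdot>\<^bsub>C\<^esub> a = f' \<cdot>\<^bsub>C\<^esub> a'"
        using a a' f f' by (intro faithful) (auto simp: C.Cmp_in C.Dom_Cmp C.Cod_Cmp)
      then have "Act P (k \<cdot>\<^bsub>D\<^esub> u) (x f) = Act P (k' \<cdot>\<^bsub>D\<^esub> u) (x f')"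
        using x_match[OF fk(1) a(1,3)] x_match[OF fk'(1) a'(1,3)] a(4) a'(4) by simp
      then have "Act P u (Act P k (x f)) = Act P u (Act P k' (x f'))"
        using fk fk' u u' dom x_in by (simp add: Act_Cmp[OF P])
      moreover have "Act P k (x f) \<in> Sec P (Cod D u)" "Act P k' (x f') \<in> Sec P (Cod D u)"
        using fk fk' u dom x_in Act_in[OF P, of k "x f"] Act_in[OF P, of k' "x f'"] by simp_all
      ultimately show ?thesis
        using D.bij_betw_Act_iso[OF P u(1)] by (auto simp: bij_betw_def dest: inj_onD)
    qed
    \<comment> \<open>Some factorization is picked; \<open>unique\<close> makes every other one give
      the same value.\<close>
    define y where "y g = (SOME z. \<exists>f k. ?fac g f k \<and> z = Act P k (x f))" for g
    have y_eq: "y g = Act P k (x f)" if "?fac g f k" for g f k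
    proof -
      have "\<exists>f k. ?fac g f k \<and> y g = Act P k (x f)"
        unfolding y_def by (rule someI_ex) (use that in blast)
      then show ?thesis
        using unique[OF that] by metis
    qed
    have "matching_family D P R y"
      unfolding matching_family_def
    proof (intro conjI ballI impI)
      fix g assume "g \<in> R"
      then obtain f k where fk: "?fac g f k" by (auto simp: R_def)
      then have "Dom D g = Dom D k"
        using S_in by (simp add: D.Dom_Cmp FArr_in Dom_FArr)
      then show "y g \<in> Sec P (Dom D g)"
        using fk x_in[of f] Act_in[OF P, of k "x f"] unfolding y_eq[OF fk] by simp
    next
      fix g h assume "g \<in> R" and h: "h \<in> Arr D" "Cod D h = Dom D g"
      then obtain f k where fk: "?fac g f k" by (auto simp: R_def)
      then have g: "Dom D g = Dom D k"
        using S_in by (simp add: D.Dom_Cmp FArr_in Dom_FArr)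
      then have gh: "?fac (g \<cdot>\<^bsub>D\<^esub> h) f (k \<cdot>\<^bsub>D\<^esub> h)"
        using fk h S_in by (simp add: D.Cmp_in D.Cod_Cmp D.Cmp_assoc FArr_in Dom_FArr)
      then show "Act P h (y g) = y (g \<cdot>\<^bsub>D\<^esub> h)"
        using fk h g x_in[of f] unfolding y_eq[OF fk] y_eq[OF gh] by (simp add: Act_Cmp[OF P])
    qed
    then have "\<exists>!s. s \<in> Sec P (FObj F A) \<and> (\<forall>g\<in>R. Act P g s = y g)"
      using assms R FObj_in[OF A] by (auto simp: sheaf_def)
    moreover have "(\<forall>g\<in>R. Act P g s = y g) \<longleftrightarrow> (\<forall>f\<in>S. Act (pull_psh C F P) f s = x f)"
      if s: "s \<in> Sec P (FObj F A)" for s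
    proof
      assume *: "\<forall>g\<in>R. Act P g s = y g"
      show "\<forall>f\<in>S. Act (pull_psh C F P) f s = x f"
      proof
        fix f assume f: "f \<in> S"
        note f' = S_in[OF f]
        \<comment> \<open>The factorization with \<open>k\<close> an identity recovers the original
          family from its extension.\<close>
        have fac: "?fac (FArr F f) f (Ide D (FObj F (Dom C f)))"
          using f f' D.Cmp_Ide_right[OF FArr_in[OF f'(1)]]
          by (simp add: D.Ide_in D.Cod_Ide FObj_in C.Dom_in Dom_FArr)
        then have "FArr F f \<in> R"
          by (auto simp: R_def)
        with * f f' show "Act (pull_psh C F P) f s = x f"
          by (simp add: y_eq[OF fac] Act_Ide[OF P] FObj_in C.Dom_in x_in)
      qed
    next
      assume *: "\<forall>f\<in>S. Act (pull_psh C F P) f s = x f"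
      show "\<forall>g\<in>R. Act P g s = y g"
      proof
        fix g assume "g \<in> R"
        then obtain f k where fk: "?fac g f k" by (auto simp: R_def)
        then show "Act P g s = y g"
          using * s S_in[of f] y_eq[OF fk] by (auto simp: Act_Cmp[OF P] FArr_in Dom_FArr Cod_FArr)
      qed
    qed
    ultimately show ?thesis
      using A by (simp cong: conj_cong)
  qed
  then show ?thesis
    by (simp add: sheaf_def presheaf_pull_psh[OF P])
qed

lemma is_functor_pull_psh:
  "is_functor (sheaf_category D K) (sheaf_category C J) (reindex_fctr (Obj C) (FObj F) (pull_psh C F))"
  using C.category_sheaf_category[of J] D.category_sheaf_category[of K]
  unfolding C.sheaf_category_eq D.sheaf_category_eq
  by (intro is_functor_reindex_fctr)
    (auto simp: FObj_in sheaf_pull_psh presheaf_morphism_pull_psh)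

end

text \<open>Pulling back reverses direction: along \<open>F\<close> it leads from sheaves on
  \<open>D\<close> to sheaves on \<open>C\<close>. Since \<open>G\<close> after \<open>F\<close> is
  strictly the identity, one round trip of sheaves is an equality, and only the other one needs the
  isomorphism \<theta>.\<close>

theorem equivalent_sheaf_categories:
  fixes C :: "('o, 'a) cat" and D :: "('p, 'b) cat"
  assumes F: "cover_preserving_equivalence C D F J K" and G: "cover_preserving_equivalence D C G K J"
    and GF: "\<And>A. A \<in> Obj C \<Longrightarrow> FObj G (FObj F A) = A" "\<And>f. f \<in> Arr C \<Longrightarrow> FArr G (FArr F f) = f"
    and \<theta>: "natural_iso D D id_fctr (comp_fctr F G) \<theta>"
  shows "equivalent_categories (sheaf_category C J :: ('o, 'a, 's) psh_cat) (sheaf_category D K :: ('p, 'b, 's) psh_cat)"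
    (is "equivalent_categories ?C ?D")
proof -
  interpret F: cover_preserving_equivalence C D F J K by fact
  interpret G: cover_preserving_equivalence D C G K J by fact
  let ?F = "reindex_fctr (Obj C) (FObj F) (pull_psh C F)" and ?G = "reindex_fctr (Obj D) (FObj G) (pull_psh D G)"
  have fct: "is_functor ?D ?C ?F" "is_functor ?C ?D ?G"
    by (rule F.is_functor_pull_psh G.is_functor_pull_psh)+
  have pull_GF: "pull_psh C F (pull_psh D G P) = P" if "presheaf C P" for P :: "('o, 'a, 's) psh"
  proof -
    have "Sec (pull_psh C F (pull_psh D G P)) = Sec P" "Act (pull_psh C F (pull_psh D G P)) = Act P"
      using that unfolding pull_psh_def presheaf_def
      by (auto intro!: extensionalityI[of _ "Obj C"] extensionalityI[of _ "Arr C"]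
          simp: PiE_def F.FObj_in F.FArr_in GF)
    then show ?thesis by simp
  qed
  have ext: "restrict (\<lambda>A. restrict (\<lambda>B. \<alpha> (FObj G B)) (Obj D) (FObj F A)) (Obj C) = \<alpha>"
    if "presheaf_morphism C P Q \<alpha>" for P Q :: "('o, 'a, 's) psh" and \<alpha>
    using presheaf_morphism_extensional[OF that]
    by (auto intro!: extensionalityI[of _ "Obj C"] simp: F.FObj_in GF)
  have "FArr ?F (FArr ?G f) = f" if f: "f \<in> Arr ?C" for f
  proof -
    obtain P Q \<alpha> where "f = (P, Q, \<alpha>)" "sheaf C J P" "sheaf C J Q" "presheaf_morphism C P Q \<alpha>"
      using f by (auto simp: F.C.sheaf_category_eq)
    then show ?thesis
      by (simp only: reindex_fctr_simps pull_GF sheaf_presheaf ext)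
  qed
  moreover have "FObj ?F (FObj ?G P) = P" if "P \<in> Obj ?C" for P
    using that by (simp add: F.C.sheaf_category_eq pull_GF sheaf_presheaf)
  ultimately have "natural_iso ?C ?C id_fctr (comp_fctr ?F ?G) (Ide ?C)"
    using natural_iso_Ide[OF is_functor_id[OF F.C.category_sheaf_category] is_functor_comp[OF fct(2,1)]]
    by simp
  moreover
  have \<theta>': "iso_arrow D (\<theta> B)" "\<theta> B \<in> Arr D" "Dom D (\<theta> B) = B" "Cod D (\<theta> B) = FObj F (FObj G B)"
    if "B \<in> Obj D" for B
  proof -
    have "iso_arrow D (\<theta> B) \<and> Dom D (\<theta> B) = B \<and> Cod D (\<theta> B) = FObj F (FObj G B)"
      using \<theta> that unfolding natural_iso_def id_fctr_simps comp_fctr_simps by blast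
    then show "iso_arrow D (\<theta> B)" "\<theta> B \<in> Arr D" "Dom D (\<theta> B) = B" "Cod D (\<theta> B) = FObj F (FObj G B)"
      by (simp_all add: F.D.iso_in)
  qed
  have \<theta>_nat: "\<theta> (Cod D f) \<cdot>\<^bsub>D\<^esub> f = FArr F (FArr G f) \<cdot>\<^bsub>D\<^esub> \<theta> (Dom D f)" if "f \<in> Arr D" for f
    using \<theta> that unfolding natural_iso_def id_fctr_simps comp_fctr_simps by blast
  let ?pull = "\<lambda>Q :: ('p, 'b, 's) psh. pull_psh D G (pull_psh C F Q)"
  \<comment> \<open>As \<theta> runs from \<open>B\<close> to \<open>FObj F (FObj G B)\<close>, its
    contravariant action runs from the twice pulled back sheaf to \<open>Q\<close>, the direction
    required of a counit.\<close>
  define \<epsilon> where "\<epsilon> Q = (?pull Q, Q, \<lambda>B\<in>Obj D. Act Q (\<theta> B))" for Q :: "('p, 'b, 's) psh"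
  have \<epsilon>: "presheaf_morphism D (?pull Q) Q (\<lambda>B\<in>Obj D. Act Q (\<theta> B))" if Q: "presheaf D Q" for Q
    unfolding presheaf_morphism_def
  proof (intro conjI ballI PiE_I)
    fix B x assume "B \<in> Obj D" "x \<in> Sec (?pull Q) B"
    then show "(\<lambda>B\<in>Obj D. Act Q (\<theta> B)) B x \<in> Sec Q B"
      using Act_in[OF Q \<theta>'(2), of B x] by (simp add: G.FObj_in \<theta>')
  next
    fix B x assume "B \<in> Obj D" "x \<notin> Sec (?pull Q) B"
    then show "(\<lambda>B\<in>Obj D. Act Q (\<theta> B)) B x = undefined"
      using extensional_arb[OF Act_extensional[OF Q \<theta>'(2)], of B x] by (simp add: G.FObj_in \<theta>')
  next
    fix f x assume f: "f \<in> Arr D" and x: "x \<in> Sec (?pull Q) (Cod D f)"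
    have x': "x \<in> Sec Q (FObj F (FObj G (Cod D f)))"
      using f x by (simp add: G.FObj_in F.D.Cod_in)
    note obj = F.D.Dom_in[OF f] F.D.Cod_in[OF f]
    have "Act Q (\<theta> (Dom D f)) (Act Q (FArr F (FArr G f)) x) = Act Q (FArr F (FArr G f) \<cdot>\<^bsub>D\<^esub> \<theta> (Dom D f)) x"
      using f x' obj by (intro Act_Cmp[OF Q, symmetric]) (simp_all add: \<theta>' F.FArr_in G.FArr_in F.Dom_FArr F.Cod_FArr
          G.Dom_FArr G.Cod_FArr)
    also have "FArr F (FArr G f) \<cdot>\<^bsub>D\<^esub> \<theta> (Dom D f) = \<theta> (Cod D f) \<cdot>\<^bsub>D\<^esub> f"
      by (rule \<theta>_nat[OF f, symmetric])
    also have "Act Q \<dots> x = Act Q f (Act Q (\<theta> (Cod D f)) x)"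
      using f x' obj by (intro Act_Cmp[OF Q]) (simp_all add: \<theta>')
    finally show "(\<lambda>B\<in>Obj D. Act Q (\<theta> B)) (Dom D f) (Act (?pull Q) f x)
        = Act Q f ((\<lambda>B\<in>Obj D. Act Q (\<theta> B)) (Cod D f) x)"
      using f obj by (simp add: G.FArr_in)
  qed simp
  have iso: "iso_arrow ?D (\<epsilon> Q)" if Q: "sheaf D K Q" for Q
    unfolding \<epsilon>_def
  proof (rule F.D.iso_sheaf_category)
    show "sheaf D K (?pull Q)"
      by (intro G.sheaf_pull_psh F.sheaf_pull_psh Q)
    show "bij_betw ((\<lambda>B\<in>Obj D. Act Q (\<theta> B)) B) (Sec (?pull Q) B) (Sec Q B)" if "B \<in> Obj D" for B
      using F.D.bij_betw_Act_iso[OF sheaf_presheaf[OF Q] \<theta>'(1)[OF that]] that by (simp add: \<theta>' G.FObj_in)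
  qed (rule Q \<epsilon>[OF sheaf_presheaf[OF Q]])+
  \<comment> \<open>The naturality square of \<epsilon> at \<alpha>, taken at \<open>B\<close>, is
    the naturality square of \<alpha> at \<open>\<theta> B\<close>.\<close>
  have nat: "(\<lambda>B\<in>Obj D. compose (Sec (?pull Q) B) (Act R (\<theta> B)) (\<alpha> (FObj F (FObj G B))))
      = (\<lambda>B\<in>Obj D. compose (Sec (?pull Q) B) (\<alpha> B) (Act Q (\<theta> B)))"
    if \<alpha>: "presheaf_morphism D Q R \<alpha>" for Q R :: "('p, 'b, 's) psh" and \<alpha>
    using presheaf_morphism_natural[OF \<alpha> \<theta>'(2)] by (auto intro!: restrict_ext simp: compose_def \<theta>' G.FObj_in)
  have "natural_iso ?D ?D (comp_fctr ?G ?F) id_fctr \<epsilon>"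
    unfolding natural_iso_def
  proof (intro conjI ballI)
    fix f assume "f \<in> Arr ?D"
    then obtain Q R \<alpha> where f: "f = (Q, R, \<alpha>)" and \<alpha>: "presheaf_morphism D Q R \<alpha>"
      by (auto simp: F.D.sheaf_category_eq)
    have "(\<lambda>B\<in>Obj D. compose (Sec (?pull Q) B) ((\<lambda>B\<in>Obj D. Act R (\<theta> B)) B)
          ((\<lambda>B\<in>Obj D. (\<lambda>A\<in>Obj C. \<alpha> (FObj F A)) (FObj G B)) B))
        = (\<lambda>B\<in>Obj D. compose (Sec (?pull Q) B) (\<alpha> B) ((\<lambda>B\<in>Obj D. Act Q (\<theta> B)) B))"
      using nat[OF \<alpha>] by (simp add: G.FObj_in cong: restrict_cong)
    then show "\<epsilon> (Cod ?D f) \<cdot>\<^bsub>?D\<^esub> FArr (comp_fctr ?G ?F) f = FArr id_fctr f \<cdot>\<^bsub>?D\<^esub> \<epsilon> (Dom ?D f)"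
      by (simp only: f F.D.sheaf_category_eq \<epsilon>_def family_category_simps comp_fctr_simps id_fctr_simps reindex_fctr_simps)
  next
    fix Q assume "Q \<in> Obj ?D"
    then have "sheaf D K Q" by (simp add: F.D.sheaf_category_eq)
    then show "iso_arrow ?D (\<epsilon> Q)" by (rule iso)
  qed (simp_all add: F.D.sheaf_category_eq \<epsilon>_def)
  ultimately show ?thesis
    using fct unfolding equivalent_categories_def by blast
qed



section \<open>The ordered groupoid of a left-cancellative category\<close>

context left_cancellative_category
begin

text \<open>The equality of domains asked for in \<open>mono_arrow\<close> comes for free, because a
  composite has the domain of its right factor.\<close>

lemma cancel:
  assumes "m \<in> Arr C" "f \<in> Arr C" "g \<in> Arr C" "Cod C f = Dom C m" "Cod C g = Dom C m" "m \<cdot> f = m \<cdot> g"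
  shows "f = g"
proof -
  have "Dom C f = Dom C g"
    using assms Dom_Cmp[of f m] Dom_Cmp[of g m] by simp
  then show ?thesis
    using mono[OF assms(1)] assms by (simp add: mono_arrow_def)
qed

text \<open>From \<open>h g = id\<close> it follows that \<open>h (g h) = h\<close>, and cancelling
  \<open>h\<close> on the left gives \<open>g h = id\<close>. This yields antisymmetry of the order
  on \<open>G(C)\<close>.\<close>

lemma right_inverse_iso:
  assumes "h \<in> Arr C" "g \<in> Arr C" "Dom C h = Cod C g" "h \<cdot> g = Ide C (Cod C h)"
  shows "iso_arrow C h"
proof -
  have "Dom C g = Dom C (h \<cdot> g)"
    by (rule Dom_Cmp[OF assms(2,1,3), symmetric])
  also have "\<dots> = Cod C h"
    unfolding assms(4) by (rule Dom_Ide[OF Cod_in[OF assms(1)]])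
  finally have g: "Dom C g = Cod C h" .
  have "h \<cdot> (g \<cdot> h) = (h \<cdot> g) \<cdot> h"
    by (rule Cmp_assoc[symmetric]) (simp_all only: assms g)
  also have "\<dots> = h \<cdot> Ide C (Dom C h)"
    unfolding assms(4) by (simp only: Cmp_Ide_left Cmp_Ide_right assms(1))
  finally have "g \<cdot> h = Ide C (Dom C h)"
    by (rule cancel[OF assms(1), rotated -1])
      (simp_all only: assms(1-3) g Cmp_in Cod_Cmp Ide_in Cod_Ide Dom_in Cod_in)
  with assms g have "inverse_arrows C h g"
    by (simp add: inverse_arrows_def)
  then show ?thesis
    by (auto simp: iso_arrow_def)
qed

lemma Cmp_iso_inv_arrow:
  assumes "m \<in> Arr C" "iso_arrow C k" "Cod C k = Dom C m"
  shows "(m \<cdot> k) \<cdot> inv_arrow C k = m"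
proof -
  have "(m \<cdot> k) \<cdot> inv_arrow C k = m \<cdot> (k \<cdot> inv_arrow C k)"
    by (rule Cmp_assoc) (use assms inv_arrow[OF assms(2)] iso_in in simp_all)
  then show ?thesis
    using assms by (simp add: inv_arrow Cmp_Ide_right)
qed

lemma span_classI: "\<lbrakk>iso_arrow C k; Cod C k = Dom C m\<rbrakk> \<Longrightarrow> (m \<cdot> k, n \<cdot> k) \<in> span_class C m n"
  by (auto simp: span_class_def)

lemma subobj_self: "m \<in> Arr C \<Longrightarrow> m \<in> subobj C m"
  unfolding subobj_def using Cmp_Ide_right[of m]
  by (auto intro!: exI[of _ "Ide C (Dom C m)"] simp: iso_Ide Cod_Ide Dom_in)

lemma span_class_self: "\<lbrakk>m \<in> Arr C; n \<in> Arr C; Dom C m = Dom C n\<rbrakk> \<Longrightarrow> (m, n) \<in> span_class C m n"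
  using span_classI[of "Ide C (Dom C m)" m n] Cmp_Ide_right[of m] Cmp_Ide_right[of n]
  by (simp add: iso_Ide Cod_Ide Dom_in)

lemma span_class_Cmp_iso_subset:
  assumes "m \<in> Arr C" "n \<in> Arr C" "Dom C m = Dom C n" "iso_arrow C k" "Cod C k = Dom C m"
  shows "span_class C (m \<cdot> k) (n \<cdot> k) \<subseteq> span_class C m n"
proof
  fix p assume "p \<in> span_class C (m \<cdot> k) (n \<cdot> k)"
  then obtain l where p: "p = ((m \<cdot> k) \<cdot> l, (n \<cdot> k) \<cdot> l)" and l: "iso_arrow C l" "Cod C l = Dom C k"
    using assms iso_in[OF assms(4)] by (auto simp: span_class_def Dom_Cmp)
  have "p = (m \<cdot> (k \<cdot> l), n \<cdot> (k \<cdot> l))"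
    using assms l iso_in[OF assms(4)] iso_in[OF l(1)] by (simp add: p Cmp_assoc)
  then show "p \<in> span_class C m n"
    using assms l iso_in[OF assms(4)] iso_in[OF l(1)] by (simp add: span_classI iso_Cmp Cod_Cmp)
qed

lemma span_class_Cmp_iso:
  assumes "m \<in> Arr C" "n \<in> Arr C" "Dom C m = Dom C n" "iso_arrow C k" "Cod C k = Dom C m"
  shows "span_class C (m \<cdot> k) (n \<cdot> k) = span_class C m n"
proof
  note inv = inv_arrow[OF assms(4)] iso_inv_arrow[OF assms(4)]
  have "span_class C ((m \<cdot> k) \<cdot> inv_arrow C k) ((n \<cdot> k) \<cdot> inv_arrow C k) \<subseteq> span_class C (m \<cdot> k) (n \<cdot> k)"
    using assms inv iso_in[OF assms(4)] by (intro span_class_Cmp_iso_subset) (simp_all add: Cmp_in Dom_Cmp)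
  then show "span_class C m n \<subseteq> span_class C (m \<cdot> k) (n \<cdot> k)"
    using assms by (simp add: Cmp_iso_inv_arrow)
qed (rule span_class_Cmp_iso_subset[OF assms])

lemma Domain_span_class [simp]: "Domain (span_class C m n) = subobj C m"
  by (auto simp: span_class_def subobj_def)

lemma Range_span_class: "Dom C m = Dom C n \<Longrightarrow> Range (span_class C m n) = subobj C n"
  by (auto simp: span_class_def subobj_def)

lemma Id_on_subobj: "Id_on (subobj C m) = span_class C m m"
  by (auto simp: span_class_def subobj_def)

lemma subobj_Cmp_iso: "\<lbrakk>m \<in> Arr C; iso_arrow C k; Cod C k = Dom C m\<rbrakk> \<Longrightarrow> subobj C (m \<cdot> k) = subobj C m"
  by (metis Domain_span_class span_class_Cmp_iso)

text \<open>As \<open>m\<close> is itself a member of \<open>[n]\<close>, membership names the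
  comparison isomorphism. Equalities of classes become equations between arrows in this way.\<close>

lemma subobj_eqE:
  assumes "m \<in> Arr C" "n \<in> Arr C" "subobj C m = subobj C n"
  obtains k where "iso_arrow C k" "Cod C k = Dom C n" "Dom C k = Dom C m" "m = n \<cdot> k"
proof -
  from assms have "m \<in> subobj C n" using subobj_self by blast
  then obtain k where k: "iso_arrow C k" "Cod C k = Dom C n" "m = n \<cdot> k"
    by (auto simp: subobj_def)
  then have "Dom C k = Dom C m"
    using assms iso_in[OF k(1)] by (simp add: Dom_Cmp)
  with k show ?thesis by (intro that)
qed

section \<open>The groupoid \<open>G(C)\<close> and its order\<close>

lemma Ggpd_simps [simp]:
  "Obj (Ggpd C) = {subobj C m | m. m \<in> Arr C}"
  "Arr (Ggpd C) = {span_class C m n | m n. m \<in> Arr C \<and> n \<in> Arr C \<and> Dom C m = Dom C n}"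
  "Dom (Ggpd C) = Domain" "Cod (Ggpd C) = Range" "Ide (Ggpd C) = Id_on"
  by (simp_all add: Ggpd_def)

lemma mem_Cmp_Ggpd: "p \<in> Q \<cdot>\<^bsub>Ggpd C\<^esub> P \<longleftrightarrow> (\<exists>k m m' n h. p = (k, n \<cdot> h) \<and>
    (k, m) \<in> P \<and> (m', n) \<in> Q \<and> iso_arrow C h \<and> Cod C h = Dom C m' \<and> m = m' \<cdot> h)"
  by (simp add: Ggpd_def)

text \<open>Representatives \<open>a u, b u\<close> and \<open>b v, c v\<close> that match through
  \<open>h\<close> satisfy \<open>b u = b v h\<close>. Cancelling \<open>b\<close> gives
  \<open>u = v h\<close>, so the composite pair is \<open>a u, c u\<close>.\<close>

lemma Cmp_span_class:
  assumes "a \<in> Arr C" "b \<in> Arr C" "c \<in> Arr C" "Dom C a = Dom C b" "Dom C b = Dom C c"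
  shows "span_class C b c \<cdot>\<^bsub>Ggpd C\<^esub> span_class C a b = span_class C a c"
proof
  show "span_class C b c \<cdot>\<^bsub>Ggpd C\<^esub> span_class C a b \<subseteq> span_class C a c"
  proof
    fix p assume "p \<in> span_class C b c \<cdot>\<^bsub>Ggpd C\<^esub> span_class C a b"
    then obtain k m m' n h where p: "p = (k, n \<cdot> h)" and km: "(k, m) \<in> span_class C a b"
      and mn: "(m', n) \<in> span_class C b c" and h': "iso_arrow C h" "Cod C h = Dom C m'" "m = m' \<cdot> h"
      by (auto simp only: mem_Cmp_Ggpd)
    from km obtain u where u: "iso_arrow C u" "Cod C u = Dom C a" "k = a \<cdot> u" "m = b \<cdot> u"
      by (auto simp: span_class_def)
    from mn obtain v where v: "iso_arrow C v" "Cod C v = Dom C b" "m' = b \<cdot> v" "n = c \<cdot> v"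
      by (auto simp: span_class_def)
    note in_C = iso_in[OF u(1)] iso_in[OF v(1)] iso_in[OF h'(1)]
    have cod_h: "Cod C h = Dom C v"
      using h'(2) v in_C assms by (simp add: Dom_Cmp)
    have "b \<cdot> u = (b \<cdot> v) \<cdot> h"
      using h'(3) u(4) v(3) by simp
    also have "\<dots> = b \<cdot> (v \<cdot> h)"
      using in_C cod_h v(2) assms by (intro Cmp_assoc) simp_all
    finally have uvh: "u = v \<cdot> h"
      by - (rule cancel[of b]; use in_C cod_h u(2) v(2) assms(2,4) in \<open>simp add: Cmp_in Cod_Cmp\<close>)
    have "(c \<cdot> v) \<cdot> h = c \<cdot> (v \<cdot> h)"
      using in_C cod_h v(2) assms by (intro Cmp_assoc) simp_all
    then have "p = (a \<cdot> u, c \<cdot> u)"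
      unfolding uvh p u(3) v(4) by simp
    then show "p \<in> span_class C a c"
      using u(1,2) by (simp add: span_classI)
  qed
  show "span_class C a c \<subseteq> span_class C b c \<cdot>\<^bsub>Ggpd C\<^esub> span_class C a b"
  proof
    fix p assume "p \<in> span_class C a c"
    then obtain u where p: "p = (a \<cdot> u, c \<cdot> u)" and u: "iso_arrow C u" "Cod C u = Dom C a"
      by (auto simp: span_class_def)
    then have "(a \<cdot> u, b \<cdot> u) \<in> span_class C a b" "(b, c) \<in> span_class C b c"
      using assms by (auto simp: span_class_self intro: span_classI)
    with u(1) u(2)[unfolded assms(4)] show "p \<in> span_class C b c \<cdot>\<^bsub>Ggpd C\<^esub> span_class C a b"
      unfolding p mem_Cmp_Ggpd
      by (intro exI[of _ "a \<cdot> u"] exI[of _ "b \<cdot> u"] exI[of _ b] exI[of _ c] exI[of _ u] conjI refl)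
  qed
qed

text \<open>The middle legs agree only up to an isomorphism, which is absorbed into the
  representative of \<open>Q\<close> so that \<open>Cmp_span_class\<close> applies
  literally.\<close>

lemma composable_spansE:
  assumes "P \<in> Arr (Ggpd C)" "Q \<in> Arr (Ggpd C)" "Domain Q = Range P"
  obtains a b c where "a \<in> Arr C" "b \<in> Arr C" "c \<in> Arr C" "Dom C a = Dom C b" "Dom C b = Dom C c"
    "P = span_class C a b" "Q = span_class C b c"
proof -
  from assms obtain a b b' c' where P: "a \<in> Arr C" "b \<in> Arr C" "Dom C a = Dom C b" "P = span_class C a b"
    and Q: "b' \<in> Arr C" "c' \<in> Arr C" "Dom C b' = Dom C c'" "Q = span_class C b' c'"
    by auto
  have "subobj C b = subobj C b'"
    using assms(3) P(3) by (simp add: P(4) Q(4) Range_span_class)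
  with P(2) Q(1) obtain k where k: "iso_arrow C k" "Cod C k = Dom C b'" "Dom C k = Dom C b" "b = b' \<cdot> k"
    by (rule subobj_eqE)
  show ?thesis
  proof (rule that[of a b "c' \<cdot> k"])
    show "Q = span_class C b (c' \<cdot> k)"
      unfolding Q(4) k(4) by (rule span_class_Cmp_iso[symmetric]) (simp_all add: Q(1-3) k(1,2))
  qed (use P Q(1-3) k(1-3) iso_in[OF k(1)] in \<open>simp_all add: Cmp_in Dom_Cmp\<close>)
qed

lemma span_class_in: "\<lbrakk>m \<in> Arr C; n \<in> Arr C; Dom C m = Dom C n\<rbrakk> \<Longrightarrow> span_class C m n \<in> Arr (Ggpd C)"
  by auto

lemma Ggpd_Cmp:
  assumes "P \<in> Arr (Ggpd C)" "Q \<in> Arr (Ggpd C)" "Domain Q = Range P"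
  shows "Q \<cdot>\<^bsub>Ggpd C\<^esub> P \<in> Arr (Ggpd C)"
    and "Domain (Q \<cdot>\<^bsub>Ggpd C\<^esub> P) = Domain P" "Range (Q \<cdot>\<^bsub>Ggpd C\<^esub> P) = Range Q"
proof -
  obtain a b c where "a \<in> Arr C" "b \<in> Arr C" "c \<in> Arr C" "Dom C a = Dom C b" "Dom C b = Dom C c"
    "P = span_class C a b" "Q = span_class C b c"
    by (rule composable_spansE[OF assms])
  then show "Q \<cdot>\<^bsub>Ggpd C\<^esub> P \<in> Arr (Ggpd C)"
    and "Domain (Q \<cdot>\<^bsub>Ggpd C\<^esub> P) = Domain P" "Range (Q \<cdot>\<^bsub>Ggpd C\<^esub> P) = Range Q"
    by (simp_all add: Cmp_span_class Range_span_class span_class_in del: Ggpd_simps(1,2))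
qed

lemma category_Ggpd: "category (Ggpd C)"
proof (unfold_locales, goal_cases)
  case (11 P Q R)
  then have "Domain Q = Range P" by simp
  with 11(1,2) obtain a b c where abc: "a \<in> Arr C" "b \<in> Arr C" "c \<in> Arr C" "Dom C a = Dom C b" "Dom C b = Dom C c"
    and P: "P = span_class C a b" and Q: "Q = span_class C b c"
    by (rule composable_spansE)
  have "Domain R = subobj C c"
    using 11(5) abc by (simp add: Q Range_span_class)
  moreover obtain c' d where c': "c' \<in> Arr C" "d \<in> Arr C" "Dom C c' = Dom C d" "R = span_class C c' d"
    using 11(3) by auto
  ultimately have "subobj C c = subobj C c'" by simp
  with abc(3) c'(1) obtain k where k: "iso_arrow C k" "Cod C k = Dom C c'" "Dom C k = Dom C c" "c = c' \<cdot> k"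
    by (rule subobj_eqE)
  define e where "e = d \<cdot> k"
  have e: "e \<in> Arr C" "Dom C e = Dom C c"
    using c'(1-3) k(1-3) iso_in[OF k(1)] by (simp_all add: e_def Cmp_in Dom_Cmp)
  have R: "R = span_class C c e"
    unfolding e_def c'(4) k(4) by (rule span_class_Cmp_iso[symmetric]) (simp_all add: c'(1-3) k(1,2))
  show ?case
    using abc e by (simp add: P Q R Cmp_span_class)
qed (auto simp: Range_span_class Id_on_subobj Cmp_span_class Ggpd_Cmp simp del: Ggpd_simps(2) | auto simp: Range_span_class Id_on_subobj Cmp_span_class)+

text \<open>The order is defined through some representative of the larger class. A change of
  representative by an isomorphism \<open>k\<close> is absorbed by replacing \<open>h\<close> with
  \<open>k\<close> after it, so any fixed representative will do.\<close>

lemma leA_span_class_iff: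
  assumes "m \<in> Arr C" "n \<in> Arr C" "Dom C m = Dom C n"
  shows "leA (Ggpd C) P (span_class C m n)
    \<longleftrightarrow> (\<exists>h\<in>Arr C. Cod C h = Dom C m \<and> P = span_class C (m \<cdot> h) (n \<cdot> h))" (is "?l \<longleftrightarrow> ?r")
proof
  assume ?l
  then obtain m' n' h where *: "m' \<in> Arr C" "n' \<in> Arr C" "Dom C m' = Dom C n'" "h \<in> Arr C" "Cod C h = Dom C m'"
    "P = span_class C (m' \<cdot> h) (n' \<cdot> h)" "span_class C m n = span_class C m' n'"
    by (auto simp: leA_def Ggpd_def)
  then have "(m', n') \<in> span_class C m n"
    by (simp add: span_class_self)
  then obtain k where k: "iso_arrow C k" "Cod C k = Dom C m" "m' = m \<cdot> k" "n' = n \<cdot> k"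
    by (auto simp: span_class_def)
  show ?r
    using * k assms iso_in[OF k(1)]
    by (intro bexI[of _ "k \<cdot> h"]) (simp_all add: Cmp_assoc Cmp_in Dom_Cmp Cod_Cmp)
next
  assume ?r
  then obtain h where "h \<in> Arr C" "Cod C h = Dom C m" "P = span_class C (m \<cdot> h) (n \<cdot> h)" by blast
  with assms have "(P, span_class C m n) \<in> Ord (Ggpd C)"
    unfolding Ggpd_def ogpd.simps by blast
  then show ?l
    by (simp add: leA_def)
qed

lemma leA_spanE:
  assumes "leA (Ggpd C) P Q"
  obtains m n h where "m \<in> Arr C" "n \<in> Arr C" "Dom C m = Dom C n" "h \<in> Arr C" "Cod C h = Dom C m"
    "P = span_class C (m \<cdot> h) (n \<cdot> h)" "Q = span_class C m n"
  using assms by (auto simp: leA_def Ggpd_def)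

lemma inv_arrow_span_class:
  assumes "m \<in> Arr C" "n \<in> Arr C" "Dom C m = Dom C n"
  shows "inverse_arrows (Ggpd C) (span_class C m n) (span_class C n m)"
    and "inv_arrow (Ggpd C) (span_class C m n) = span_class C n m"
proof -
  show *: "inverse_arrows (Ggpd C) (span_class C m n) (span_class C n m)"
    using assms unfolding inverse_arrows_def
    by (simp add: span_class_in Range_span_class Cmp_span_class Id_on_subobj del: Ggpd_simps(1,2))
  show "inv_arrow (Ggpd C) (span_class C m n) = span_class C n m"
    by (rule category.inv_arrow_eq[OF category_Ggpd *])
qed

lemma leO_subobj_iff:
  assumes "m \<in> Arr C"
  shows "leO (Ggpd C) A (subobj C m) \<longleftrightarrow> (\<exists>h\<in>Arr C. Cod C h = Dom C m \<and> A = subobj C (m \<cdot> h))"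
proof
  assume "leO (Ggpd C) A (subobj C m)"
  then obtain h where "h \<in> Arr C" "Cod C h = Dom C m" "Id_on A = Id_on (subobj C (m \<cdot> h))"
    using assms by (auto simp: leO_def Id_on_subobj leA_span_class_iff)
  then show "\<exists>h\<in>Arr C. Cod C h = Dom C m \<and> A = subobj C (m \<cdot> h)"
    by (metis Domain_Id_on)
next
  assume "\<exists>h\<in>Arr C. Cod C h = Dom C m \<and> A = subobj C (m \<cdot> h)"
  then obtain h where "h \<in> Arr C" "Cod C h = Dom C m" "A = subobj C (m \<cdot> h)" by blast
  with assms show "leO (Ggpd C) A (subobj C m)"
    by (auto simp: leO_def Id_on_subobj leA_span_class_iff Cmp_in)
qed

lemma ordered_groupoid_Ggpd: "ordered_groupoid (Ggpd C)"
proof -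
  interpret G: category "Ggpd C" by (rule category_Ggpd)
  \<comment> \<open>Going down along \<open>h\<close> and \<open>h'\<close> and back by an
    isomorphism \<open>k\<close> fixes \<open>m\<close>. Cancelling \<open>m\<close> leaves a right
    inverse of \<open>h\<close>, so \<open>h\<close> is invertible and does not change the
    class.\<close>
  have antisym: "P = Q" if le: "leA (Ggpd C) P Q" "leA (Ggpd C) Q P" for P Q
  proof -
    obtain m n h where *: "m \<in> Arr C" "n \<in> Arr C" "Dom C m = Dom C n" "h \<in> Arr C" "Cod C h = Dom C m"
      "P = span_class C (m \<cdot> h) (n \<cdot> h)" "Q = span_class C m n"
      using le(1) by (rule leA_spanE)
    then obtain h' where h': "h' \<in> Arr C" "Cod C h' = Dom C h" "Q = span_class C ((m \<cdot> h) \<cdot> h') ((n \<cdot> h) \<cdot> h')"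
      using le(2) by (auto simp: leA_span_class_iff Cmp_in Dom_Cmp)
    have "(m, n) \<in> Q"
      using * by (simp add: span_class_self)
    then obtain k where k: "iso_arrow C k" "Cod C k = Dom C h'" "m = ((m \<cdot> h) \<cdot> h') \<cdot> k"
      unfolding h'(3) using * h' by (auto simp: span_class_def Cmp_in Dom_Cmp)
    note k' = iso_in[OF k(1)]
    have "((m \<cdot> h) \<cdot> h') \<cdot> k = m \<cdot> (h \<cdot> (h' \<cdot> k))"
      using *(1-5) h'(1,2) k(1,2) k' by (simp add: Cmp_assoc Cmp_in Dom_Cmp Cod_Cmp)
    with k(3) have "m \<cdot> Ide C (Dom C m) = m \<cdot> (h \<cdot> (h' \<cdot> k))"
      using Cmp_Ide_right[OF *(1)] by argo
    then have "Ide C (Dom C m) = h \<cdot> (h' \<cdot> k)"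
      by - (rule cancel[of m]; use *(1-5) h'(1,2) k(1,2) k' in \<open>simp add: Ide_in Cod_Ide Dom_in Cmp_in Cod_Cmp\<close>)
    then have "iso_arrow C h"
      using *(1-5) h'(1,2) k(1,2) k' by (intro right_inverse_iso[of h "h' \<cdot> k"]) (simp_all add: Cmp_in Cod_Cmp)
    with * show ?thesis
      by (simp add: span_class_Cmp_iso)
  qed
  show ?thesis
  proof (unfold_locales, goal_cases)
    case (1 P)
    then show ?case
      using inv_arrow_span_class(1) unfolding iso_arrow_def by fastforce
  next
    case 2
    have sub: "Ord (Ggpd C) \<subseteq> Arr (Ggpd C) \<times> Arr (Ggpd C)"
    proof
      fix p assume "p \<in> Ord (Ggpd C)"
      then have "leA (Ggpd C) (fst p) (snd p)" by (simp add: leA_def)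
      then show "p \<in> Arr (Ggpd C) \<times> Arr (Ggpd C)"
        by (elim leA_spanE) (simp add: mem_Times_iff span_class_in Cmp_in Dom_Cmp del: Ggpd_simps)
    qed
    have refl: "leA (Ggpd C) P P" if "P \<in> Arr (Ggpd C)" for P
    proof -
      from that obtain m n where mn: "m \<in> Arr C" "n \<in> Arr C" "Dom C m = Dom C n" "P = span_class C m n" by auto
      then show ?thesis
        using Cmp_Ide_right[of m] Cmp_Ide_right[of n]
        by (auto simp: leA_span_class_iff Ide_in Cod_Ide Dom_in intro!: bexI[of _ "Ide C (Dom C m)"])
    qed
    have trans: "leA (Ggpd C) P R" if PQ: "leA (Ggpd C) P Q" and QR: "leA (Ggpd C) Q R" for P Q R
    proof -
      obtain m n h where *: "m \<in> Arr C" "n \<in> Arr C" "Dom C m = Dom C n" "h \<in> Arr C" "Cod C h = Dom C m"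
        "Q = span_class C (m \<cdot> h) (n \<cdot> h)" "R = span_class C m n"
        using QR by (rule leA_spanE)
      then obtain h' where h': "h' \<in> Arr C" "Cod C h' = Dom C h" "P = span_class C ((m \<cdot> h) \<cdot> h') ((n \<cdot> h) \<cdot> h')"
        using PQ by (auto simp: leA_span_class_iff Cmp_in Dom_Cmp)
      then show ?thesis
        using * by (auto simp: leA_span_class_iff Cmp_assoc Cmp_in Cod_Cmp intro!: bexI[of _ "h \<cdot> h'"])
    qed
    show ?case
      unfolding partial_order_on_def preorder_on_def
      using sub refl[unfolded leA_def] trans[unfolded leA_def] antisym[unfolded leA_def]
      by (intro conjI refl_onI transI antisymI) blast+
  next
    case (3 P Q)
    then show ?case
    proof (elim leA_spanE)
      fix m n h
      assume *: "m \<in> Arr C" "n \<in> Arr C" "Dom C m = Dom C n" "h \<in> Arr C" "Cod C h = Dom C m"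
        "P = span_class C (m \<cdot> h) (n \<cdot> h)" "Q = span_class C m n"
      then show ?thesis
        by (auto simp: inv_arrow_span_class Cmp_in Dom_Cmp leA_span_class_iff)
    qed
  next
    \<comment> \<open>The larger arrows are given a common middle leg \<open>y\<close>, while the
      smaller ones restrict along a priori different \<open>h\<close> and \<open>h'\<close>.
      Composability makes \<open>y h\<close> and \<open>y h'\<close> isomorphic, and cancelling
      \<open>y\<close> shows that \<open>h\<close> serves for both.\<close>
    case (4 P' P Q' Q)
    have "P \<in> Arr (Ggpd C)" "Q \<in> Arr (Ggpd C)" "Domain P = Range Q"
      using 4 by (auto elim!: leA_spanE)
    then obtain x y z where xyz: "x \<in> Arr C" "y \<in> Arr C" "z \<in> Arr C" "Dom C x = Dom C y" "Dom C y = Dom C z"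
      "Q = span_class C x y" "P = span_class C y z"
      by (auto elim: composable_spansE simp del: Ggpd_simps)
    obtain h where h: "h \<in> Arr C" "Cod C h = Dom C y" "Q' = span_class C (x \<cdot> h) (y \<cdot> h)"
      using 4(2) xyz by (auto simp: leA_span_class_iff)
    obtain h' where h': "h' \<in> Arr C" "Cod C h' = Dom C y" "P' = span_class C (y \<cdot> h') (z \<cdot> h')"
      using 4(1) xyz by (auto simp: leA_span_class_iff)
    have yh: "y \<cdot> h \<in> Arr C" "y \<cdot> h' \<in> Arr C" "subobj C (y \<cdot> h) = subobj C (y \<cdot> h')"
      using 4(3) xyz h h' by (simp_all add: Range_span_class Cmp_in Dom_Cmp)
    obtain k where k: "iso_arrow C k" "Cod C k = Dom C (y \<cdot> h')" "Dom C k = Dom C (y \<cdot> h)" "y \<cdot> h = (y \<cdot> h') \<cdot> k"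
      using yh by (rule subobj_eqE)
    note k' = iso_in[OF k(1)]
    have "(y \<cdot> h') \<cdot> k = y \<cdot> (h' \<cdot> k)"
      using k(1,2) k' xyz(1-5) h'(1,2) by (simp add: Cmp_assoc Dom_Cmp)
    with k(4) have "y \<cdot> h = y \<cdot> (h' \<cdot> k)" by simp
    then have "h = h' \<cdot> k"
      by - (rule cancel[of y]; use k(1,2) k' xyz(1-5) h(1,2) h'(1,2) in \<open>simp add: Cmp_in Dom_Cmp Cod_Cmp\<close>)
    then have "span_class C (y \<cdot> h) (z \<cdot> h) = span_class C ((y \<cdot> h') \<cdot> k) ((z \<cdot> h') \<cdot> k)"
      using k(1,2) k' xyz(1-5) h'(1,2) by (simp add: Cmp_assoc Dom_Cmp)
    also have "\<dots> = P'"
      unfolding h'(3) using k(1,2) k' xyz(1-5) h'(1,2) by (intro span_class_Cmp_iso) (simp_all add: Cmp_in Dom_Cmp)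
    finally have P': "P' = span_class C (y \<cdot> h) (z \<cdot> h)" by simp
    have "P' \<cdot>\<^bsub>Ggpd C\<^esub> Q' = span_class C (x \<cdot> h) (z \<cdot> h)"
      unfolding P' h(3) using xyz(1-5) h(1,2) by (intro Cmp_span_class) (simp_all add: Cmp_in Dom_Cmp)
    then show ?case
      unfolding xyz(6,7) using xyz(1-5) h(1,2) by (auto simp: Cmp_span_class leA_span_class_iff)
  next
    case (5 P A)
    then obtain m n where mn: "m \<in> Arr C" "n \<in> Arr C" "Dom C m = Dom C n" and P: "P = span_class C m n" by auto
    then obtain h where h: "h \<in> Arr C" "Cod C h = Dom C m" and A: "A = subobj C (m \<cdot> h)"
      using 5(2) by (auto simp: leO_subobj_iff)
    \<comment> \<open>A second restriction along \<open>h'\<close> with the same domain class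
      satisfies \<open>m h = m h' k\<close> with \<open>k\<close> invertible. Cancelling
      \<open>m\<close> gives \<open>h = h' k\<close>, hence the same span class.\<close>
    have unique: "Q = span_class C (m \<cdot> h) (n \<cdot> h)" if Q: "leA (Ggpd C) Q P" "Domain Q = A" for Q
    proof -
      obtain h' where h': "h' \<in> Arr C" "Cod C h' = Dom C m" "Q = span_class C (m \<cdot> h') (n \<cdot> h')"
        using Q(1) mn by (auto simp: P leA_span_class_iff)
      with Q A have "m \<cdot> h \<in> Arr C" "m \<cdot> h' \<in> Arr C" "subobj C (m \<cdot> h) = subobj C (m \<cdot> h')"
        using mn h by (simp_all add: Cmp_in)
      then obtain k where k: "iso_arrow C k" "Cod C k = Dom C (m \<cdot> h')" "Dom C k = Dom C (m \<cdot> h)" "m \<cdot> h = (m \<cdot> h') \<cdot> k"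
        by (rule subobj_eqE)
      note k' = iso_in[OF k(1)]
      have "(m \<cdot> h') \<cdot> k = m \<cdot> (h' \<cdot> k)"
        using k(1,2) k' mn h'(1,2) by (simp add: Cmp_assoc Dom_Cmp)
      with k(4) have "m \<cdot> h = m \<cdot> (h' \<cdot> k)" by simp
      then have "h = h' \<cdot> k"
        by - (rule cancel[of m]; use k(1,2) k' mn h h'(1,2) in \<open>simp add: Cmp_in Dom_Cmp Cod_Cmp\<close>)
      then have "span_class C (m \<cdot> h) (n \<cdot> h) = span_class C ((m \<cdot> h') \<cdot> k) ((n \<cdot> h') \<cdot> k)"
        using k(1,2) k' mn h'(1,2) by (simp add: Cmp_assoc Dom_Cmp)
      also have "\<dots> = Q"
        unfolding h'(3) using k(1,2) k' mn h'(1,2) by (intro span_class_Cmp_iso) (simp_all add: Cmp_in Dom_Cmp)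
      finally show ?thesis by simp
    qed
    have le: "leA (Ggpd C) (span_class C (m \<cdot> h) (n \<cdot> h)) P"
      using mn h by (auto simp: P leA_span_class_iff)
    show ?case
      unfolding Ggpd_simps
    proof (rule ex1I, rule conjI)
      show "leA (Ggpd C) (span_class C (m \<cdot> h) (n \<cdot> h)) P" by (rule le)
      show "Domain (span_class C (m \<cdot> h) (n \<cdot> h)) = A" unfolding A by (rule Domain_span_class)
    qed (rule unique; blast)
  qed
qed

lemma subobj_in: "m \<in> Arr C \<Longrightarrow> subobj C m \<in> Obj (Ggpd C)"
  by auto

lemma restr_span_class:
  assumes "m \<in> Arr C" "n \<in> Arr C" "Dom C m = Dom C n" "h \<in> Arr C" "Cod C h = Dom C m"
  shows "restr (Ggpd C) (span_class C m n) (subobj C (m \<cdot> h)) = span_class C (m \<cdot> h) (n \<cdot> h)"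
proof -
  interpret G: ordered_groupoid "Ggpd C" by (rule ordered_groupoid_Ggpd)
  show ?thesis
    using assms by (intro G.restr_eqI) (auto simp: leA_span_class_iff)
qed

text \<open>Provides the hypothesis on \<open>T\<close> in the equivalence of part (1) when that is
  applied to \<open>G(C)\<close>. Any member \<open>m\<close> of the class \<open>M\<close>
  represents it, so the sieve can be examined over the \<open>m\<close> that occurs in
  \<open>Ttop\<close>.\<close>

lemma vertical_sieve_Ttop:
  assumes sieve: "\<And>A S. \<lbrakk>A \<in> Obj C; S \<in> J A\<rbrakk> \<Longrightarrow> sieve C A S"
    and M: "M \<in> Obj (Ggpd C)" and \<A>: "\<A> \<in> Ttop C J M"
  shows "vertical_sieve (Ggpd C) M \<A>"
proof -
  obtain m S where \<A>: "\<A> = {subobj C (m \<cdot> n) | n. n \<in> S}" and m: "m \<in> M" and S: "S \<in> J (Dom C m)"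
    using \<A> by (auto simp: Ttop_def)
  obtain m' k where "m' \<in> Arr C" "M = subobj C m'" "iso_arrow C k" "Cod C k = Dom C m'" "m = m' \<cdot> k"
    using m M by (auto simp: subobj_def)
  then have m: "m \<in> Arr C" and M: "M = subobj C m"
    using iso_in by (auto simp: Cmp_in subobj_Cmp_iso)
  note sv = sieve[OF Dom_in[OF m] S]
  show ?thesis
    unfolding vertical_sieve_def
  proof (intro conjI ballI allI impI)
    show "\<A> \<subseteq> down (Ggpd C) M"
      using sv m by (auto simp: \<A> M down_def leO_subobj_iff sieve_def)
  next
    fix A' A'' assume "A' \<in> \<A>" and le: "leO (Ggpd C) A'' A'"
    then obtain n where n: "n \<in> S" "n \<in> Arr C" "Cod C n = Dom C m" and A': "A' = subobj C (m \<cdot> n)"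
      using sv by (auto simp: \<A> sieve_def)
    obtain h where h: "h \<in> Arr C" "Cod C h = Dom C n" and A'': "A'' = subobj C ((m \<cdot> n) \<cdot> h)"
      using le n m by (auto simp: A' leO_subobj_iff Cmp_in Dom_Cmp)
    have "n \<cdot> h \<in> S"
      using sv n h by (simp add: sieve_def)
    moreover have "A'' = subobj C (m \<cdot> (n \<cdot> h))"
      using m n h by (simp add: A'' Cmp_assoc)
    ultimately show "A'' \<in> \<A>"
      by (auto simp: \<A>)
  qed
qed

end


section \<open>Comparison of a left-cancellative category with the category of its ordered groupoid\<close>

text \<open>
  Every arrow \<open>[a] \<rightarrow> [n]\<close> of \<open>L(G(C))\<close> is \<open>larr C a n h\<close> for exactly one \<open>h\<close>, and composition of these arrows
  is composition of the \<open>h\<close>'s; this makes \<open>C\<close> and \<open>L(G(C))\<close> equivalent.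
\<close>

definition larr :: "('o, 'a, 'm) cat_scheme \<Rightarrow> 'a \<Rightarrow> 'a \<Rightarrow> 'a \<Rightarrow> ('a \<times> 'a) set \<times> 'a set" where
  "larr C a n h = (span_class C a (n \<cdot>\<^bsub>C\<^esub> h), subobj C n)"

text \<open>Preferring identities as representatives makes \<open>from_Lcat\<close> a strict left inverse of \<open>to_Lcat\<close>.\<close>

definition subobj_rep :: "('o, 'a, 'm) cat_scheme \<Rightarrow> 'a set \<Rightarrow> 'a" where
  "subobj_rep C M = (SOME m. m \<in> M \<and> ((\<exists>A\<in>Obj C. Ide C A \<in> M) \<longrightarrow> m \<in> Ide C ` Obj C))"

definition to_Lcat :: "('o, 'a) cat \<Rightarrow> ('o, 'a, 'a set, ('a \<times> 'a) set \<times> 'a set) fctr" where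
  "to_Lcat C = \<lparr>FObj = (\<lambda>A. subobj C (Ide C A)),
     FArr = (\<lambda>f. larr C (Ide C (Dom C f)) (Ide C (Cod C f)) f)\<rparr>"

definition from_Lcat :: "('o, 'a) cat \<Rightarrow> ('a set, ('a \<times> 'a) set \<times> 'a set, 'o, 'a) fctr" where
  "from_Lcat C = \<lparr>FObj = (\<lambda>M. Dom C (subobj_rep C M)),
     FArr = (\<lambda>(P, N). THE h. h \<in> Arr C \<and> Dom C h = Dom C (subobj_rep C (Domain P)) \<and>
       Cod C h = Dom C (subobj_rep C N) \<and> (P, N) = larr C (subobj_rep C (Domain P)) (subobj_rep C N) h)\<rparr>"

context left_cancellative_category
begin

lemma larr_in:
  assumes "a \<in> Arr C" "n \<in> Arr C" "h \<in> Arr C" "Dom C h = Dom C a" "Cod C h = Dom C n"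
  shows "larr C a n h \<in> Arr (Lcat (Ggpd C))"
    "Dom (Lcat (Ggpd C)) (larr C a n h) = subobj C a" "Cod (Lcat (Ggpd C)) (larr C a n h) = subobj C n"
proof -
  interpret G: ordered_groupoid "Ggpd C" by (rule ordered_groupoid_Ggpd)
  have "leO (Ggpd C) (subobj C (n \<cdot> h)) (subobj C n)"
    using assms by (auto simp: leO_subobj_iff)
  moreover have "span_class C a (n \<cdot> h) \<in> Arr (Ggpd C)"
    using assms by (intro span_class_in) (simp_all add: Cmp_in Dom_Cmp)
  ultimately show "larr C a n h \<in> Arr (Lcat (Ggpd C))"
    using assms by (simp add: larr_def Range_span_class Dom_Cmp del: Ggpd_simps(1,2))
  show "Dom (Lcat (Ggpd C)) (larr C a n h) = subobj C a" "Cod (Lcat (Ggpd C)) (larr C a n h) = subobj C n"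
    by (simp_all add: larr_def)
qed

text \<open>Restricting the span \<open>(n, p k)\<close> to \<open>[n h]\<close> gives
  \<open>(n h, p k h)\<close>, whose first leg is the second leg of the other span.\<close>

lemma larr_Cmp:
  assumes "a \<in> Arr C" "n \<in> Arr C" "p \<in> Arr C"
    and "h \<in> Arr C" "Dom C h = Dom C a" "Cod C h = Dom C n"
    and "k \<in> Arr C" "Dom C k = Dom C n" "Cod C k = Dom C p"
  shows "larr C n p k \<cdot>\<^bsub>Lcat (Ggpd C)\<^esub> larr C a n h = larr C a p (k \<cdot> h)"
proof -
  interpret G: ordered_groupoid "Ggpd C" by (rule ordered_groupoid_Ggpd)
  have "restr (Ggpd C) (span_class C n (p \<cdot> k)) (subobj C (n \<cdot> h)) = span_class C (n \<cdot> h) ((p \<cdot> k) \<cdot> h)"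
    using assms by (intro restr_span_class) (simp_all add: Cmp_in Dom_Cmp)
  moreover have "span_class C (n \<cdot> h) ((p \<cdot> k) \<cdot> h) \<cdot>\<^bsub>Ggpd C\<^esub> span_class C a (n \<cdot> h) = span_class C a ((p \<cdot> k) \<cdot> h)"
    using assms by (intro Cmp_span_class) (simp_all add: Cmp_in Dom_Cmp)
  moreover have "(p \<cdot> k) \<cdot> h = p \<cdot> (k \<cdot> h)"
    using assms by (intro Cmp_assoc) simp_all
  ultimately show ?thesis
    using assms by (simp add: larr_def Range_span_class Dom_Cmp)
qed

lemma larr_Ide: "a \<in> Arr C \<Longrightarrow> larr C a a (Ide C (Dom C a)) = Ide (Lcat (Ggpd C)) (subobj C a)"
  using ordered_groupoid.Lcat_simps(5)[OF ordered_groupoid_Ggpd]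
  by (simp add: larr_def Cmp_Ide_right Id_on_subobj)

text \<open>The source of faithfulness: equal classes differ by some \<open>k\<close> with
  \<open>a = a k\<close>, so \<open>k\<close> is an identity, and cancelling \<open>n\<close> does
  the rest.\<close>

lemma larr_inj:
  assumes "a \<in> Arr C" "n \<in> Arr C"
    and h: "h \<in> Arr C" "Dom C h = Dom C a" "Cod C h = Dom C n"
    and h': "h' \<in> Arr C" "Dom C h' = Dom C a" "Cod C h' = Dom C n"
    and eq: "larr C a n h = larr C a n h'"
  shows "h = h'"
proof -
  have "(a, n \<cdot> h) \<in> span_class C a (n \<cdot> h)"
    using assms(1-5) by (intro span_class_self) (simp_all add: Cmp_in Dom_Cmp)
  also have "span_class C a (n \<cdot> h) = span_class C a (n \<cdot> h')"
    using eq by (simp add: larr_def)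
  finally obtain k where k: "iso_arrow C k" "Cod C k = Dom C a" "a = a \<cdot> k" "n \<cdot> h = (n \<cdot> h') \<cdot> k"
    by (auto simp: span_class_def)
  have "a \<cdot> k = a \<cdot> Ide C (Dom C a)"
    using k(3) Cmp_Ide_right[OF assms(1)] by argo
  then have "k = Ide C (Dom C a)"
    by - (rule cancel[of a]; use assms(1) k(2) iso_in[OF k(1)] in \<open>simp add: Ide_in Cod_Ide Dom_in\<close>)
  then have "n \<cdot> h = n \<cdot> h'"
    using k(4) assms(2) h' Cmp_Ide_right[of "n \<cdot> h'"] by (simp add: Cmp_in Dom_Cmp)
  then show ?thesis
    by - (rule cancel[of n]; use assms in simp)
qed

text \<open>The source of fullness: the horizontal part is rewritten with first leg
  \<open>a\<close>, and its second leg \<open>b\<close> factors through \<open>n\<close> because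
  \<open>[b] \<le> [n]\<close>. The isomorphism \<open>l\<close> between \<open>b\<close> and that
  factorization is absorbed into the result.\<close>

lemma larr_surj:
  assumes x: "x \<in> Arr (Lcat (Ggpd C))" and a: "a \<in> Arr C" "Dom (Lcat (Ggpd C)) x = subobj C a"
    and n: "n \<in> Arr C" "Cod (Lcat (Ggpd C)) x = subobj C n"
  obtains h where "h \<in> Arr C" "Dom C h = Dom C a" "Cod C h = Dom C n" "x = larr C a n h"
proof -
  interpret G: ordered_groupoid "Ggpd C" by (rule ordered_groupoid_Ggpd)
  obtain P where x_def: "x = (P, subobj C n)" and P: "P \<in> Arr (Ggpd C)" "leO (Ggpd C) (Range P) (subobj C n)"
    and Dom_P: "Domain P = subobj C a"
    using x a(2) n(2) by (cases x) (simp del: Ggpd_simps(1,2))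
  obtain a' b' where *: "a' \<in> Arr C" "b' \<in> Arr C" "Dom C a' = Dom C b'" "P = span_class C a' b'"
    using P(1) by auto
  then have "subobj C a = subobj C a'"
    using Dom_P by simp
  with a(1) *(1) obtain k where k: "iso_arrow C k" "Cod C k = Dom C a'" "Dom C k = Dom C a" "a = a' \<cdot> k"
    by (rule subobj_eqE)
  define b where "b = b' \<cdot> k"
  have b: "b \<in> Arr C" "Dom C b = Dom C a"
    using *(1-3) k(1-3) iso_in[OF k(1)] by (simp_all add: b_def Cmp_in Dom_Cmp)
  have P_eq: "P = span_class C a b"
    unfolding b_def k(4) *(4) by (rule span_class_Cmp_iso[symmetric]) (simp_all add: *(1-3) k(1,2))
  obtain h where h: "h \<in> Arr C" "Cod C h = Dom C n" "subobj C b = subobj C (n \<cdot> h)"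
    using P(2) n b by (auto simp: P_eq Range_span_class leO_subobj_iff)
  have "n \<cdot> h \<in> Arr C" using n h by (simp add: Cmp_in)
  with b(1) obtain l where l: "iso_arrow C l" "Cod C l = Dom C (n \<cdot> h)" "Dom C l = Dom C b" "b = (n \<cdot> h) \<cdot> l"
    using h(3) by (rule subobj_eqE)
  have l': "l \<in> Arr C" "Cod C l = Dom C h" "Dom C l = Dom C a"
    using l(2,3) n h b iso_in[OF l(1)] by (simp_all add: Dom_Cmp)
  show ?thesis
  proof (rule that)
    show "h \<cdot> l \<in> Arr C" "Dom C (h \<cdot> l) = Dom C a" "Cod C (h \<cdot> l) = Dom C n"
      using h(1,2) l' by (simp_all add: Cmp_in Dom_Cmp Cod_Cmp)
    have "b = n \<cdot> (h \<cdot> l)"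
      unfolding l(4) using n h(1,2) l' by (intro Cmp_assoc) simp_all
    then show "x = larr C a n (h \<cdot> l)"
      by (simp add: x_def larr_def P_eq)
  qed
qed

text \<open>In \<open>L(G(C))\<close> a subobject is determined up to isomorphism by the domain of a
  representative. In particular \<open>[m]\<close> is isomorphic to the identity subobject of the
  domain of \<open>m\<close>, which gives essential surjectivity of \<open>to_Lcat\<close>.\<close>

lemma iso_larr_Ide:
  assumes "a \<in> Arr C" "b \<in> Arr C" "Dom C a = Dom C b"
  shows "iso_arrow (Lcat (Ggpd C)) (larr C a b (Ide C (Dom C a)))"
proof -
  let ?L = "Lcat (Ggpd C)" and ?I = "Ide C (Dom C a)"
  have I: "?I \<in> Arr C" "Dom C ?I = Dom C a" "Cod C ?I = Dom C a" "?I \<cdot> ?I = ?I"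
    using assms Cmp_Ide_left[of ?I] by (simp_all add: Ide_in Dom_Ide Cod_Ide Dom_in)
  have "inverse_arrows ?L (larr C a b ?I) (larr C b a ?I)"
    unfolding inverse_arrows_def
    using assms I larr_Ide[of a] larr_Ide[of b] by (simp add: larr_in larr_Cmp)
  then show ?thesis
    unfolding iso_arrow_def by (rule exI)
qed

lemma subobj_rep:
  assumes "M \<in> Obj (Ggpd C)"
  shows subobj_rep_in: "subobj_rep C M \<in> Arr C" and subobj_subobj_rep: "subobj C (subobj_rep C M) = M"
proof -
  obtain m where m: "m \<in> Arr C" "M = subobj C m"
    using assms by auto
  have "\<exists>r. r \<in> M \<and> ((\<exists>A\<in>Obj C. Ide C A \<in> M) \<longrightarrow> r \<in> Ide C ` Obj C)"
    using subobj_self[OF m(1)] m(2) by blast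
  then have "subobj_rep C M \<in> M"
    unfolding subobj_rep_def by (rule someI2_ex) blast
  then obtain k where "iso_arrow C k" "Cod C k = Dom C m" "subobj_rep C M = m \<cdot> k"
    unfolding m(2) by (auto simp: subobj_def)
  then show "subobj_rep C M \<in> Arr C" "subobj C (subobj_rep C M) = M"
    using m iso_in by (auto simp: Cmp_in subobj_Cmp_iso)
qed

text \<open>All members of a subobject share their codomain, so it contains at most one identity,
  and the preference for identities leaves no choice here.\<close>

lemma subobj_rep_Ide:
  assumes A: "A \<in> Obj C"
  shows "subobj_rep C (subobj C (Ide C A)) = Ide C A"
proof -
  let ?M = "subobj C (Ide C A)"
  have "Ide C A \<in> ?M"
    using A by (simp add: subobj_self Ide_in)
  with A have "\<exists>r. r \<in> ?M \<and> ((\<exists>A\<in>Obj C. Ide C A \<in> ?M) \<longrightarrow> r \<in> Ide C ` Obj C)"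
    by blast
  then have "subobj_rep C ?M \<in> ?M \<and> ((\<exists>A\<in>Obj C. Ide C A \<in> ?M) \<longrightarrow> subobj_rep C ?M \<in> Ide C ` Obj C)"
    unfolding subobj_rep_def by (rule someI_ex)
  with A \<open>Ide C A \<in> ?M\<close> obtain B where B: "B \<in> Obj C" "subobj_rep C ?M = Ide C B" "Ide C B \<in> ?M"
    by auto
  then obtain k where "iso_arrow C k" "Cod C k = A" "Ide C B = Ide C A \<cdot> k"
    using A by (auto simp: subobj_def Dom_Ide)
  then have "Cod C (Ide C B) = A"
    using A iso_in[of k] by (simp add: Cod_Cmp Ide_in Dom_Ide Cod_Ide)
  with B show ?thesis
    by (simp add: Cod_Ide)
qed

end

lemma to_Lcat_simps [simp]:
  "FObj (to_Lcat C) A = subobj C (Ide C A)"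
  "FArr (to_Lcat C) f = larr C (Ide C (Dom C f)) (Ide C (Cod C f)) f"
  by (simp_all add: to_Lcat_def)

lemma FObj_from_Lcat [simp]: "FObj (from_Lcat C) M = Dom C (subobj_rep C M)"
  by (simp add: from_Lcat_def)

lemma FArr_from_Lcat:
  fixes C :: "('o, 'a) cat"
  assumes "left_cancellative_category C" and M: "M \<in> Obj (Ggpd C)" and N: "N \<in> Obj (Ggpd C)"
    and h: "h \<in> Arr C" "Dom C h = Dom C (subobj_rep C M)" "Cod C h = Dom C (subobj_rep C N)"
  shows "FArr (from_Lcat C) (larr C (subobj_rep C M) (subobj_rep C N) h) = h"
proof -
  interpret left_cancellative_category C by fact
  note M' = subobj_rep[OF M] and N' = subobj_rep[OF N]
  have "(THE h'. h' \<in> Arr C \<and> Dom C h' = Dom C (subobj_rep C M) \<and> Cod C h' = Dom C (subobj_rep C N) \<and>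
      larr C (subobj_rep C M) (subobj_rep C N) h = larr C (subobj_rep C M) (subobj_rep C N) h') = h"
    using h larr_inj[OF M'(1) N'(1)] by (intro the_equality) auto
  then show ?thesis
    by (simp add: from_Lcat_def larr_def M' N')
qed

section \<open>The two functors, with \<open>C\<close> a plain \<open>cat\<close> record as
  \<open>is_functor\<close> requires\<close>

context
  fixes C :: "('o, 'a) cat" (structure)
  assumes lcc: "left_cancellative_category C"
begin

interpretation left_cancellative_category C by (rule lcc)

interpretation G: ordered_groupoid "Ggpd C" by (rule ordered_groupoid_Ggpd)

interpretation L: category "Lcat (Ggpd C)" by (rule G.category_Lcat)

lemma Lcat_arr_cases:
  assumes x: "x \<in> Arr (Lcat (Ggpd C))"
  obtains M N h where "M \<in> Obj (Ggpd C)" "N \<in> Obj (Ggpd C)" "Dom (Lcat (Ggpd C)) x = M" "Cod (Lcat (Ggpd C)) x = N"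
    "h \<in> Arr C" "Dom C h = Dom C (subobj_rep C M)" "Cod C h = Dom C (subobj_rep C N)"
    "x = larr C (subobj_rep C M) (subobj_rep C N) h"
proof -
  let ?M = "Dom (Lcat (Ggpd C)) x" and ?N = "Cod (Lcat (Ggpd C)) x"
  have M: "?M \<in> Obj (Ggpd C)" and N: "?N \<in> Obj (Ggpd C)"
    using L.Dom_in[OF x] L.Cod_in[OF x] unfolding G.Lcat_simps(1) .
  obtain h where "h \<in> Arr C" "Dom C h = Dom C (subobj_rep C ?M)" "Cod C h = Dom C (subobj_rep C ?N)"
    "x = larr C (subobj_rep C ?M) (subobj_rep C ?N) h"
    by (rule larr_surj[OF x subobj_rep_in[OF M] subobj_subobj_rep[OF M, symmetric]
          subobj_rep_in[OF N] subobj_subobj_rep[OF N, symmetric]])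
  with M N show ?thesis
    by (intro that[of ?M ?N]) simp_all
qed

lemma is_functor_to_Lcat: "is_functor C (Lcat (Ggpd C)) (to_Lcat C)"
proof (unfold_locales, goal_cases)
  case (1 A)
  then show ?case by (auto simp: Ide_in)
next
  case (2 f)
  then show ?case
    by (simp add: larr_in Ide_in Dom_in Cod_in Dom_Ide Cod_Ide)
next
  case (5 A)
  then show ?case
    using larr_Ide[of "Ide C A"] by (simp add: Ide_in Dom_Ide Cod_Ide)
next
  case (6 f g)
  then show ?case
    by (simp add: larr_Cmp Ide_in Dom_in Cod_in Dom_Ide Cod_Ide Dom_Cmp Cod_Cmp)
qed (simp_all add: larr_in Ide_in Dom_in Cod_in Dom_Ide Cod_Ide)

lemma is_functor_from_Lcat: "is_functor (Lcat (Ggpd C)) C (from_Lcat C)"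
proof (unfold_locales, goal_cases)
  case (1 M)
  then show ?case by (simp add: subobj_rep_in Dom_in del: Ggpd_simps(1))
next
  case (5 M)
  then have M: "M \<in> Obj (Ggpd C)" by simp
  note M' = subobj_rep[OF M]
  have "Ide (Lcat (Ggpd C)) M = larr C (subobj_rep C M) (subobj_rep C M) (Ide C (Dom C (subobj_rep C M)))"
    using larr_Ide[OF M'(1)] by (simp add: M'(2))
  then show ?case
    using M'(1) by (simp add: FArr_from_Lcat[OF lcc M M] Ide_in Dom_Ide Cod_Ide Dom_in)
next
  case (6 x y)
  obtain M N h where x: "M \<in> Obj (Ggpd C)" "N \<in> Obj (Ggpd C)" "Cod (Lcat (Ggpd C)) x = N"
    and h: "h \<in> Arr C" "Dom C h = Dom C (subobj_rep C M)" "Cod C h = Dom C (subobj_rep C N)"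
    and x_eq: "x = larr C (subobj_rep C M) (subobj_rep C N) h"
    using 6(1) by (rule Lcat_arr_cases)
  obtain N' R k where y: "N' \<in> Obj (Ggpd C)" "R \<in> Obj (Ggpd C)" "Dom (Lcat (Ggpd C)) y = N'"
    and k: "k \<in> Arr C" "Dom C k = Dom C (subobj_rep C N')" "Cod C k = Dom C (subobj_rep C R)"
    and y_eq: "y = larr C (subobj_rep C N') (subobj_rep C R) k"
    using 6(2) by (rule Lcat_arr_cases)
  have [simp]: "N' = N"
    using 6(3) x(3) y(3) by simp
  have "y \<cdot>\<^bsub>Lcat (Ggpd C)\<^esub> x = larr C (subobj_rep C M) (subobj_rep C R) (k \<cdot> h)"
    using x y h k by (simp add: x_eq y_eq larr_Cmp subobj_rep_in del: Ggpd_simps(1))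
  then show ?case
    using h k FArr_from_Lcat[OF lcc x(1) y(2), of "k \<cdot> h"] FArr_from_Lcat[OF lcc x(1,2), of h]
      FArr_from_Lcat[OF lcc x(2) y(2), of k]
    by (simp add: x_eq y_eq Cmp_in Dom_Cmp Cod_Cmp)
qed (auto elim!: Lcat_arr_cases simp: FArr_from_Lcat[OF lcc] larr_in subobj_rep simp del: Ggpd_simps(1))

lemma from_to_Lcat:
  "A \<in> Obj C \<Longrightarrow> FObj (from_Lcat C) (FObj (to_Lcat C) A) = A"
  "f \<in> Arr C \<Longrightarrow> FArr (from_Lcat C) (FArr (to_Lcat C) f) = f"
proof -
  show "FObj (from_Lcat C) (FObj (to_Lcat C) A) = A" if "A \<in> Obj C"
    using that by (simp add: subobj_rep_Ide Dom_Ide)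
  show "FArr (from_Lcat C) (FArr (to_Lcat C) f) = f" if "f \<in> Arr C"
    using that FArr_from_Lcat[OF lcc, of "subobj C (Ide C (Dom C f))" "subobj C (Ide C (Cod C f))" f]
    by (simp add: subobj_rep_Ide subobj_in Ide_in Dom_in Cod_in Dom_Ide del: Ggpd_simps(1))
qed

text \<open>The component at \<open>M\<close> replaces the chosen representative by the identity of
  its domain. After composition each side of the square is given by the same \<open>h\<close>,
  composed with an identity on one side or the other.\<close>

lemma natural_iso_to_from_Lcat:
  "natural_iso (Lcat (Ggpd C)) (Lcat (Ggpd C)) id_fctr (comp_fctr (to_Lcat C) (from_Lcat C))
    (\<lambda>M. larr C (subobj_rep C M) (Ide C (Dom C (subobj_rep C M))) (Ide C (Dom C (subobj_rep C M))))"
  (is "natural_iso ?L ?L _ _ ?\<theta>")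
  unfolding natural_iso_def
proof (intro conjI ballI)
  fix M assume "M \<in> Obj ?L"
  then have M: "M \<in> Obj (Ggpd C)" by simp
  note M' = subobj_rep[OF M]
  show "iso_arrow ?L (?\<theta> M)" "Dom ?L (?\<theta> M) = FObj id_fctr M"
    "Cod ?L (?\<theta> M) = FObj (comp_fctr (to_Lcat C) (from_Lcat C)) M"
    using M' by (simp_all add: iso_larr_Ide larr_in Ide_in Dom_in Dom_Ide Cod_Ide)
next
  fix x assume x: "x \<in> Arr ?L"
  then obtain M N h where MN: "M \<in> Obj (Ggpd C)" "N \<in> Obj (Ggpd C)" "Dom ?L x = M" "Cod ?L x = N"
    and h: "h \<in> Arr C" "Dom C h = Dom C (subobj_rep C M)" "Cod C h = Dom C (subobj_rep C N)"
    and x_eq: "x = larr C (subobj_rep C M) (subobj_rep C N) h"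
    by (rule Lcat_arr_cases)
  note reps = subobj_rep_in[OF MN(1)] subobj_rep_in[OF MN(2)]
  have Fx: "FArr (from_Lcat C) x = h"
    unfolding x_eq using h by (rule FArr_from_Lcat[OF lcc MN(1,2)])
  let ?X = "Dom C (subobj_rep C M)" and ?Y = "Dom C (subobj_rep C N)"
  have "?\<theta> N \<cdot>\<^bsub>?L\<^esub> x = larr C (subobj_rep C M) (Ide C ?Y) (Ide C ?Y \<cdot> h)"
    using reps h by (simp add: x_eq larr_Cmp Ide_in Dom_in Dom_Ide Cod_Ide)
  also have "Ide C ?Y \<cdot> h = h \<cdot> Ide C ?X"
    using h Cmp_Ide_left[of h] Cmp_Ide_right[of h] by simp
  also have "larr C (subobj_rep C M) (Ide C ?Y) \<dots> = larr C (Ide C ?X) (Ide C ?Y) h \<cdot>\<^bsub>?L\<^esub> ?\<theta> M"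
    using reps h by (simp add: larr_Cmp Ide_in Dom_in Dom_Ide Cod_Ide)
  finally show "?\<theta> (Cod ?L x) \<cdot>\<^bsub>?L\<^esub> FArr id_fctr x
      = FArr (comp_fctr (to_Lcat C) (from_Lcat C)) x \<cdot>\<^bsub>?L\<^esub> ?\<theta> (Dom ?L x)"
    using h by (simp only: MN id_fctr_simps comp_fctr_simps to_Lcat_simps Fx)
qed

section \<open>Covering sieves under the two functors\<close>

context
  fixes J :: "'o \<Rightarrow> 'a set set"
  assumes site: "grothendieck_site C J"
begin

interpretation grothendieck_site C J by (rule site)

lemma cover_preserving_to_Lcat:
  "cover_preserving_equivalence C (Lcat (Ggpd C)) (to_Lcat C) J (Jtop (Ggpd C) (Ttop C J))"
proof -
  let ?L = "Lcat (Ggpd C)"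
  interpret F: is_functor C ?L "to_Lcat C" by (rule is_functor_to_Lcat)
  show ?thesis
  proof (unfold_locales, goal_cases)
    case (1 A B g)
    have "Ide C A \<in> Arr C" "Ide C B \<in> Arr C"
      using 1 by (simp_all add: Ide_in)
    with 1 obtain h where "h \<in> Arr C" "Dom C h = Dom C (Ide C A)" "Cod C h = Dom C (Ide C B)"
      "g = larr C (Ide C A) (Ide C B) h"
      by (auto elim: larr_surj)
    with 1 show ?case
      by (intro bexI[of _ h]) (simp_all add: Dom_Ide)
  next
    case (2 f f')
    show ?case
      by (rule larr_inj[of "Ide C (Dom C f)" "Ide C (Cod C f)"])
        (use 2 in \<open>simp_all add: Ide_in Dom_in Cod_in Dom_Ide\<close>)
  next
    case (3 M)
    then have M: "M \<in> Obj (Ggpd C)" by simp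
    note M' = subobj_rep[OF M]
    let ?X = "Dom C (subobj_rep C M)"
    have X: "?X \<in> Obj C"
      using M' by (simp add: Dom_in)
    have "iso_arrow ?L (larr C (Ide C ?X) (subobj_rep C M) (Ide C ?X))"
      using iso_larr_Ide[of "Ide C ?X" "subobj_rep C M"] M' X by (simp add: Ide_in Dom_Ide)
    moreover have "Dom ?L (larr C (Ide C ?X) (subobj_rep C M) (Ide C ?X)) = FObj (to_Lcat C) ?X"
      "Cod ?L (larr C (Ide C ?X) (subobj_rep C M) (Ide C ?X)) = M"
      using M' X by (simp_all add: larr_in Ide_in Dom_Ide Cod_Ide)
    ultimately show ?case
      using X by blast
  next
    case (4 A S)
    then show ?case by (rule covering_sieve)
  next
    case (5 A S)
    let ?R = "{FArr (to_Lcat C) f \<cdot>\<^bsub>?L\<^esub> k | f k. f \<in> S \<and> k \<in> Arr ?L \<and> Cod ?L k = FObj (to_Lcat C) (Dom C f)}"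
    have S_in: "f \<in> Arr C" "Cod C f = A" and closed: "\<lbrakk>h \<in> Arr C; Cod C h = Dom C f\<rbrakk> \<Longrightarrow> f \<cdot> h \<in> S"
      if "f \<in> S" for f h
      using covering_sieve[OF 5] that by (auto simp: sieve_def)
    have "sieve ?L (FObj (to_Lcat C) A) ?R"
      unfolding sieve_def
    proof (intro conjI subsetI ballI impI)
      fix x assume "x \<in> ?R"
      then obtain f k where fk: "f \<in> S" "k \<in> Arr ?L" "Cod ?L k = FObj (to_Lcat C) (Dom C f)"
        and x: "x = FArr (to_Lcat C) f \<cdot>\<^bsub>?L\<^esub> k" by blast
      note f = S_in[OF fk(1)]
      show "x \<in> {x \<in> Arr ?L. Cod ?L x = FObj (to_Lcat C) A}"
        using fk f F.FArr_in[OF f(1)] F.Dom_FArr[OF f(1)] F.Cod_FArr[OF f(1)]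
        by (simp add: x L.Cmp_in L.Cod_Cmp del: to_Lcat_simps)
    next
      fix x y assume "x \<in> ?R" and y: "y \<in> Arr ?L" "Cod ?L y = Dom ?L x"
      then obtain f k where fk: "f \<in> S" "k \<in> Arr ?L" "Cod ?L k = FObj (to_Lcat C) (Dom C f)"
        and x: "x = FArr (to_Lcat C) f \<cdot>\<^bsub>?L\<^esub> k" by blast
      note f = F.FArr_in[OF S_in(1)[OF fk(1)]] F.Dom_FArr[OF S_in(1)[OF fk(1)]]
      have y': "Cod ?L y = Dom ?L k"
        using y(2) fk f by (simp add: x L.Dom_Cmp del: to_Lcat_simps)
      have "x \<cdot>\<^bsub>?L\<^esub> y = FArr (to_Lcat C) f \<cdot>\<^bsub>?L\<^esub> (k \<cdot>\<^bsub>?L\<^esub> y)"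
        unfolding x using y(1) y' fk f by (intro L.Cmp_assoc) (simp_all del: to_Lcat_simps)
      moreover have "k \<cdot>\<^bsub>?L\<^esub> y \<in> Arr ?L" "Cod ?L (k \<cdot>\<^bsub>?L\<^esub> y) = FObj (to_Lcat C) (Dom C f)"
        using y(1) y' fk by (simp_all add: L.Cmp_in L.Cod_Cmp del: to_Lcat_simps)
      ultimately show "x \<cdot>\<^bsub>?L\<^esub> y \<in> ?R"
        using fk(1) by blast
    qed
    \<comment> \<open>Members of the generated sieve are given by composites
      \<open>f \<cdot> h\<close> with \<open>f\<close> in \<open>S\<close>, which lie in
      \<open>S\<close> again. Their codomains thus form the vertical sieve that \<open>Ttop\<close>
      attaches to \<open>S\<close> and the representative \<open>Ide C A\<close>.\<close>
    moreover have "{Range P | P. (P, FObj (to_Lcat C) A) \<in> ?R} = {subobj C (Ide C A \<cdot> n) | n. n \<in> S}"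
    proof (intro equalityI subsetI)
      fix B assume "B \<in> {Range P | P. (P, FObj (to_Lcat C) A) \<in> ?R}"
      then obtain P f k where B: "B = Range P" and P: "(P, FObj (to_Lcat C) A) = FArr (to_Lcat C) f \<cdot>\<^bsub>?L\<^esub> k"
        and fk: "f \<in> S" "k \<in> Arr ?L" "Cod ?L k = FObj (to_Lcat C) (Dom C f)"
        by blast
      note f = S_in[OF fk(1)] and Cod_k = fk(3)[unfolded to_Lcat_simps]
      have "Dom ?L k \<in> Obj (Ggpd C)"
        using L.Dom_in[OF fk(2)] by simp
      then obtain a where a: "a \<in> Arr C" "Dom ?L k = subobj C a" by auto
      have I: "Ide C (Dom C f) \<in> Arr C" "Ide C A \<in> Arr C"
        using f 5 by (simp_all add: Ide_in Dom_in)
      obtain h where h: "h \<in> Arr C" "Dom C h = Dom C a" "Cod C h = Dom C f"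
        and k: "k = larr C a (Ide C (Dom C f)) h"
        using larr_surj[OF fk(2) a I(1) Cod_k] f by (auto simp: Dom_Ide Dom_in)
      have "FArr (to_Lcat C) f \<cdot>\<^bsub>?L\<^esub> k = larr C a (Ide C A) (f \<cdot> h)"
        using f h a I 5 by (simp add: k larr_Cmp Dom_Ide Dom_in)
      then have "P = span_class C a (Ide C A \<cdot> (f \<cdot> h))"
        using P by (simp add: larr_def)
      moreover have "Dom C a = Dom C (Ide C A \<cdot> (f \<cdot> h))"
        using f h I 5 by (simp add: Dom_Cmp Cod_Cmp Cmp_in Dom_Ide)
      ultimately have "B = subobj C (Ide C A \<cdot> (f \<cdot> h))"
        by (simp add: B Range_span_class)
      with closed[OF fk(1) h(1,3)] show "B \<in> {subobj C (Ide C A \<cdot> n) | n. n \<in> S}"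
        by blast
    next
      fix B assume "B \<in> {subobj C (Ide C A \<cdot> n) | n. n \<in> S}"
      then obtain n where n: "n \<in> S" and B: "B = subobj C (Ide C A \<cdot> n)" by blast
      note n' = S_in[OF n]
      let ?P = "span_class C (Ide C (Dom C n)) (Ide C A \<cdot> n)"
      \<comment> \<open>With an identity as second factor, the image of \<open>n\<close> itself
        belongs to the generated sieve.\<close>
      have "FArr (to_Lcat C) n \<cdot>\<^bsub>?L\<^esub> Ide ?L (FObj (to_Lcat C) (Dom C n)) = FArr (to_Lcat C) n"
        using L.Cmp_Ide_right[OF F.FArr_in[OF n'(1)]] unfolding F.Dom_FArr[OF n'(1)] .
      also have "\<dots> = (?P, FObj (to_Lcat C) A)"
        using n' by (simp add: larr_def)
      finally have "(?P, FObj (to_Lcat C) A) = FArr (to_Lcat C) n \<cdot>\<^bsub>?L\<^esub> Ide ?L (FObj (to_Lcat C) (Dom C n))" ..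
      moreover have "FObj (to_Lcat C) (Dom C n) \<in> Obj ?L"
        by (rule F.FObj_in[OF Dom_in[OF n'(1)]])
      ultimately have "(?P, FObj (to_Lcat C) A) \<in> ?R"
        using n L.Ide_in L.Cod_Ide by blast
      moreover have "B = Range ?P"
        using n' 5 by (simp add: B Range_span_class Dom_Cmp Dom_Ide Ide_in Dom_in)
      ultimately show "B \<in> {Range P | P. (P, FObj (to_Lcat C) A) \<in> ?R}"
        by blast
    qed
    moreover have "{subobj C (Ide C A \<cdot> n) | n. n \<in> S} \<in> Ttop C J (FObj (to_Lcat C) A)"
      unfolding Ttop_def to_Lcat_simps
      by (intro CollectI exI[of _ "Ide C A"] exI[of _ S] conjI refl) (simp_all add: 5 subobj_self Ide_in Dom_Ide)
    ultimately show ?case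
      by (simp add: Jtop_def del: to_Lcat_simps)
  qed
qed

lemma cover_preserving_from_Lcat:
  "cover_preserving_equivalence (Lcat (Ggpd C)) C (from_Lcat C) (Jtop (Ggpd C) (Ttop C J)) J"
proof -
  let ?L = "Lcat (Ggpd C)"
  interpret F: is_functor ?L C "from_Lcat C" by (rule is_functor_from_Lcat)
  show ?thesis
  proof (unfold_locales, goal_cases)
    case (1 M N g)
    then have MN: "M \<in> Obj (Ggpd C)" "N \<in> Obj (Ggpd C)" by simp_all
    note M' = subobj_rep[OF MN(1)] and N' = subobj_rep[OF MN(2)]
    let ?x = "larr C (subobj_rep C M) (subobj_rep C N) g"
    have "?x \<in> Arr ?L" "Dom ?L ?x = M" "Cod ?L ?x = N" "FArr (from_Lcat C) ?x = g"
      using 1 M' N' by (simp_all add: larr_in FArr_from_Lcat[OF lcc MN])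
    then show ?case by blast
  next
    case (2 x x')
    obtain M N h where x: "M \<in> Obj (Ggpd C)" "N \<in> Obj (Ggpd C)" "Dom ?L x = M" "Cod ?L x = N"
      and h: "h \<in> Arr C" "Dom C h = Dom C (subobj_rep C M)" "Cod C h = Dom C (subobj_rep C N)"
      and x_eq: "x = larr C (subobj_rep C M) (subobj_rep C N) h"
      using 2(1) by (rule Lcat_arr_cases)
    obtain M' N' h' where x': "M' \<in> Obj (Ggpd C)" "N' \<in> Obj (Ggpd C)" "Dom ?L x' = M'" "Cod ?L x' = N'"
      and h': "h' \<in> Arr C" "Dom C h' = Dom C (subobj_rep C M')" "Cod C h' = Dom C (subobj_rep C N')"
      and x'_eq: "x' = larr C (subobj_rep C M') (subobj_rep C N') h'"
      using 2(2) by (rule Lcat_arr_cases)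
    have [simp]: "M' = M" "N' = N"
      using 2(3,4) x x' by simp_all
    have "h = h'"
      using 2(5) h h' FArr_from_Lcat[OF lcc x(1,2), of h] FArr_from_Lcat[OF lcc x(1,2), of h']
      by (simp add: x_eq x'_eq)
    then show ?case
      by (simp add: x_eq x'_eq)
  next
    case (3 A)
    \<comment> \<open>The object \<open>A\<close> is hit exactly, by its identity subobject, so an
      identity serves as the required isomorphism.\<close>
    have "FObj (to_Lcat C) A \<in> Obj ?L"
      using is_functor.FObj_in[OF is_functor_to_Lcat 3] .
    moreover have "iso_arrow C (Ide C A)" "Dom C (Ide C A) = FObj (from_Lcat C) (FObj (to_Lcat C) A)" "Cod C (Ide C A) = A"
      using 3 by (simp_all only: from_to_Lcat iso_Ide Dom_Ide Cod_Ide)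
    ultimately show ?case by blast
  next
    case (4 M S)
    then show ?case by (simp add: Jtop_def)
  next
    case (5 M S)
    then have M: "M \<in> Obj (Ggpd C)" and sv: "sieve ?L M S"
      and T: "{Range P | P. (P, M) \<in> S} \<in> Ttop C J M"
      by (simp_all add: Jtop_def)
    define r where "r = subobj_rep C M"
    have r: "r \<in> Arr C" "subobj C r = M"
      using subobj_rep[OF M] by (simp_all add: r_def)
    obtain m S' where Ran: "{Range P | P. (P, M) \<in> S} = {subobj C (m \<cdot> n) | n. n \<in> S'}"
      and m: "m \<in> M" and S': "S' \<in> J (Dom C m)"
      using T by (auto simp: Ttop_def)
    \<comment> \<open>\<open>Ttop\<close> describes the cover through some representative
      \<open>m\<close> of \<open>M\<close>, whereas \<open>from_Lcat\<close> works with
      \<open>r\<close>; \<open>u\<close> compares the two.\<close>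
    obtain u where u: "iso_arrow C u" "Cod C u = Dom C r" "m = r \<cdot> u"
      using m unfolding r(2)[symmetric] by (auto simp: subobj_def)
    note inv = inv_arrow[OF u(1)] iso_in[OF u(1)]
    have Dom_m: "Dom C m = Dom C u"
      unfolding u(3) using u(2) inv r by (simp add: Dom_Cmp)
    have cancel_u: "u \<cdot> (inv_arrow C u \<cdot> g) = g" "inv_arrow C u \<cdot> (u \<cdot> g') = g'"
      if "g \<in> Arr C" "Cod C g = Cod C u" "g' \<in> Arr C" "Cod C g' = Dom C u" for g g'
    proof -
      have "u \<cdot> (inv_arrow C u \<cdot> g) = (u \<cdot> inv_arrow C u) \<cdot> g"
        by (rule Cmp_assoc[symmetric]) (use inv that in simp_all)
      then show "u \<cdot> (inv_arrow C u \<cdot> g) = g"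
        using inv Cmp_Ide_left[OF that(1)] that(2) by simp
      have "inv_arrow C u \<cdot> (u \<cdot> g') = (inv_arrow C u \<cdot> u) \<cdot> g'"
        by (rule Cmp_assoc[symmetric]) (use inv that in simp_all)
      then show "inv_arrow C u \<cdot> (u \<cdot> g') = g'"
        using inv Cmp_Ide_left[OF that(3)] that(4) by simp
    qed
    have S'_in: "n \<in> Arr C" "Cod C n = Dom C u" and closed: "\<lbrakk>h \<in> Arr C; Cod C h = Dom C n\<rbrakk> \<Longrightarrow> n \<cdot> h \<in> S'"
      if "n \<in> S'" for n h
      using covering_sieve[OF _ S'] that inv Dom_in by (auto simp: sieve_def Dom_m)
    let ?R = "{FArr (from_Lcat C) x \<cdot> k | x k. x \<in> S \<and> k \<in> Arr C \<and> Cod C k = FObj (from_Lcat C) (Dom ?L x)}"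
    have S_elim: thesis
      if x: "x \<in> S" and thesis: "\<And>s h. \<lbrakk>s \<in> Arr C; h \<in> Arr C; Dom C h = Dom C s; Cod C h = Dom C r; FArr (from_Lcat C) x = h;
        FObj (from_Lcat C) (Dom ?L x) = Dom C h; x = larr C s r h\<rbrakk> \<Longrightarrow> thesis" for x thesis
    proof -
      have "x \<in> Arr ?L" "Cod ?L x = M"
        using x sv by (auto simp: sieve_def)
      then obtain M' h where "M' \<in> Obj (Ggpd C)" "Dom ?L x = M'"
        "h \<in> Arr C" "Dom C h = Dom C (subobj_rep C M')" "Cod C h = Dom C r" "x = larr C (subobj_rep C M') r h"
        unfolding r_def using Lcat_arr_cases by metis
      with M show thesis
        using FArr_from_Lcat[OF lcc, of M' M h]
        by (intro thesis[of "subobj_rep C M'" h]) (simp_all add: r_def subobj_rep_in del: Ggpd_simps(1))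
    qed
    \<comment> \<open>Seen over \<open>r\<close>, the generated sieve consists of the arrows
      \<open>u n\<close> with \<open>n\<close> in \<open>S'\<close>, which are those that the
      inverse of \<open>u\<close> sends into \<open>S'\<close>. Stability of covers under pullback
      then finishes the case.\<close>
    have "?R = pullback_sieve C (inv_arrow C u) S'"
    proof (intro equalityI subsetI)
      fix g assume "g \<in> ?R"
      then obtain x k where g: "g = FArr (from_Lcat C) x \<cdot> k" and x: "x \<in> S"
        and k: "k \<in> Arr C" "Cod C k = FObj (from_Lcat C) (Dom ?L x)" by blast
      obtain s h where s: "s \<in> Arr C" and h: "h \<in> Arr C" "Dom C h = Dom C s" "Cod C h = Dom C r"
        and Fx: "FArr (from_Lcat C) x = h" "FObj (from_Lcat C) (Dom ?L x) = Dom C h" and x_eq: "x = larr C s r h"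
        using x by (rule S_elim)
      have "(span_class C s (r \<cdot> h), M) \<in> S"
        using x by (simp add: x_eq larr_def r)
      then have "Range (span_class C s (r \<cdot> h)) \<in> {subobj C (m \<cdot> n) | n. n \<in> S'}"
        unfolding Ran[symmetric] by blast
      then obtain n where n: "n \<in> S'" "subobj C (r \<cdot> h) = subobj C (m \<cdot> n)"
        using r h s by (auto simp: Range_span_class Dom_Cmp)
      note n' = S'_in[OF n(1)]
      have "r \<cdot> h \<in> Arr C" "m \<cdot> n \<in> Arr C"
        using r h n' inv u(2) by (simp_all add: u(3) Cmp_in Dom_Cmp)
      then obtain v where v: "iso_arrow C v" "Cod C v = Dom C (m \<cdot> n)" "Dom C v = Dom C (r \<cdot> h)" "r \<cdot> h = (m \<cdot> n) \<cdot> v"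
        using n(2) by (rule subobj_eqE)
      have v': "v \<in> Arr C" "Cod C v = Dom C n" "Dom C v = Dom C h"
        using v(2,3) iso_in[OF v(1)] n' r h u(2) inv by (simp_all add: u(3) Cmp_in Dom_Cmp)
      have "(m \<cdot> n) \<cdot> v = r \<cdot> (u \<cdot> (n \<cdot> v))"
        unfolding u(3) using r u(2) inv n' v' by (simp add: Cmp_assoc Cmp_in Dom_Cmp Cod_Cmp)
      with v(4) have "r \<cdot> h = r \<cdot> (u \<cdot> (n \<cdot> v))" by simp
      then have h_eq: "h = u \<cdot> (n \<cdot> v)"
        by - (rule cancel[of r]; use r h u(2) inv n' v' in \<open>simp add: Cmp_in Cod_Cmp\<close>)
      have "g = (u \<cdot> (n \<cdot> v)) \<cdot> k"
        by (simp only: g Fx(1) h_eq)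
      also have "\<dots> = u \<cdot> (n \<cdot> (v \<cdot> k))"
        using inv n' v' k Fx(2) by (simp add: Cmp_assoc Cmp_in Dom_Cmp Cod_Cmp)
      finally have g_eq: "g = u \<cdot> (n \<cdot> (v \<cdot> k))" .
      have nvk: "n \<cdot> (v \<cdot> k) \<in> S'" "n \<cdot> (v \<cdot> k) \<in> Arr C" "Cod C (n \<cdot> (v \<cdot> k)) = Dom C u"
        using n' v' k Fx(2) by (auto intro!: closed[OF n(1)] simp: Cmp_in Cod_Cmp)
      then show "g \<in> pullback_sieve C (inv_arrow C u) S'"
        unfolding pullback_sieve_def g_eq
        using inv cancel_u(2)[of u "n \<cdot> (v \<cdot> k)"] by (simp add: Cmp_in Cod_Cmp)
    next
      fix g assume "g \<in> pullback_sieve C (inv_arrow C u) S'"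
      then have g: "g \<in> Arr C" "Cod C g = Cod C u" "inv_arrow C u \<cdot> g \<in> S'"
        using inv by (auto simp: pullback_sieve_def)
      then have "subobj C (m \<cdot> (inv_arrow C u \<cdot> g)) \<in> {Range P | P. (P, M) \<in> S}"
        unfolding Ran by blast
      moreover have "m \<cdot> (inv_arrow C u \<cdot> g) = r \<cdot> g"
        unfolding u(3) using r u(2) inv g(1,2) cancel_u(1)[of g "Ide C (Dom C u)"]
        by (simp add: Cmp_assoc Cmp_in Cod_Cmp Ide_in Dom_in Cod_Ide)
      \<comment> \<open>Only the codomain of \<open>P\<close> is prescribed, so its factor
        \<open>h\<close> need not be \<open>g\<close> itself. From \<open>[r h] = [r g]\<close> and
        cancellation of \<open>r\<close> one gets \<open>g = h k\<close>, a member of the generated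
        sieve.\<close>
      ultimately obtain P where P: "(P, M) \<in> S" "Range P = subobj C (r \<cdot> g)" by auto
      obtain s h where s: "s \<in> Arr C" and h: "h \<in> Arr C" "Dom C h = Dom C s" "Cod C h = Dom C r"
        and Fx: "FArr (from_Lcat C) (P, M) = h" "FObj (from_Lcat C) (Dom ?L (P, M)) = Dom C h"
        and x_eq: "(P, M) = larr C s r h"
        using P(1) by (rule S_elim)
      have "subobj C (r \<cdot> g) = subobj C (r \<cdot> h)"
        using P(2) x_eq r h s by (simp add: larr_def Range_span_class Dom_Cmp)
      moreover have "r \<cdot> g \<in> Arr C" "r \<cdot> h \<in> Arr C"
        using r h g u(2) by (simp_all add: Cmp_in)
      ultimately obtain k where k: "iso_arrow C k" "Cod C k = Dom C (r \<cdot> h)" "r \<cdot> g = (r \<cdot> h) \<cdot> k"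
        by (metis subobj_eqE)
      have k': "k \<in> Arr C" "Cod C k = Dom C h"
        using k(2) iso_in[OF k(1)] r h by (simp_all add: Dom_Cmp)
      have "(r \<cdot> h) \<cdot> k = r \<cdot> (h \<cdot> k)"
        using r h k' by (intro Cmp_assoc) simp_all
      with k(3) have "r \<cdot> g = r \<cdot> (h \<cdot> k)" by simp
      then have "g = h \<cdot> k"
        by - (rule cancel[of r]; use r g u(2) h k' in \<open>simp add: Cmp_in Cod_Cmp\<close>)
      then have "g = FArr (from_Lcat C) (P, M) \<cdot> k"
        by (simp only: Fx(1))
      moreover have "Cod C k = FObj (from_Lcat C) (Dom ?L (P, M))"
        by (simp only: k'(2) Fx(2))
      ultimately show "g \<in> ?R"
        using P(1) k'(1) by blast
    qed
    moreover have "pullback_sieve C (inv_arrow C u) S' \<in> J (FObj (from_Lcat C) M)"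
      using covering_stable[of "inv_arrow C u" S'] S' inv u(2) Dom_m by (simp add: r_def)
    ultimately show ?case
      by argo
  qed
qed

lemma equivalent_sheaf_category_Lcat_Ggpd:
  "equivalent_categories (sheaf_category C J :: ('o, 'a, 's) psh_cat)
    (sheaf_category (Lcat (Ggpd C)) (Jtop (Ggpd C) (Ttop C J)) :: ('a set, ('a \<times> 'a) set \<times> 'a set, 's) psh_cat)"
  by (rule equivalent_sheaf_categories[OF cover_preserving_to_Lcat cover_preserving_from_Lcat _ _
        natural_iso_to_from_Lcat]) (rule from_to_Lcat; assumption)+

theorem equivalent_sheaf_category_Ggpd:
  "equivalent_categories (sheaf_category C J :: ('o, 'a, 's) psh_cat)
    (ehresmann_sheaf_category (Ggpd C) (Ttop C J) :: ('a set, ('a \<times> 'a) set, 's) opsh_cat)"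
  by (rule equivalent_categories_trans[OF equivalent_sheaf_category_Lcat_Ggpd
        G.equivalent_ehresmann_sheaf_category_Lcat(2)])
    (rule vertical_sieve_Ttop[OF covering_sieve])

end

end

theorem proposition6p5:
  fixes G :: "('o, 'a) ogpd" and T :: "'o \<Rightarrow> 'o set set"
    and C :: "('p, 'b) cat" and J :: "'p \<Rightarrow> 'b set set"
  shows "(ehresmann_site G T \<longrightarrow>
      equivalent_categories
        (ehresmann_sheaf_category G T :: ('o, 'a, 's) opsh_cat)
        (sheaf_category (Lcat G) (Jtop G T) :: ('o, 'a \<times> 'o, 's) psh_cat))
    \<and> (left_cancellative_site C J \<longrightarrow>
      equivalent_categories
        (sheaf_category C J :: ('p, 'b, 't) psh_cat)
        (ehresmann_sheaf_category (Ggpd C) (Ttop C J) :: ('b set, ('b \<times> 'b) set, 't) opsh_cat))"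
proof (intro conjI impI)
  assume "ehresmann_site G T"
  then interpret ehresmann_site G T .
  show "equivalent_categories (ehresmann_sheaf_category G T :: ('o, 'a, 's) opsh_cat)
      (sheaf_category (Lcat G) (Jtop G T) :: ('o, 'a \<times> 'o, 's) psh_cat)"
    by (rule equivalent_ehresmann_sheaf_category_Lcat(1)) (rule ET0)
next
  assume "left_cancellative_site C J"
  then interpret left_cancellative_site C J .
  show "equivalent_categories (sheaf_category C J :: ('p, 'b, 't) psh_cat)
      (ehresmann_sheaf_category (Ggpd C) (Ttop C J) :: ('b set, ('b \<times> 'b) set, 't) opsh_cat)"
    by (rule equivalent_sheaf_category_Ggpd) unfold_locales
qed

end
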